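(* Let $\mu$ be a measure on the Borel subsets of $(0,\infty)$ such that $$0 < \int_0^{\infty} \frac{\lambda}{\lambda^2+1}\, d\mu(\lambda) < \infty ,$$ let $\delta>0$, and let $\nu$ be the measure on Borel subsets $E\subseteq(0,\infty)$ defined by $\nu(E)=\mu(\delta E)$, where $\delta E=\{\delta x: x\in E\}$. With $f_\mu$, $G_\nu$, $L(\lambda,z)$ and $\widehat L(\lambda,t)$ as defined in the context, the following hold. (i) The real entire function $z\mapsto G_\nu(\delta z)$ has exponential type at most $2\pi\delta$. (ii) For real $x\neq0$ the function $\lambda\mapsto e^{-\lambda|x|}-L(\delta^{-1}\lambda,\delta x)$ is nonnegative and integrable on $(0,\infty)$ with respect to $\mu$. (iii) For all real $x$, $$0\le f_\mu(x)-f_\mu(\delta^{-1})-G_\nu(\delta x)=\int_0^\infty\{e^{-\lambda|x|}-L(\delta^{-1}\lambda,\delta x)\}\,d\mu(\lambda).$$ (iv) The nonnegative function $x\mapsto f_\mu(x)-f_\mu(\delta^{-1})-G_\nu(\delta x)$ is integrable on $\mathbb{R}$, and $$\int_{-\infty}^\infty\{f_\mu(x)-f_\mu(\delta^{-1})-G_\nu(\delta x)\}\,dx=\int_0^\infty\left\{\tfrac2\lambda-\tfrac1\delta\operatorname{csch}\left(\tfrac{\lambda}{2\delta}\right)\right\}d\mu(\lambda).$$ (v) If $t\ne0$ then $$\int_{-\infty}^\infty\{f_\mu(x)-f_\mu(\delta^{-1})-G_\nu(\delta x)\}e(-tx)\,dx=\int_0^\infty\frac{2\lambda}{\lambda^2+4\pi^2t^2}\,d\mu(\lambda)-\delta^{-1}\int_0^\infty\widehat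 L(\delta^{-1}\lambda,\delta^{-1}t)\,d\mu(\lambda).$$
   Context: Conventions: a real entire function is an entire function taking real values on $\mathbb{R}$. An entire function $F$ has exponential type at most $\tau$ if for every $\varepsilon>0$ there is $C_\varepsilon$ with $|F(z)|\le C_\varepsilon e^{(\tau+\varepsilon)|z|}$ for all $z\in\mathbb{C}$. Write $e(z)=e^{2\pi i z}$, and $\operatorname{sgn}(x)=1,0,-1$ according as $x>0$, $x=0$, $x<0$. Integrals of nonnegative functions take values in $[0,\infty]$. For $\lambda>0$ define the entire function (with removable singularities removed) $$L(\lambda,z)=\left(\frac{\cos\pi z}{\pi}\right)^2\left\{\sum_{k\in\mathbb{Z}}\frac{e^{-\lambda|k+\frac12|}}{(z-k-\frac12)^2}-\lambda\sum_{l\in\mathbb{Z}}\frac{\operatorname{sgn}(l+\frac12)e^{-\lambda|l+\frac12|}}{z-l-\frac12}\right\}.$$ It is real entire of exponential type $2\pi$, bounded and integrable on $\mathbb{R}$, and $\widehat L(\lambda,t)=\int_{-\infty}^\infty L(\lambda,x)e(-tx)\,dx$, which is continuous in $t$ and supported on $[-1,1]$. For a measure $\rho$ on the Borel subsets of $(0,\infty)$ with $0<\int_0^\infty\frac{\lambda}{\lambda^2+1}\,d\rho(\lambda)<\infty$ (this holds for $\rho=\mu$ and for $\rho=\nu$), define $f_\rho:\mathbb{R}\to\mathbb{R}\cup\{\infty\}$ by $$f_\rho(x)=\int_0^\infty\{e^{-\lambda|x|}-e^{-\lambda}\}\,d\rho(\lambda),$$ where $f_\rho(0)=\int_0^\infty\{1-e^{-\lambda}\}\,d\rho(\lambda)$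 may equal $\infty$. For $x\ne0$, $f_\rho$ is smooth and $f_\rho'(x)=-\operatorname{sgn}(x)\int_0^\infty\lambda e^{-\lambda|x|}\,d\rho(\lambda)$. Define $G_\rho:\mathbb{C}\to\mathbb{C}$ by $$G_\rho(z)=\lim_{N\to\infty}\left(\frac{\cos\pi z}{\pi}\right)^2\left\{\sum_{n=-N}^{N+1}\frac{f_\rho(n-\frac12)}{(z-n+\frac12)^2}+\sum_{n=-N}^{N+1}\frac{f_\rho'(n-\frac12)}{z-n+\frac12}\right\};$$ the limit converges uniformly on compact subsets of $\mathbb{C}$ and defines a real entire function. *)

theory Defs
  imports "HOL-Complex_Analysis.Complex_Analysis"
begin

definition real_entire :: "(complex \<Rightarrow> complex) \<Rightarrow> bool" where
  "real_entire F \<longleftrightarrow> F holomorphic_on UNIV \<and> (\<forall>x::real. F (of_real x) \<in> \<real>)"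

definition exp_type_at_most :: "(complex \<Rightarrow> complex) \<Rightarrow> real \<Rightarrow> bool" where
  "exp_type_at_most F \<tau> \<longleftrightarrow>
     (\<forall>\<epsilon>>0. \<exists>C. \<forall>z. cmod (F z) \<le> C * exp ((\<tau> + \<epsilon>) * cmod z))"

definition e2pi :: "complex \<Rightarrow> complex" where
  "e2pi z = exp (2 * of_real pi * \<i> * z)"

(* Lebesgue integral of an extended real valued function, with values in the extended reals.
   It is meaningful when the positive or the negative part has a finite integral; the
   indeterminate case \<infinity> - \<infinity> does not occur below. *)
definition ereal_integral :: "'a measure \<Rightarrow> ('a \<Rightarrow> ereal) \<Rightarrow> ereal" where
  "ereal_integral M g =
     enn2ereal (\<integral>\<^sup>+x. e2ennreal (g x) \<partial>M) - enn2ereal (\<integral>\<^sup>+x. e2ennreal (- g x) \<partial>M)"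

definition ereal_integrable :: "'a measure \<Rightarrow> ('a \<Rightarrow> ereal) \<Rightarrow> bool" where
  "ereal_integrable M g \<longleftrightarrow>
     g \<in> borel_measurable M \<and> (\<integral>\<^sup>+x. e2ennreal \<bar>g x\<bar> \<partial>M) < \<infinity>"

abbreviation borel_pos :: "real measure" where
  "borel_pos \<equiv> restrict_space borel {0<..}"

definition admissible_measure :: "real measure \<Rightarrow> bool" where
  "admissible_measure \<rho> \<longleftrightarrow> sets \<rho> = sets borel_pos \<and>
     0 < (\<integral>\<^sup>+l. ennreal (l / (l\<^sup>2 + 1)) \<partial>\<rho>) \<and> (\<integral>\<^sup>+l. ennreal (l / (l\<^sup>2 + 1)) \<partial>\<rho>) < \<infinity>"

(* The library operator remove_sings extends a function continuously over its removable
   singularities.  At a half-integer the bracket contains a division by zero, but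
   remove_sings only looks at a punctured neighbourhood of such a point. *)
definition L_fun :: "real \<Rightarrow> complex \<Rightarrow> complex" where
  "L_fun l = remove_sings (\<lambda>z. (cos (of_real pi * z) / of_real pi)\<^sup>2 *
     ((\<Sum>\<^sub>\<infinity>k\<in>(UNIV::int set).
         of_real (exp (- l * \<bar>of_int k + 1/2\<bar>)) / (z - of_int k - 1/2)\<^sup>2)
      - of_real l * (\<Sum>\<^sub>\<infinity>k\<in>(UNIV::int set).
         of_real (sgn (of_int k + 1/2) * exp (- l * \<bar>of_int k + 1/2\<bar>)) / (z - of_int k - 1/2))))"

definition L_hat :: "real \<Rightarrow> real \<Rightarrow> complex" where
  "L_hat l t = (\<integral>x. L_fun l (of_real x) * e2pi (of_real (- t * x)) \<partial>lborel)"

(* Finite for x \<noteq> 0; possibly \<infinity> at x = 0. *)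
definition f_meas :: "real measure \<Rightarrow> real \<Rightarrow> ereal" where
  "f_meas \<rho> x = ereal_integral \<rho> (\<lambda>l. ereal (exp (- l * \<bar>x\<bar>) - exp (- l)))"

definition f_meas' :: "real measure \<Rightarrow> real \<Rightarrow> real" where
  "f_meas' \<rho> x = deriv (\<lambda>y. real_of_ereal (f_meas \<rho> y)) x"

definition G_meas_partial :: "real measure \<Rightarrow> nat \<Rightarrow> complex \<Rightarrow> complex" where
  "G_meas_partial \<rho> N = remove_sings (\<lambda>z. (cos (of_real pi * z) / of_real pi)\<^sup>2 *
     ((\<Sum>n\<in>{- int N..int N + 1}.
         of_real (real_of_ereal (f_meas \<rho> (of_int n - 1/2))) / (z - of_int n + 1/2)\<^sup>2)
      + (\<Sum>n\<in>{- int N..int N + 1}.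
         of_real (f_meas' \<rho> (of_int n - 1/2)) / (z - of_int n + 1/2))))"

definition G_meas :: "real measure \<Rightarrow> complex \<Rightarrow> complex" where
  "G_meas \<rho> z = lim (\<lambda>N. G_meas_partial \<rho> N z)"

(* x \<mapsto> f_\<mu>(x) - f_\<mu>(1/\<delta>) - G_\<nu>(\<delta>x).  The only point where the value can be \<infinity> is x = 0.
   Re is the coercion to the reals of G_\<nu>, which is real on the real axis. *)
definition minorant_gap :: "real measure \<Rightarrow> real measure \<Rightarrow> real \<Rightarrow> real \<Rightarrow> ereal" where
  "minorant_gap \<mu> \<nu> \<delta> x =
     f_meas \<mu> x - f_meas \<mu> (1 / \<delta>) - ereal (Re (G_meas \<nu> (of_real (\<delta> * x))))"

end

theory Submission
  imports Defs "HOL-Probability.Sinc_Integral"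
begin

text \<open>
  Group the interpolation series for \<open>L(l, \<cdot>)\<close> into pairs of nodes \<open>\<plusminus> y\<close>, with \<open>y\<close> a positive
  half-integer. By \<open>\<Sum> 1 / (z - n - 1/2)\<^sup>2 = (\<pi> / cos (\<pi> z))\<^sup>2\<close> the same series with the values
  \<open>exp (- l y) - exp (- l)\<close> in place of \<open>exp (- l y)\<close> sums to \<open>L(l, z) - exp (- l)\<close>. Its terms, summed
  in absolute value, are at most a constant times \<open>(1 + \<bar>z\<bar>)\<^sup>4 exp (2 \<pi> \<bar>z\<bar>) l / (l\<^sup>2 + 1)\<close>; this bound may be
  integrated against the measure \<open>\<rho>\<close>, so \<open>G\<^sub>\<rho>\<close> is entire of exponential type \<open>2 \<pi>\<close> and
  \<open>G\<^sub>\<rho>(x) = \<integral> (L(l, x) - exp (- l)) d\<rho>(l)\<close>. After rescaling, the difference in (iii) is the integral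
  of \<open>exp (- l \<bar>x\<bar>) - L(l / \<delta>, \<delta> x)\<close>, which is nonnegative because it is a positive multiple of the
  Laplace transform of \<open>B(l - w) - B(l + w)\<close> with \<open>B(u) = u / (2 sinh (u / 2))\<close> even and decreasing in
  \<open>\<bar>u\<bar>\<close>. The integral of \<open>L(l, \<cdot>)\<close> follows from the orthonormality of the shifted sinc functions, and
  (iv) and (v) are then the theorems of Tonelli and Fubini.
\<close>

section \<open>Cardinal functions at the half-integers\<close>

text \<open>The measure may have infinite mass near 0 and near infinity, so everything hinges on a
  bound of order l for small l. The obvious one fails: the values 1 - exp(-l y), divided by y^2 and
  summed over the nodes, are of order l log(1/l), and so are the derivatives l exp(-l y), divided by
  y. Pairing y with -y and combining value with derivative repairs this. With q = cos(pi z) / (pi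
  (z^2 - y^2)), a pair with value a and derivative b at y contributes q^2 (2 (a - y b)(y^2 + z^2) +
  4 y b z^2); up to factors depending on z, only |a - y b| / y^2 and |b| / y^3 count. For the
  exponential, a - y b is exp(-l y)(1 + l y) - exp(-l), in which the terms linear in l y cancel, and
  the sum is of order l. This combination is what \<open>weight\<close> measures. Each pair is
  written with products of sinc functions, so it is entire from the start; the quotients of the
  definitions are matched only away from the half-integers.\<close>

definition csinc :: "complex \<Rightarrow> complex" where
  "csinc z = (if z = 0 then 1 else sin z / z)"

lemma holomorphic_csinc: "csinc holomorphic_on UNIV"
proof (rule no_isolated_singularity'[where K = "{0}"])
  have "((\<lambda>z::complex. sin z / z) \<longlongrightarrow> 1) (at 0)"
    using DERIV_sin[of "0::complex"] by (simp add: has_field_derivative_iff)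
  then have "csinc \<midarrow>0\<rightarrow> 1"
    by (rule Lim_transform_eventually) (auto simp: csinc_def eventually_at_filter)
  then show "(csinc \<longlongrightarrow> csinc z) (at z within UNIV)" if "z \<in> {0}" for z
    using that by (simp add: csinc_def)
  have "(\<lambda>z. sin z / z) holomorphic_on UNIV - {0}"
    by (intro holomorphic_intros) auto
  then show "csinc holomorphic_on UNIV - {0}"
    by (rule holomorphic_transform) (auto simp: csinc_def)
qed auto

lemma csinc_of_real: "csinc (of_real x) = of_real (sinc x)"
  by (simp add: csinc_def sin_of_real flip: of_real_divide)

lemma norm_cos_le_exp_Im: "cmod (cos z) \<le> exp \<bar>Im z\<bar>"
proof -
  have "cmod (cos z) = cmod (exp (\<i> * z) + exp (- (\<i> * z))) / 2"
    by (simp add: cos_exp_eq norm_divide)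
  also have "\<dots> \<le> (exp (- Im z) + exp (Im z)) / 2"
    using norm_triangle_ineq[of "exp (\<i> * z)" "exp (- (\<i> * z))"] by simp
  also have "\<dots> \<le> exp \<bar>Im z\<bar>"
    using add_mono[of "exp (- Im z)" "exp \<bar>Im z\<bar>" "exp (Im z)" "exp \<bar>Im z\<bar>"]
      abs_ge_self[of "Im z"] abs_ge_minus_self[of "Im z"] by simp
  finally show ?thesis .
qed

text \<open>The strip of points no farther from the real axis than z is convex, contains 0 and z,
  and |cos| is at most exp |Im z| on it. The mean value inequality for sin from 0 to z then gives
  the bound after division by |z|.\<close>

lemma norm_csinc_le: "cmod (csinc z) \<le> exp \<bar>Im z\<bar>"
proof (cases "z = 0")
  case False
  define S where "S = {u. \<bar>Im u\<bar> \<le> \<bar>Im z\<bar>}"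
  have "S = {u. Im u \<le> \<bar>Im z\<bar>} \<inter> {u. Im u \<ge> - \<bar>Im z\<bar>}"
    unfolding S_def by auto
  then have "convex S"
    by (simp only: convex_Int convex_halfspace_Im_le convex_halfspace_Im_ge)
  then have "cmod (sin z - sin 0) \<le> exp \<bar>Im z\<bar> * cmod (z - 0)"
  proof (rule field_differentiable_bound[where f' = cos])
    show "(sin has_field_derivative cos u) (at u within S)" for u
      by (auto intro!: derivative_eq_intros)
    show "cmod (cos u) \<le> exp \<bar>Im z\<bar>" if "u \<in> S" for u
      using norm_cos_le_exp_Im[of u] that unfolding S_def
      by (smt (verit, best) exp_less_mono mem_Collect_eq)
  qed (auto simp: S_def)
  then show ?thesis
    using False by (simp add: csinc_def norm_divide field_simps)
qed (simp add: csinc_def)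

definition node :: "nat \<Rightarrow> real" where
  "node k = real k + 1/2"

lemma node_ge_half: "node k \<ge> 1/2" and node_pos: "node k > 0" and node_nonzero: "node k \<noteq> 0"
  by (simp_all add: node_def)

lemma cos_node: "cos (pi * node k) = 0"
proof -
  have "pi * node k = real k * pi + pi / 2"
    by (simp add: node_def algebra_simps)
  then show ?thesis
    by (simp add: cos_add)
qed

text \<open>At a half-integer \<open>y\<close> this is \<open>cos (\<pi> z) / (\<pi> (z - y))\<close> with its singularity removed.\<close>

definition nodal :: "real \<Rightarrow> complex \<Rightarrow> complex" where
  "nodal y z = - of_real (sin (pi * y)) * csinc (of_real pi * (z - of_real y))"

lemma holomorphic_nodal [holomorphic_intros]:
  assumes "f holomorphic_on A"
  shows "(\<lambda>z. nodal y (f z)) holomorphic_on A"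
proof -
  have "nodal y holomorphic_on UNIV"
    unfolding nodal_def
    by (intro holomorphic_intros holomorphic_on_compose_gen[OF _ holomorphic_csinc, unfolded o_def]) auto
  then show ?thesis
    using holomorphic_on_compose_gen[OF assms, of "nodal y" UNIV] by (simp add: o_def)
qed

text \<open>At a zero y of cos(pi y), sin(pi (z - y)) is -cos(pi z) sin(pi y) and sin(pi y)^2 = 1.
  The product form remains valid at z = y.\<close>

lemma nodal_mult:
  assumes "cos (pi * y) = 0"
  shows "nodal y z * (z - of_real y) = cos (of_real pi * z) / of_real pi"
proof -
  have "csinc (of_real pi * (z - of_real y)) * (z - of_real y) = sin (of_real pi * (z - of_real y)) / of_real pi"
    by (cases "z = of_real y") (simp_all add: csinc_def)
  then have "nodal y z * (z - of_real y) =
      - of_real (sin (pi * y)) * sin (of_real pi * (z - of_real y)) / of_real pi"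
    unfolding nodal_def by (simp only: mult.assoc times_divide_eq_right)
  also have "sin (of_real pi * (z - of_real y)) =
      - cos (of_real pi * z) * of_real (sin (pi * y))"
    using assms by (simp add: ring_distribs sin_diff sin_of_real cos_of_real flip: of_real_mult)
  also have "- of_real (sin (pi * y)) * (- cos (of_real pi * z) * of_real (sin (pi * y))) =
      cos (of_real pi * z) * of_real ((sin (pi * y))\<^sup>2)"
    by (simp add: power2_eq_square)
  also have "(sin (pi * y))\<^sup>2 = 1"
    using sin_cos_squared_add[of "pi * y"] assms by simp
  finally show ?thesis by simp
qed

lemma nodal_of_real: "nodal y (of_real x) = of_real (- sin (pi * y) * sinc (pi * (x - y)))"
proof -
  have "complex_of_real pi * (of_real x - of_real y) = of_real (pi * (x - y))"
    by simp
  then show ?thesis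
    unfolding nodal_def by (simp only: csinc_of_real) simp
qed

text \<open>A real shift leaves the imaginary part alone, which is why the bound is uniform in
  \<open>y\<close>.\<close>

lemma norm_nodal_le: "cmod (nodal y z) \<le> exp (pi * cmod z)"
proof -
  have "cmod (nodal y z) \<le> 1 * exp \<bar>Im (of_real pi * (z - of_real y))\<bar>"
    unfolding nodal_def norm_mult
    by (intro mult_mono norm_csinc_le) auto
  also have "\<dots> \<le> exp (pi * cmod z)"
    using abs_Im_le_cmod[of z] by (simp add: abs_mult)
  finally show ?thesis .
qed

text \<open>This is cos(pi z) / (pi (z^2 - y^2)) for y = \<open>node k\<close>, with its
  singularities removed: 1/(z - y) - 1/(z + y) equals 2 y / (z^2 - y^2).\<close>

definition nodal_quot :: "nat \<Rightarrow> complex \<Rightarrow> complex" where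
  "nodal_quot k z = (nodal (node k) z - nodal (- node k) z) / of_real (2 * node k)"

lemma nodal_eq_quot:
  "nodal (node k) z = nodal_quot k z * (z + of_real (node k))"
  "nodal (- node k) z = nodal_quot k z * (z - of_real (node k))"
proof -
  have "nodal (node k) z * (z - of_real (node k)) = nodal (- node k) z * (z + of_real (node k))"
    using nodal_mult[OF cos_node, of k z] nodal_mult[of "- node k" z] by (simp add: cos_node)
  then show "nodal (node k) z = nodal_quot k z * (z + of_real (node k))"
    "nodal (- node k) z = nodal_quot k z * (z - of_real (node k))"
    using node_nonzero[of k] by (simp_all add: nodal_quot_def field_simps)
qed

text \<open>If |z| <= y/2, both factors z + y and z - y have modulus at least y/2, which gives the
  decay 1/y^2. Otherwise y < 2 |z|, and a bound of order 1/y can be traded for one of order 1/y^2 at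
  the cost of the factor 1 + |z|.\<close>

lemma norm_nodal_quot_le:
  "cmod (nodal_quot k z) \<le> 4 * exp (pi * cmod z) * (1 + cmod z) / (node k)\<^sup>2"
proof -
  define y where "y = node k"
  define E where "E = exp (pi * cmod z)"
  have y: "y > 0" by (simp add: y_def node_pos)
  have E: "E > 0" by (simp add: E_def)
  have b1: "cmod (nodal_quot k z) * cmod (z + of_real y) \<le> E"
    and b2: "cmod (nodal_quot k z) * cmod (z - of_real y) \<le> E"
    using norm_nodal_le[of y z] norm_nodal_le[of "- y" z]
    by (simp_all add: E_def y_def nodal_eq_quot norm_mult)
  \<comment> \<open>The two factors cannot both be small, so a bound of order 1/y holds even when z
    is close to a node.\<close>
  have tri: "2 * y \<le> cmod (z + of_real y) + cmod (z - of_real y)"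
    using norm_triangle_ineq4[of "z + of_real y" "z - of_real y"] y by simp
  have "cmod (nodal_quot k z) * (2 * y)
      \<le> cmod (nodal_quot k z) * (cmod (z + of_real y) + cmod (z - of_real y))"
    by (intro mult_left_mono tri) auto
  with b1 b2 have b3: "cmod (nodal_quot k z) * y \<le> E"
    by (simp add: algebra_simps)
  show ?thesis
  proof (cases "cmod z \<le> y / 2")
    case True
    have "y / 2 \<le> cmod (z + of_real y)"
      using norm_triangle_ineq4[of "z + of_real y" z] True y by simp
    moreover have "y / 2 \<le> cmod (z - of_real y)"
      using norm_triangle_ineq4[of z "z - of_real y"] True y by simp
    ultimately have "cmod (nodal_quot k z) * (y / 2) * (y / 2)
        \<le> cmod (nodal_quot k z) * cmod (z + of_real y) * cmod (z - of_real y)"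
      using y by (intro mult_mono) auto
    also have "nodal_quot k z * (z + of_real y) * (z - of_real y) = cos (of_real pi * z) / of_real pi"
      using nodal_mult[OF cos_node, of k z] by (simp add: y_def nodal_eq_quot)
    then have "cmod (nodal_quot k z) * cmod (z + of_real y) * cmod (z - of_real y)
        = cmod (cos (of_real pi * z) / of_real pi)"
      by (simp flip: norm_mult)
    also have "\<dots> \<le> cmod (cos (of_real pi * z)) / 1"
      unfolding norm_divide using pi_gt3 by (intro divide_left_mono) auto
    also have "\<dots> \<le> E"
      using norm_cos_le[of "of_real pi * z"] by (simp add: E_def norm_mult)
    finally have "cmod (nodal_quot k z) * y\<^sup>2 \<le> 4 * E"
      by (simp add: power2_eq_square)
    also have "\<dots> \<le> 4 * E * (1 + cmod z)"
      using E by simp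
    finally show ?thesis
      using y by (simp add: y_def E_def field_simps)
  next
    case False
    have "cmod (nodal_quot k z) * y\<^sup>2 \<le> E * y"
      using b3 y by (simp add: power2_eq_square)
    also have "\<dots> \<le> E * (4 * (1 + cmod z))"
      using False E y by (intro mult_left_mono) auto
    finally show ?thesis
      using y by (simp add: y_def E_def field_simps)
  qed
qed

text \<open>The contribution of the nodes \<open>\<plusminus> node k\<close> to the interpolation series of an even function
  with value \<open>a\<close> and derivative \<open>b\<close> at \<open>node k\<close>.\<close>

definition hermite :: "nat \<Rightarrow> real \<Rightarrow> real \<Rightarrow> complex \<Rightarrow> complex" where
  "hermite k a b z =
     of_real a * ((nodal (node k) z)\<^sup>2 + (nodal (- node k) z)\<^sup>2)
     + of_real (2 * node k * b) * (nodal (node k) z * nodal (- node k) z)"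

lemma hermite_diff: "hermite k (a - a') (b - b') z = hermite k a b z - hermite k a' b' z"
  by (simp add: hermite_def algebra_simps)

lemma hermite_scale: "hermite k (c * a) (c * b) z = of_real c * hermite k a b z"
  by (simp add: hermite_def algebra_simps)

lemma holomorphic_hermite: "hermite k a b holomorphic_on A"
  unfolding hermite_def by (intro holomorphic_intros)

lemma hermite_minus: "hermite k a b (- z) = hermite k a b z"
proof -
  have "csinc (- w) = csinc w" for w
    by (simp add: csinc_def)
  then have "nodal y (- z) = - nodal (- y) z" for y
    using \<open>csinc (- _) = _\<close>[of "of_real pi * (z + of_real y)"]
    by (simp add: nodal_def algebra_simps)
  then show ?thesis
    by (simp add: hermite_def algebra_simps)
qed

lemma hermite_in_Reals: "hermite k a b (of_real x) \<in> \<real>"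
  by (simp add: hermite_def nodal_of_real flip: of_real_power of_real_mult of_real_add)

text \<open>The derivative of an even function is odd, hence the opposite signs of the simple
  fractions. Their difference is 2 y / ((z - y)(z + y)), which explains the product of the two nodal
  functions in \<open>hermite\<close>.\<close>

lemma hermite_eq_fractions:
  assumes "z \<noteq> of_real (node k)" "z \<noteq> - of_real (node k)"
  shows "hermite k a b z = (cos (of_real pi * z) / of_real pi)\<^sup>2 *
    (of_real a * (1 / (z - of_real (node k))\<^sup>2 + 1 / (z + of_real (node k))\<^sup>2)
     + of_real b * (1 / (z - of_real (node k)) - 1 / (z + of_real (node k))))"
proof -
  define c where "c = cos (of_real pi * z) / of_real pi"
  define y where "y = complex_of_real (node k)"
  have ne: "z - y \<noteq> 0" "z + y \<noteq> 0"
    using assms by (auto simp: y_def add_eq_0_iff2)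
  have "nodal (node k) z * (z - y) = c" "nodal (- node k) z * (z + y) = c"
    using nodal_mult[OF cos_node, of k z] nodal_mult[of "- node k" z]
    by (simp_all add: y_def c_def cos_node)
  then have n: "nodal (node k) z = c / (z - y)" "nodal (- node k) z = c / (z + y)"
    using ne by (simp_all add: field_simps)
  have "1 / (z - y) - 1 / (z + y) = 2 * y / ((z - y) * (z + y))"
    using ne by (simp add: field_simps)
  then show ?thesis
    unfolding hermite_def n c_def[symmetric] y_def[symmetric]
    by (simp add: power_divide algebra_simps power2_eq_square flip: y_def)
qed

text \<open>The two summands keep track of the cancellation between \<open>a / y\<^sup>2\<close> and \<open>b / y\<close> for large \<open>y\<close>.\<close>

definition weight :: "nat \<Rightarrow> real \<Rightarrow> real \<Rightarrow> real" where
  "weight k a b = \<bar>a - node k * b\<bar> / (node k)\<^sup>2 + \<bar>b\<bar> / node k ^ 3"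

lemma weight_nonneg: "weight k a b \<ge> 0"
  using node_pos[of k] by (simp add: weight_def)

text \<open>The constant is 10 * 4^2: the squared bound for \<open>nodal_quot\<close> contributes 16
  exp(2 pi r)(1 + r)^2 with r = |z|, and the remaining bracket of \<open>norm_hermite_le\<close>
  contributes 10 (1 + r)^2.\<close>

definition growth :: "complex \<Rightarrow> real" where
  "growth z = 160 * exp (2 * pi * cmod z) * (1 + cmod z) ^ 4"

text \<open>Factor out the square of q = \<open>nodal_quot k z\<close>, which is O(1/y^4), and split
  a as (a - y b) + y b. Then only a - y b is multiplied by y^2; the rest, 4 y b z^2, costs no
  further power of y.\<close>

lemma norm_hermite_le: "cmod (hermite k a b z) \<le> growth z * weight k a b"
proof -
  define y where "y = node k"
  define q where "q = nodal_quot k z"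
  define A where "A = \<bar>a - y * b\<bar>"
  define r where "r = cmod z"
  define M where "M = 4 * exp (pi * r) * (1 + r)"
  have y: "y \<ge> 1/2" "y > 0"
    using node_ge_half[of k] by (simp_all add: y_def node_pos)
  have r: "r \<ge> 0" by (simp add: r_def)
  have A: "A \<ge> 0" by (simp add: A_def)
  have "hermite k a b z = q\<^sup>2 *
      (of_real (2 * (a - y * b)) * (of_real (y\<^sup>2) + z\<^sup>2) + of_real (4 * y * b) * z\<^sup>2)"
    unfolding hermite_def nodal_eq_quot unfolding q_def[symmetric] y_def[symmetric]
    by (simp add: power2_eq_square algebra_simps)
  then have "cmod (hermite k a b z) = (cmod q)\<^sup>2 *
      cmod (of_real (2 * (a - y * b)) * (of_real (y\<^sup>2) + z\<^sup>2) + of_real (4 * y * b) * z\<^sup>2)"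
    by (simp add: norm_mult norm_power)
  also have "cmod (of_real (2 * (a - y * b)) * (of_real (y\<^sup>2) + z\<^sup>2) + of_real (4 * y * b) * z\<^sup>2)
     \<le> 2 * A * (y\<^sup>2 + r\<^sup>2) + 4 * y * \<bar>b\<bar> * r\<^sup>2"
  proof (rule order.trans[OF norm_triangle_ineq], intro add_mono)
    have "cmod (of_real (y\<^sup>2) + z\<^sup>2) \<le> y\<^sup>2 + r\<^sup>2"
      using norm_triangle_ineq[of "of_real (y\<^sup>2)" "z\<^sup>2"] by (simp add: norm_power r_def)
    moreover have "\<bar>2 * (a - y * b)\<bar> = 2 * A"
      unfolding A_def abs_mult by simp
    ultimately show "cmod (of_real (2 * (a - y * b)) * (of_real (y\<^sup>2) + z\<^sup>2)) \<le> 2 * A * (y\<^sup>2 + r\<^sup>2)"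
      unfolding norm_mult norm_of_real using A by (simp add: mult_left_mono)
    show "cmod (of_real (4 * y * b) * z\<^sup>2) \<le> 4 * y * \<bar>b\<bar> * r\<^sup>2"
      using y by (simp add: norm_mult norm_power r_def abs_mult)
  qed
  also have "(cmod q)\<^sup>2 \<le> (M / y\<^sup>2)\<^sup>2"
    using norm_nodal_quot_le[of k z] by (intro power_mono) (auto simp: q_def M_def y_def r_def)
  finally have *: "cmod (hermite k a b z) \<le> (M / y\<^sup>2)\<^sup>2 * (2 * A * (y\<^sup>2 + r\<^sup>2) + 4 * y * \<bar>b\<bar> * r\<^sup>2)"
    using A y by (simp add: mult_left_mono mult_right_mono)
  \<comment> \<open>Since y >= 1/2, r^2 is at most 4 y^2 r^2; hence the constant 1 + 4.\<close>
  have "y\<^sup>2 + r\<^sup>2 \<le> 5 * y\<^sup>2 * (1 + r)\<^sup>2"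
  proof -
    have "y\<^sup>2 \<ge> (1/2)\<^sup>2"
      using y by (intro power_mono) auto
    then have "r\<^sup>2 * (1/4) \<le> r\<^sup>2 * y\<^sup>2"
      by (intro mult_left_mono) (auto simp: power2_eq_square)
    moreover have "0 \<le> y\<^sup>2 * r" "0 \<le> y\<^sup>2" "0 \<le> r\<^sup>2 * y\<^sup>2" using r by simp_all
    moreover have "5 * y\<^sup>2 * (1 + r)\<^sup>2 = 5 * y\<^sup>2 + 10 * (y\<^sup>2 * r) + 5 * (r\<^sup>2 * y\<^sup>2)"
      by (simp add: algebra_simps power2_sum)
    ultimately show ?thesis
      by linarith
  qed
  moreover have "r\<^sup>2 \<le> (1 + r)\<^sup>2"
    using r by (intro power_mono) auto
  ultimately have "2 * A * (y\<^sup>2 + r\<^sup>2) + 4 * y * \<bar>b\<bar> * r\<^sup>2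
      \<le> 2 * A * (5 * y\<^sup>2 * (1 + r)\<^sup>2) + 4 * y * \<bar>b\<bar> * (1 + r)\<^sup>2"
    using A y by (intro add_mono mult_left_mono) auto
  also have "\<dots> \<le> 10 * (1 + r)\<^sup>2 * (A * y\<^sup>2 + y * \<bar>b\<bar>)"
    using y by (simp add: algebra_simps)
  finally have "cmod (hermite k a b z) \<le> (M / y\<^sup>2)\<^sup>2 * (10 * (1 + r)\<^sup>2 * (A * y\<^sup>2 + y * \<bar>b\<bar>))"
    using mult_left_mono[of _ _ "(M / y\<^sup>2)\<^sup>2"] * by fastforce
  also have "\<dots> = 10 * M\<^sup>2 * (1 + r)\<^sup>2 * (A / y\<^sup>2 + \<bar>b\<bar> / y ^ 3)"
    using y by (simp add: field_simps power_numeral_reduce)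
  also have "10 * M\<^sup>2 * (1 + r)\<^sup>2 = growth z"
  proof -
    have "exp (2 * pi * r) = (exp (pi * r))\<^sup>2"
      by (simp add: mult.assoc flip: exp_double)
    moreover have "(1 + r) ^ 4 = (1 + r)\<^sup>2 * (1 + r)\<^sup>2"
      by (simp flip: power_add)
    ultimately show ?thesis
      by (simp add: M_def growth_def r_def power_mult_distrib)
  qed
  finally show ?thesis
    by (simp add: weight_def A_def y_def)
qed

section \<open>Even interpolation series\<close>

definition half_integers :: "complex set" where
  "half_integers = range (\<lambda>n::int. of_int n + 1/2)"

lemma of_node_in_half_integers: "of_real (node k) \<in> half_integers" "- of_real (node k) \<in> half_integers"
proof -
  have "of_real (node k) = of_int (int k) + (1/2 :: complex)"
    "- of_real (node k) = of_int (- int k - 1) + (1/2 :: complex)"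
    by (simp_all add: node_def)
  then show "of_real (node k) \<in> half_integers" "- of_real (node k) \<in> half_integers"
    unfolding half_integers_def by blast+
qed

lemma eventually_not_half_integer: "\<forall>\<^sub>F w in at z. w \<notin> half_integers"
proof -
  have "a = b" if ab: "a \<in> half_integers" "b \<in> half_integers" "dist a b < 1" for a b
  proof -
    obtain m n :: int where "a = of_int m + 1/2" "b = of_int n + 1/2"
      using ab(1,2) unfolding half_integers_def by blast
    moreover from this have "dist a b = \<bar>of_int (m - n)\<bar>"
      by (simp add: dist_norm flip: of_int_diff)
    ultimately show ?thesis
      using ab(3) by simp
  qed
  then have "\<not> z islimpt half_integers"
    by (intro discrete_imp_not_islimpt[of 1]) auto
  then show ?thesis
    by (simp add: islimpt_iff_eventually)
qed

text \<open>This is how the definitions made with \<open>remove_sings\<close> are evaluated: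
  agreement with an entire function off the half-integers fixes the value everywhere, also at the
  nodes, where the quotients divide by zero.\<close>

lemma remove_sings_eq_entire:
  assumes "g holomorphic_on UNIV" "\<And>w. w \<notin> half_integers \<Longrightarrow> f w = g w"
  shows "remove_sings f z = g z"
proof (rule remove_sings_eqI)
  have "isCont g z"
    using holomorphic_on_imp_continuous_on[OF assms(1)] by (simp add: continuous_on_eq_continuous_at)
  then have "g \<midarrow>z\<rightarrow> g z"
    by (rule isContD)
  then show "f \<midarrow>z\<rightarrow> g z"
    by (rule Lim_transform_eventually)
      (use eventually_not_half_integer[of z] assms(2) in \<open>auto elim!: eventually_mono\<close>)
qed

lemma growth_mono: "cmod z \<le> cmod w \<Longrightarrow> growth z \<le> growth w"
  unfolding growth_def by (intro mult_mono power_mono) auto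

lemma growth_nonneg: "growth z \<ge> 0"
  by (simp add: growth_def)

section \<open>Convergence, symmetry and growth of the series\<close>

context
  fixes a b :: "nat \<Rightarrow> real"
  assumes summable_weight: "summable (\<lambda>k. weight k (a k) (b k))"
begin

lemma summable_norm_hermite: "summable (\<lambda>k. cmod (hermite k (a k) (b k) z))"
  by (rule summable_comparison_test'[OF summable_mult[OF summable_weight, of "growth z"]])
    (simp add: norm_hermite_le)

lemma summable_hermite: "summable (\<lambda>k. hermite k (a k) (b k) z)"
  using summable_norm_cancel[OF summable_norm_hermite] .

lemma norm_suminf_hermite_le:
  "cmod (\<Sum>k. hermite k (a k) (b k) z) \<le> growth z * (\<Sum>k. weight k (a k) (b k))"
proof -
  have "cmod (\<Sum>k. hermite k (a k) (b k) z) \<le> (\<Sum>k. growth z * weight k (a k) (b k))"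
    by (rule order.trans[OF summable_norm[OF summable_norm_hermite]])
      (intro suminf_le norm_hermite_le summable_norm_hermite summable_mult summable_weight)
  also have "\<dots> = growth z * (\<Sum>k. weight k (a k) (b k))"
    by (rule suminf_mult[OF summable_weight])
  finally show ?thesis .
qed

lemma holomorphic_suminf_hermite: "(\<lambda>z. \<Sum>k. hermite k (a k) (b k) z) holomorphic_on UNIV"
proof (rule holomorphic_uniform_sequence[where f = "\<lambda>n z. \<Sum>k<n. hermite k (a k) (b k) z"])
  fix z :: complex
  have "uniform_limit (cball z 1) (\<lambda>n z. \<Sum>k<n. hermite k (a k) (b k) z)
      (\<lambda>z. \<Sum>k. hermite k (a k) (b k) z) sequentially"
  proof (rule Weierstrass_m_test)
    define R where "R = complex_of_real (cmod z + 1)"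
    show "summable (\<lambda>k. growth R * weight k (a k) (b k))"
      by (intro summable_mult summable_weight)
    fix k w assume "w \<in> cball z 1"
    then have "cmod w \<le> cmod R"
      using norm_triangle_ineq2[of w z] by (simp add: R_def dist_norm norm_minus_commute)
    then have "growth w \<le> growth R"
      by (rule growth_mono)
    then show "cmod (hermite k (a k) (b k) w) \<le> growth R * weight k (a k) (b k)"
      using norm_hermite_le[of k "a k" "b k" w] weight_nonneg[of k "a k" "b k"]
      by (meson mult_right_mono order.trans)
  qed
  then show "\<exists>d. 0 < d \<and> cball z d \<subseteq> UNIV \<and> uniform_limit (cball z d)
      (\<lambda>n z. \<Sum>k<n. hermite k (a k) (b k) z) (\<lambda>z. \<Sum>k. hermite k (a k) (b k) z) sequentially"
    by (intro exI[of _ 1]) auto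
qed (auto intro!: holomorphic_intros holomorphic_hermite)

lemma suminf_hermite_minus: "(\<Sum>k. hermite k (a k) (b k) (- z)) = (\<Sum>k. hermite k (a k) (b k) z)"
  by (simp add: hermite_minus)

lemma suminf_hermite_in_Reals: "(\<Sum>k. hermite k (a k) (b k) (of_real x)) \<in> \<real>"
proof -
  have "(\<Sum>k. hermite k (a k) (b k) (of_real x)) =
      (\<Sum>k. of_real (Re (hermite k (a k) (b k) (of_real x))))"
    using hermite_in_Reals by (simp add: of_real_Re)
  also have "\<dots> = of_real (\<Sum>k. Re (hermite k (a k) (b k) (of_real x)))"
    by (intro suminf_of_real[symmetric] summable_Re summable_hermite)
  finally show ?thesis by simp
qed

lemma exp_type_suminf_hermite: "exp_type_at_most (\<lambda>z. \<Sum>k. hermite k (a k) (b k) z) (2 * pi)"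
  unfolding exp_type_at_most_def
proof (intro allI impI)
  fix \<epsilon> :: real assume \<epsilon>: "\<epsilon> > 0"
  define S where "S = (\<Sum>k. weight k (a k) (b k))"
  \<comment> \<open>Chosen so that 1 + |z| <= K exp(eps |z| / 4); the fourth power in
    \<open>growth\<close> then uses up exactly the spare exponent eps |z|.\<close>
  define K where "K = max 1 (4 / \<epsilon>)"
  have "cmod (\<Sum>k. hermite k (a k) (b k) z) \<le> (S * 160 * K ^ 4) * exp ((2 * pi + \<epsilon>) * cmod z)" for z
  proof -
    have "1 + cmod z \<le> K * (1 + \<epsilon> * cmod z / 4)"
    proof -
      have "4 / \<epsilon> * (\<epsilon> * cmod z / 4) \<le> K * (\<epsilon> * cmod z / 4)"
        unfolding K_def using \<epsilon> by (intro mult_right_mono) auto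
      then have "cmod z \<le> K * (\<epsilon> * cmod z / 4)"
        using \<epsilon> by simp
      moreover have "1 \<le> K" by (simp add: K_def)
      ultimately show ?thesis by (simp add: algebra_simps)
    qed
    also have "\<dots> \<le> K * exp (\<epsilon> * cmod z / 4)"
      by (intro mult_left_mono exp_ge_add_one_self) (simp add: K_def)
    finally have "(1 + cmod z) ^ 4 \<le> (K * exp (\<epsilon> * cmod z / 4)) ^ 4"
      by (intro power_mono) auto
    also have "\<dots> = K ^ 4 * exp (\<epsilon> * cmod z)"
      by (simp add: power_mult_distrib flip: exp_of_nat_mult)
    finally have "growth z \<le> 160 * exp (2 * pi * cmod z) * (K ^ 4 * exp (\<epsilon> * cmod z))"
      unfolding growth_def by (intro mult_left_mono) auto
    also have "\<dots> = 160 * K ^ 4 * exp ((2 * pi + \<epsilon>) * cmod z)"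
      by (simp add: exp_add ring_distribs)
    finally have "growth z \<le> 160 * K ^ 4 * exp ((2 * pi + \<epsilon>) * cmod z)" .
    moreover have "S \<ge> 0"
      unfolding S_def by (intro suminf_nonneg summable_weight weight_nonneg)
    ultimately have "growth z * S \<le> 160 * K ^ 4 * exp ((2 * pi + \<epsilon>) * cmod z) * S"
      by (intro mult_right_mono)
    then show ?thesis
      using norm_suminf_hermite_le[of z] by (simp add: S_def mult_ac)
  qed
  then show "\<exists>C. \<forall>z. cmod (\<Sum>k. hermite k (a k) (b k) z) \<le> C * exp ((2 * pi + \<epsilon>) * cmod z)"
    by blast
qed

end

lemma exp_type_at_most_scale:
  assumes "exp_type_at_most F \<tau>" "\<delta> > 0"
  shows "exp_type_at_most (\<lambda>z. F (of_real \<delta> * z)) (\<tau> * \<delta>)"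
  unfolding exp_type_at_most_def
proof (intro allI impI)
  fix \<epsilon> :: real assume "\<epsilon> > 0"
  with assms obtain C where C: "\<And>z. cmod (F z) \<le> C * exp ((\<tau> + \<epsilon> / \<delta>) * cmod z)"
    unfolding exp_type_at_most_def by (meson divide_pos_pos)
  have "cmod (F (of_real \<delta> * z)) \<le> C * exp ((\<tau> * \<delta> + \<epsilon>) * cmod z)" for z
  proof -
    have "(\<tau> + \<epsilon> / \<delta>) * cmod (of_real \<delta> * z) = (\<tau> * \<delta> + \<epsilon>) * cmod z"
      using assms(2) by (simp add: norm_mult field_simps)
    then show ?thesis
      using C[of "of_real \<delta> * z"] by simp
  qed
  then show "\<exists>C. \<forall>z. cmod (F (of_real \<delta> * z)) \<le> C * exp ((\<tau> * \<delta> + \<epsilon>) * cmod z)"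
    by blast
qed

text \<open>Two logarithmic derivatives of the reflection formula for the Gamma function.\<close>

lemma Polygamma_reflection_complex:
  fixes z :: complex
  assumes "z \<notin> \<int>"
  shows "Polygamma 1 z + Polygamma 1 (1 - z) = (of_real pi / sin (of_real pi * z))\<^sup>2"
proof -
  have sin_nz: "sin (of_real pi * u) \<noteq> 0" if "u \<notin> \<int>" for u :: complex
    using that by (auto simp: sin_eq_0 algebra_simps)
  have nonpos: "u \<notin> \<int>\<^sub>\<le>\<^sub>0" "1 - u \<notin> \<int>\<^sub>\<le>\<^sub>0" if "u \<notin> \<int>" for u :: complex
    using that nonpos_Ints_subset_Ints[where 'a = complex] Ints_diff[OF Ints_1, of "1 - u"] by auto
  have digamma: "Digamma u - Digamma (1 - u) = - of_real pi * cos (of_real pi * u) / sin (of_real pi * u)"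
    if u: "u \<notin> \<int>" for u :: complex
  proof -
    define s where "s = sin (of_real pi * u)"
    have s: "s \<noteq> 0" using sin_nz[OF u] by (simp add: s_def)
    have prod: "Gamma u * Gamma (1 - u) = of_real pi / s"
      by (simp add: Gamma_reflection_complex s_def)
    have "((\<lambda>v. Gamma v * Gamma (1 - v)) has_field_derivative
        Gamma u * Gamma (1 - u) * (Digamma u - Digamma (1 - u))) (at u)"
      by (rule derivative_eq_intros refl nonpos[OF u])+ (simp add: algebra_simps)
    moreover have "((\<lambda>v. of_real pi / sin (of_real pi * v)) has_field_derivative
        - of_real pi * (cos (of_real pi * u) * of_real pi) / s\<^sup>2) (at u)"
      using s by (auto intro!: derivative_eq_intros simp: s_def power2_eq_square)
    ultimately have "of_real pi / s * (Digamma u - Digamma (1 - u)) =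
        - of_real pi * (cos (of_real pi * u) * of_real pi) / s\<^sup>2"
      unfolding prod[symmetric] by (simp add: Gamma_reflection_complex DERIV_unique)
    then have "s / of_real pi * (of_real pi / s * (Digamma u - Digamma (1 - u))) =
        s / of_real pi * (- of_real pi * (cos (of_real pi * u) * of_real pi) / s\<^sup>2)"
      by simp
    then show ?thesis
      using s unfolding s_def by (simp add: power2_eq_square)
  qed
  define s where "s = sin (of_real pi * z)"
  have s: "s \<noteq> 0" using sin_nz[OF assms] by (simp add: s_def)
  have "((\<lambda>u. Digamma u - Digamma (1 - u)) has_field_derivative
      Polygamma 1 z + Polygamma 1 (1 - z)) (at z)"
    by (rule derivative_eq_intros refl nonpos[OF assms])+ simp
  moreover have "((\<lambda>u. - of_real pi * cos (of_real pi * u) / sin (of_real pi * u)) has_field_derivative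
      (of_real pi / s)\<^sup>2) (at z)"
  proof -
    define c where "c = cos (of_real pi * z)"
    have "of_real pi * of_real pi * (s * s + c * c) / (s * s) = (of_real pi / s)\<^sup>2"
      using sin_cos_squared_add[of "of_real pi * z"]
      by (simp add: s_def c_def power2_eq_square del: sin_cos_squared_add)
    moreover have "((\<lambda>u. - of_real pi * cos (of_real pi * u) / sin (of_real pi * u)) has_field_derivative
        of_real pi * of_real pi * (s * s + c * c) / (s * s)) (at z)"
      by (rule derivative_eq_intros refl s[unfolded s_def])+ (unfold s_def[symmetric] c_def[symmetric], use s in \<open>simp add: field_simps\<close>)
    ultimately show ?thesis
      by simp
  qed
  then have "((\<lambda>u. Digamma u - Digamma (1 - u)) has_field_derivative (of_real pi / s)\<^sup>2) (at z)"
    by (rule has_field_derivative_transform_within_open[where S = "- \<int>"])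
      (use assms in \<open>auto simp: digamma open_Compl closed_Ints\<close>)
  ultimately show ?thesis
    unfolding s_def by (rule DERIV_unique)
qed

section \<open>The interpolation series of the constant 1\<close>

lemma summable_inverse_node_squared: "summable (\<lambda>k. 1 / (node k)\<^sup>2)"
proof (rule summable_comparison_test')
  show "summable (\<lambda>k. 4 * inverse (real (Suc k) ^ 2))"
    using inverse_power_summable[of 2, where 'a = real] by (subst summable_Suc_iff) auto
  fix k
  have "real (Suc k) \<le> 2 * node k" by (simp add: node_def)
  then have "(real (Suc k))\<^sup>2 \<le> (2 * node k)\<^sup>2"
    by (intro power_mono) auto
  then show "norm (1 / (node k)\<^sup>2) \<le> 4 * inverse (real (Suc k) ^ 2)"
    using node_pos[of k] by (simp add: divide_simps)
qed

lemma summable_weight_1_0: "summable (\<lambda>k. weight k 1 0)"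
  using summable_inverse_node_squared by (simp add: weight_def)

text \<open>With w = z + 1/2, the trigamma series at w runs over the negative nodes and the one at 1
  - w over the positive nodes. By reflection the two together give (pi / cos(pi z))^2.\<close>

lemma sums_hermite_1_0_aux:
  assumes "z \<notin> half_integers"
  shows "(\<Sum>k. hermite k 1 0 z) = 1"
proof -
  define w where "w = z + 1/2"
  have w: "w \<notin> \<int>"
  proof
    assume "w \<in> \<int>"
    then obtain n where "w = of_int n" by (auto elim: Ints_cases)
    then have "z = of_int (n - 1) + 1/2" by (simp add: w_def algebra_simps)
    with assms show False unfolding half_integers_def by blast
  qed
  have sums: "(\<lambda>k. inverse ((u + of_nat k)\<^sup>2)) sums Polygamma 1 u" if "u \<notin> \<int>" for u :: complex
  proof -
    from that have "u \<noteq> 0" by auto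
    then show ?thesis
      using summable_sums[OF Polygamma_converges'[of u 2]] by (simp add: Polygamma_def numeral_2_eq_2)
  qed
  have "(\<lambda>k. inverse ((w + of_nat k)\<^sup>2) + inverse ((1 - w + of_nat k)\<^sup>2)) sums
      (Polygamma 1 w + Polygamma 1 (1 - w))"
    using Ints_diff[OF Ints_1, of "1 - w"] w by (intro sums_add sums) auto
  moreover have "inverse ((w + of_nat k)\<^sup>2) + inverse ((1 - w + of_nat k)\<^sup>2) =
      1 / (z - of_real (node k))\<^sup>2 + 1 / (z + of_real (node k))\<^sup>2" for k
  proof -
    have "w + of_nat k = z + of_real (node k)" "1 - w + of_nat k = - (z - of_real (node k))"
      by (simp_all add: w_def node_def)
    then show ?thesis by (simp only: power2_minus) (simp add: divide_inverse)
  qed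
  ultimately have "(\<lambda>k. 1 / (z - of_real (node k))\<^sup>2 + 1 / (z + of_real (node k))\<^sup>2) sums
      (of_real pi / sin (of_real pi * w))\<^sup>2"
    using Polygamma_reflection_complex[OF w] by simp
  moreover have sc: "sin (of_real pi * w) = cos (of_real pi * z)"
  proof -
    have "of_real pi * w = of_real pi * z + of_real (pi / 2)"
      by (simp add: w_def algebra_simps)
    then show ?thesis
      by (simp only: sin_add sin_of_real cos_of_real) simp
  qed
  moreover have "sin (of_real pi * w) \<noteq> 0"
    using w by (auto simp: sin_eq_0 algebra_simps)
  ultimately have "(\<lambda>k. (cos (of_real pi * z) / of_real pi)\<^sup>2 *
      (1 / (z - of_real (node k))\<^sup>2 + 1 / (z + of_real (node k))\<^sup>2)) sums 1"
    using sums_mult[of _ "(of_real pi / cos (of_real pi * z))\<^sup>2" "(cos (of_real pi * z) / of_real pi)\<^sup>2"]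
    by (simp add: power2_eq_square)
  moreover have "hermite k 1 0 z = (cos (of_real pi * z) / of_real pi)\<^sup>2 *
      (1 / (z - of_real (node k))\<^sup>2 + 1 / (z + of_real (node k))\<^sup>2)" for k
    using assms of_node_in_half_integers[of k] by (subst hermite_eq_fractions) auto
  ultimately show ?thesis
    by (simp add: sums_iff)
qed

text \<open>The identity extends across the half-integers because the series is entire. It permits
  subtracting a constant from all node values, and expanding exp(-l x) for fixed x over the same
  nodes as L.\<close>

lemma sums_hermite_1_0: "(\<lambda>k. hermite k 1 0 z) sums 1"
proof -
  have "remove_sings (\<lambda>_. 1) z = (\<Sum>k. hermite k 1 0 z)"
    by (rule remove_sings_eq_entire[OF holomorphic_suminf_hermite[OF summable_weight_1_0]])
      (simp add: sums_hermite_1_0_aux)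
  moreover have "remove_sings (\<lambda>_. 1) z = 1"
    by (rule remove_sings_eqI) simp
  ultimately show ?thesis
    using summable_hermite[OF summable_weight_1_0, of z] by (simp add: sums_iff)
qed

section \<open>The interpolation series of the exponential\<close>

text \<open>Chosen to cover both regimes of \<open>sum_weight_exp_le\<close>. With S the sum of the
  inverse squares, l <= 1 needs 4 + 3 S, doubled because l <= 2 l / (l^2 + 1) there, and l > 1 needs
  11 * 32 * S = 352 S.\<close>

definition weight_const :: real where
  "weight_const = 8 + 400 * (\<Sum>k. 1 / (node k)\<^sup>2)"

lemma sum_inverse_node_squared:
  "(\<Sum>k<N. 1 / (node k)\<^sup>2) \<le> (\<Sum>k. 1 / (node k)\<^sup>2)"
  by (intro sum_le_suminf summable_inverse_node_squared) auto

lemma weight_const_nonneg: "weight_const \<ge> 0"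
  unfolding weight_const_def using suminf_nonneg[OF summable_inverse_node_squared] by simp

lemma inverse_node_cube_le: "1 / node k ^ 3 \<le> 2 / (node k)\<^sup>2"
  using node_ge_half[of k] node_pos[of k] by (simp add: field_simps power_numeral_reduce)

text \<open>The inequalities exp u >= 1 + u and exp(-u) >= 1 - u give the bounds 0 and min(1, u^2).
  The latter is put into the form u^2 / (1 + u)^2 because for u = l y, divided by y^2, this can be
  compared with a telescoping sum.\<close>

lemma one_minus_exp_le:
  fixes u :: real
  assumes "u \<ge> 0"
  shows "0 \<le> 1 - exp (- u) * (1 + u)" "1 - exp (- u) * (1 + u) \<le> 4 * (u\<^sup>2 / (1 + u)\<^sup>2)"
proof -
  have "exp (- u) * (1 + u) \<le> exp (- u) * exp u"
    by (intro mult_left_mono exp_ge_add_one_self) auto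
  then show "0 \<le> 1 - exp (- u) * (1 + u)"
    by (simp flip: exp_add)
  have "1 - exp (- u) * (1 + u) \<le> min 1 (u\<^sup>2)"
  proof -
    have "(1 - u) * (1 + u) \<le> exp (- u) * (1 + u)"
      using exp_ge_add_one_self[of "- u"] assms by (intro mult_right_mono) auto
    moreover have "0 \<le> exp (- u) * (1 + u)"
      using assms by simp
    ultimately show ?thesis
      by (simp add: algebra_simps power2_eq_square)
  qed
  also have "\<dots> \<le> 4 * (u\<^sup>2 / (1 + u)\<^sup>2)"
  proof (cases "u \<le> 1")
    case True
    have "(1 + u)\<^sup>2 \<le> 2\<^sup>2" using True assms by (intro power_mono) auto
    then have "u\<^sup>2 * (1 + u)\<^sup>2 \<le> u\<^sup>2 * 4" by (intro mult_left_mono) auto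
    then have "u\<^sup>2 \<le> 4 * (u\<^sup>2 / (1 + u)\<^sup>2)" using assms by (simp add: field_simps)
    then show ?thesis by linarith
  next
    case False
    have "(1 + u)\<^sup>2 \<le> (2 * u)\<^sup>2" using False by (intro power_mono) auto
    then have "1 \<le> 4 * (u\<^sup>2 / (1 + u)\<^sup>2)" using False by (simp add: field_simps)
    then show ?thesis by linarith
  qed
  finally show "1 - exp (- u) * (1 + u) \<le> 4 * (u\<^sup>2 / (1 + u)\<^sup>2)" .
qed

text \<open>The node is the midpoint of k and k + 1, so (1 + l y)^2 exceeds the product of the
  values of 1 + l t at these endpoints by l^2 / 4. Dividing l^2 by that product gives a telescoping
  difference.\<close>

lemma sum_telescoping_le:
  assumes l: "l \<ge> (0::real)"
  shows "(\<Sum>k<N. l\<^sup>2 / (1 + l * node k)\<^sup>2) \<le> l"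
proof -
  have "(\<Sum>k<N. l\<^sup>2 / (1 + l * node k)\<^sup>2) \<le> (\<Sum>k<N. l / (1 + l * real k) - l / (1 + l * real (Suc k)))"
  proof (rule sum_mono)
    fix k
    define p q where "p = 1 + l * real k" and "q = 1 + l * real (Suc k)"
    have pq: "p > 0" "q > 0"
      using l by (simp_all add: p_def q_def add_pos_nonneg)
    have "(1 + l * node k)\<^sup>2 = p * q + l\<^sup>2 / 4"
      by (simp add: p_def q_def node_def power2_eq_square field_simps)
    then have "l\<^sup>2 / (1 + l * node k)\<^sup>2 \<le> l\<^sup>2 / (p * q)"
      using pq by (intro divide_left_mono) (auto simp: add_pos_nonneg)
    also have "\<dots> = l / p - l / q"
    proof -
      have "q - p = l" by (simp add: p_def q_def algebra_simps)
      then show ?thesis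
        using pq by (simp add: diff_frac_eq power2_eq_square flip: right_diff_distrib)
    qed
    finally show "l\<^sup>2 / (1 + l * node k)\<^sup>2 \<le> l / (1 + l * real k) - l / (1 + l * real (Suc k))"
      by (simp add: p_def q_def)
  qed
  also have "\<dots> = l - l / (1 + l * real N)"
    using sum_lessThan_telescope'[of "\<lambda>k. l / (1 + l * real k)" N] by simp
  also have "\<dots> \<le> l"
    using l by simp
  finally show ?thesis .
qed

text \<open>For l <= 1, exp(-l y)(1 + l y) and exp(-l) are both compared with 1: the first error
  telescopes, and the second is at most l at each node. For l > 1 both terms decay exponentially,
  because no node is below 1/2.\<close>

lemma sum_weight_exp_le:
  assumes l: "l > 0"
  shows "(\<Sum>k<N. weight k (exp (- l * node k) - exp (- l)) (- l * exp (- l * node k)))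
    \<le> weight_const * (l / (l\<^sup>2 + 1))"
proof -
  define S where "S = (\<Sum>k. 1 / (node k)\<^sup>2)"
  have S: "S \<ge> 0"
    unfolding S_def by (intro suminf_nonneg summable_inverse_node_squared) auto
  have weight: "weight k (exp (- l * node k) - exp (- l)) (- l * exp (- l * node k))
      = \<bar>exp (- (l * node k)) * (1 + l * node k) - exp (- l)\<bar> / (node k)\<^sup>2
        + l * exp (- (l * node k)) / node k ^ 3" for k
    using l by (simp add: weight_def algebra_simps)
  show ?thesis
  proof (cases "l \<le> 1")
    case True
    have "(\<Sum>k<N. weight k (exp (- l * node k) - exp (- l)) (- l * exp (- l * node k)))
        \<le> (\<Sum>k<N. 4 * (l\<^sup>2 / (1 + l * node k)\<^sup>2) + 3 * l * (1 / (node k)\<^sup>2))"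
    proof (rule sum_mono)
      fix k
      define y where "y = node k"
      have y: "y > 0" by (simp add: y_def node_pos)
      have u: "l * y \<ge> 0" using l y by simp
      have "1 - exp (- l) \<le> l" using exp_ge_add_one_self[of "- l"] by simp
      moreover have "exp (- l) \<le> 1" using l by simp
      ultimately have "\<bar>exp (- (l * y)) * (1 + l * y) - exp (- l)\<bar>
          \<le> (1 - exp (- (l * y)) * (1 + l * y)) + l"
        using one_minus_exp_le(1)[OF u] by linarith
      also have "\<dots> \<le> 4 * ((l * y)\<^sup>2 / (1 + l * y)\<^sup>2) + l"
        using one_minus_exp_le(2)[OF u] by linarith
      finally have "\<bar>exp (- (l * y)) * (1 + l * y) - exp (- l)\<bar> / y\<^sup>2
          \<le> (4 * ((l * y)\<^sup>2 / (1 + l * y)\<^sup>2) + l) / y\<^sup>2"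
        by (intro divide_right_mono) auto
      also have "\<dots> = 4 * (l\<^sup>2 / (1 + l * y)\<^sup>2) + l * (1 / y\<^sup>2)"
        using y by (simp add: power_mult_distrib add_divide_distrib)
      finally have 1: "\<bar>exp (- (l * y)) * (1 + l * y) - exp (- l)\<bar> / y\<^sup>2
          \<le> 4 * (l\<^sup>2 / (1 + l * y)\<^sup>2) + l * (1 / y\<^sup>2)" .
      have "l * exp (- (l * y)) * (1 / y ^ 3) \<le> (l * 1) * (2 / y\<^sup>2)"
        using l u y inverse_node_cube_le[of k] by (intro mult_mono) (auto simp: y_def)
      then have "l * exp (- (l * y)) / y ^ 3 \<le> 2 * l * (1 / y\<^sup>2)"
        by (simp add: mult.commute)
      with 1 show "weight k (exp (- l * node k) - exp (- l)) (- l * exp (- l * node k))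
          \<le> 4 * (l\<^sup>2 / (1 + l * node k)\<^sup>2) + 3 * l * (1 / (node k)\<^sup>2)"
        unfolding weight unfolding y_def[symmetric] by linarith
    qed
    also have "\<dots> = 4 * (\<Sum>k<N. l\<^sup>2 / (1 + l * node k)\<^sup>2) + 3 * l * (\<Sum>k<N. 1 / (node k)\<^sup>2)"
      by (simp only: sum.distrib sum_distrib_left)
    also have "\<dots> \<le> 4 * l + 3 * l * S"
      unfolding S_def using l
      by (intro add_mono mult_left_mono sum_telescoping_le sum_inverse_node_squared) auto
    also have "\<dots> \<le> (8 + 400 * S) * (l / 2)"
      using l S by (simp add: algebra_simps)
    also have "\<dots> \<le> (8 + 400 * S) * (l / (l\<^sup>2 + 1))"
      using l S True power_mono[of l 1 2] by (intro mult_left_mono divide_left_mono) (auto simp: add_nonneg_pos)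
    finally show ?thesis by (simp add: weight_const_def S_def)
  next
    case False
    \<comment> \<open>For y >= 1/2, half of the exponent l y is worth at least l / 4; the rest
      absorbs the factors 1 + l y and l. The two parts of the weight cost 3 D and 8 D, together 11
      D.\<close>
    define D where "D = exp (- (l / 4))"
    have D: "D > 0" by (simp add: D_def)
    have "(\<Sum>k<N. weight k (exp (- l * node k) - exp (- l)) (- l * exp (- l * node k)))
        \<le> (\<Sum>k<N. 11 * D * (1 / (node k)\<^sup>2))"
    proof (rule sum_mono)
      fix k
      define y where "y = node k"
      have y: "y > 0" "y \<ge> 1/2" using node_ge_half[of k] by (simp_all add: y_def node_pos)
      have u: "l * y \<ge> 0" using l y by simp
      have half: "exp (- (l * y / 2)) \<le> D"
        using l y by (simp add: D_def)
      have "exp (- (l * y)) * (1 + l * y) \<le> exp (- (l * y)) * (2 * exp (l * y / 2))"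
      proof (rule mult_left_mono)
        show "1 + l * y \<le> 2 * exp (l * y / 2)"
          using exp_ge_add_one_self[of "l * y / 2"] by linarith
      qed auto
      also have "\<dots> = 2 * exp (- (l * y / 2))"
        by (simp flip: exp_add)
      finally have "exp (- (l * y)) * (1 + l * y) \<le> 2 * D"
        using half by linarith
      moreover have "exp (- l) \<le> D" using l by (simp add: D_def)
      moreover have "exp (- (l * y)) * (1 + l * y) \<ge> 0" using u by simp
      moreover have "exp (- l) \<ge> 0" by simp
      ultimately have "\<bar>exp (- (l * y)) * (1 + l * y) - exp (- l)\<bar> \<le> 3 * D"
        by linarith
      then have "\<bar>exp (- (l * y)) * (1 + l * y) - exp (- l)\<bar> / y\<^sup>2 \<le> 3 * D / y\<^sup>2"
        by (intro divide_right_mono) auto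
      then have 1: "\<bar>exp (- (l * y)) * (1 + l * y) - exp (- l)\<bar> / y\<^sup>2 \<le> 3 * D * (1 / y\<^sup>2)"
        by simp
      have "l * exp (- (l * y)) \<le> 4 * exp (l / 4) * exp (- (l / 2))"
      proof (rule mult_mono)
        show "l \<le> 4 * exp (l / 4)"
          using exp_ge_add_one_self[of "l / 4"] by linarith
        show "exp (- (l * y)) \<le> exp (- (l / 2))"
          using l y by simp
      qed auto
      also have "\<dots> = 4 * D" by (simp add: D_def flip: exp_add)
      finally have "l * exp (- (l * y)) * (1 / y ^ 3) \<le> (4 * D) * (2 / y\<^sup>2)"
        using D y inverse_node_cube_le[of k] by (intro mult_mono[of "l * exp (- (l * y))"]) (auto simp: y_def)
      then have "l * exp (- (l * y)) / y ^ 3 \<le> 8 * D * (1 / y\<^sup>2)"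
        by simp
      with 1 show "weight k (exp (- l * node k) - exp (- l)) (- l * exp (- l * node k))
          \<le> 11 * D * (1 / (node k)\<^sup>2)"
        unfolding weight unfolding y_def[symmetric] by linarith
    qed
    also have "\<dots> = 11 * D * (\<Sum>k<N. 1 / (node k)\<^sup>2)"
      by (simp only: sum_distrib_left)
    also have "\<dots> \<le> 11 * D * S"
      unfolding S_def using D by (intro mult_left_mono sum_inverse_node_squared) auto
    \<comment> \<open>The 32 comes from the quadratic Taylor term (l/4)^2 / 2 of exp(l/4).\<close>
    also have "D \<le> 32 * (l / (l\<^sup>2 + 1))"
    proof -
      have "(l\<^sup>2 + 1) / 32 \<le> exp (l / 4)"
        using exp_lower_Taylor_quadratic[of "l / 4"] l by (simp add: power2_eq_square)
      then have "D \<le> 32 * (1 / (l\<^sup>2 + 1))"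
        by (simp add: D_def exp_minus divide_simps add_nonneg_pos mult.commute)
      also have "\<dots> \<le> 32 * (l / (l\<^sup>2 + 1))"
        using False by (intro mult_left_mono divide_right_mono) auto
      finally show ?thesis .
    qed
    then have "11 * D * S \<le> 11 * (32 * (l / (l\<^sup>2 + 1))) * S"
      using S by (intro mult_left_mono mult_right_mono) auto
    also have "\<dots> = (352 * S) * (l / (l\<^sup>2 + 1))"
      by simp
    also have "\<dots> \<le> (8 + 400 * S) * (l / (l\<^sup>2 + 1))"
      using S l by (intro mult_right_mono) (auto simp: add_nonneg_pos)
    finally show ?thesis by (simp add: weight_const_def S_def)
  qed
qed

lemma weight_add: "weight k (a + a') (b + b') \<le> weight k a b + weight k a' b'"
proof -
  have "\<bar>(a + a') - node k * (b + b')\<bar> \<le> \<bar>a - node k * b\<bar> + \<bar>a' - node k * b'\<bar>"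
    by (simp add: algebra_simps)
  then show ?thesis
    unfolding weight_def using node_pos[of k] abs_triangle_ineq[of b b']
    by (smt (verit, ccfv_SIG) add_divide_distrib divide_right_mono zero_le_power zero_le_power2)
qed

lemma weight_scale: "weight k (c * a) (c * b) = \<bar>c\<bar> * weight k a b"
proof -
  have "\<bar>c * a - node k * (c * b)\<bar> = \<bar>c\<bar> * \<bar>a - node k * b\<bar>"
    by (simp add: algebra_simps flip: abs_mult)
  then show ?thesis
    by (simp add: weight_def abs_mult algebra_simps)
qed

lemma summable_weight_exp_diff:
  assumes "l > 0"
  shows "summable (\<lambda>k. weight k (exp (- l * node k) - exp (- l)) (- l * exp (- l * node k)))"
proof (rule summableI_nonneg_bounded)
  show "(\<Sum>k<n. weight k (exp (- l * node k) - exp (- l)) (- l * exp (- l * node k)))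
      \<le> weight_const * (l / (l\<^sup>2 + 1))" for n
    by (rule sum_weight_exp_le[OF assms])
qed (rule weight_nonneg)

lemma summable_weight_exp:
  assumes "l > 0"
  shows "summable (\<lambda>k. weight k (exp (- l * node k)) (- l * exp (- l * node k)))"
proof (rule summable_comparison_test')
  show "summable (\<lambda>k. weight k (exp (- l * node k) - exp (- l)) (- l * exp (- l * node k))
      + \<bar>exp (- l)\<bar> * weight k 1 0)"
    by (intro summable_add summable_weight_exp_diff assms summable_mult summable_weight_1_0)
  show "norm (weight k (exp (- l * node k)) (- l * exp (- l * node k)))
      \<le> weight k (exp (- l * node k) - exp (- l)) (- l * exp (- l * node k))
        + \<bar>exp (- l)\<bar> * weight k 1 0" for k
    using weight_add[of k "exp (- l * node k) - exp (- l)" "exp (- l) * 1"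
        "- l * exp (- l * node k)" "exp (- l) * 0"] weight_nonneg
    unfolding weight_scale by simp
qed

section \<open>The function L as a series over pairs of nodes\<close>

definition L_series :: "real \<Rightarrow> complex \<Rightarrow> complex" where
  "L_series l z = (\<Sum>k. hermite k (exp (- l * node k)) (- l * exp (- l * node k)) z)"

text \<open>Subtracting exp(-l) times the series of the constant 1 shifts the node values and leaves
  the derivatives alone.\<close>

lemma sums_L_series_minus_exp:
  assumes "l > 0"
  shows "(\<lambda>k. hermite k (exp (- l * node k) - exp (- l)) (- l * exp (- l * node k)) z)
    sums (L_series l z - of_real (exp (- l)))"
proof -
  have "(\<lambda>k. hermite k (exp (- l * node k)) (- l * exp (- l * node k)) z
      - of_real (exp (- l)) * hermite k 1 0 z) sums (L_series l z - of_real (exp (- l)) * 1)"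
    unfolding L_series_def
    by (intro sums_diff sums_mult sums_hermite_1_0 summable_sums summable_hermite
        summable_weight_exp assms)
  moreover have "hermite k (exp (- l * node k)) (- l * exp (- l * node k)) z
      - of_real (exp (- l)) * hermite k 1 0 z
      = hermite k (exp (- l * node k) - exp (- l)) (- l * exp (- l * node k)) z" for k
    using hermite_diff[of k "exp (- l * node k)" "exp (- l) * 1" "- l * exp (- l * node k)" "exp (- l) * 0" z]
    by (simp only: hermite_scale) simp
  ultimately show ?thesis by simp
qed

lemma norm_L_series_minus_exp_le:
  assumes "l > 0"
  shows "cmod (L_series l z - of_real (exp (- l))) \<le> growth z * (weight_const * (l / (l\<^sup>2 + 1)))"
proof -
  have "L_series l z - of_real (exp (- l)) =
      (\<Sum>k. hermite k (exp (- l * node k) - exp (- l)) (- l * exp (- l * node k)) z)"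
    using sums_L_series_minus_exp[OF assms] by (rule sums_unique)
  then have "cmod (L_series l z - of_real (exp (- l))) \<le> growth z *
      (\<Sum>k. weight k (exp (- l * node k) - exp (- l)) (- l * exp (- l * node k)))"
    using norm_suminf_hermite_le[OF summable_weight_exp_diff[OF assms], of z] by simp
  also have "\<dots> \<le> growth z * (weight_const * (l / (l\<^sup>2 + 1)))"
    by (intro mult_left_mono suminf_le_const summable_weight_exp_diff sum_weight_exp_le
        growth_nonneg assms)
  finally show ?thesis .
qed

text \<open>The integers k and -k - 1 index the opposite half-integers k + 1/2 and -(k + 1/2).
  Absolute convergence on both halves allows the unordered sum to be regrouped into these
  pairs.\<close>

lemma infsum_int_eq_suminf:
  fixes f :: "int \<Rightarrow> complex"
  assumes 1: "summable (\<lambda>k. cmod (f (int k)))" and 2: "summable (\<lambda>k. cmod (f (- int k - 1)))"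
  shows "(\<Sum>\<^sub>\<infinity>n. f n) = (\<Sum>k. f (int k) + f (- int k - 1))"
proof -
  have "((f \<circ> int) has_sum (\<Sum>k. f (int k))) UNIV"
    using norm_summable_imp_has_sum[OF 1 summable_sums[OF summable_norm_cancel[OF 1]]]
    by (simp add: o_def)
  then have "(f has_sum (\<Sum>k. f (int k))) (range int)"
    by (subst has_sum_reindex) (auto simp: inj_on_def)
  moreover have "((f \<circ> (\<lambda>k. - int k - 1)) has_sum (\<Sum>k. f (- int k - 1))) UNIV"
    using norm_summable_imp_has_sum[OF 2 summable_sums[OF summable_norm_cancel[OF 2]]]
    by (simp add: o_def)
  then have "(f has_sum (\<Sum>k. f (- int k - 1))) (range (\<lambda>k. - int k - 1))"
    by (subst has_sum_reindex) (auto simp: inj_on_def)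
  ultimately have "(f has_sum ((\<Sum>k. f (int k)) + (\<Sum>k. f (- int k - 1))))
      (range int \<union> range (\<lambda>k. - int k - 1))"
    by (rule has_sum_Un_disjoint) auto
  moreover have "range int \<union> range (\<lambda>k. - int k - 1) = UNIV"
  proof -
    have "n \<in> range int \<union> range (\<lambda>k. - int k - 1)" for n :: int
    proof (cases "n \<ge> 0")
      case True
      then have "n = int (nat n)" by simp
      then show ?thesis by blast
    next
      case False
      then have "n = - int (nat (- n - 1)) - 1" by simp
      then show ?thesis by blast
    qed
    then show ?thesis by blast
  qed
  ultimately show ?thesis
    using suminf_add[OF summable_norm_cancel[OF 1] summable_norm_cancel[OF 2]]
    by (simp add: infsumI)
qed

lemma summable_exp_node:
  assumes "l > 0"
  shows "summable (\<lambda>k. exp (- l * node k))"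
proof -
  have "exp (- l * node k) = exp (- l / 2) * exp (- l) ^ k" for k
    by (simp add: node_def algebra_simps flip: exp_add exp_of_nat_mult)
  then show ?thesis
    using assms by (simp add: summable_mult summable_geometric)
qed

lemma L_fun_eq_L_series:
  assumes l: "l > 0"
  shows "L_fun l z = L_series l z"
  unfolding L_fun_def
proof (rule remove_sings_eq_entire)
  show "L_series l holomorphic_on UNIV"
    unfolding L_series_def[abs_def]
    by (rule holomorphic_suminf_hermite[OF summable_weight_exp[OF l]])
  fix w assume w: "w \<notin> half_integers"
  define H where "H = (cos (of_real pi * w) / of_real pi)\<^sup>2"
  \<comment> \<open>One constant for all nodes: 1 / (w - y) is pi / cos(pi w) times
    \<open>nodal y w\<close>, and the bound for the latter does not depend on y.\<close>
  define K where "K = cmod (of_real pi / cos (of_real pi * w)) * exp (pi * cmod w)"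
  define E where "E = (\<lambda>k. exp (- l * node k))"
  have E: "E k \<ge> 0" for k by (simp add: E_def)
  have ne: "w \<noteq> of_real (node k)" "w \<noteq> - of_real (node k)" for k
    using w of_node_in_half_integers[of k] by auto
  have cos_nz: "cos (of_real pi * w) \<noteq> 0"
  proof
    assume "cos (of_real pi * w) = 0"
    then obtain n :: int where "of_real pi * w = of_real (n * pi) + of_real pi / 2"
      by (auto simp: cos_eq_0)
    then have "of_real pi * w = of_real pi * (of_int n + 1/2)"
      by (simp add: algebra_simps)
    then have "w = of_int n + 1/2" by simp
    with w show False unfolding half_integers_def by blast
  qed
  have inv_le: "cmod (1 / (w - of_real y)) \<le> K" if "cos (pi * y) = 0" "w \<noteq> of_real y" for y
  proof -
    have "1 / (w - of_real y) = of_real pi / cos (of_real pi * w) * nodal y w"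
      using nodal_mult[OF that(1), of w] that(2) cos_nz by (simp add: field_simps)
    then show ?thesis
      unfolding \<open>1 / _ = _\<close> norm_mult K_def by (intro mult_left_mono norm_nodal_le) auto
  qed
  have inv_le': "cmod (1 / (w - of_real (node k))) \<le> K" "cmod (1 / (w + of_real (node k))) \<le> K" for k
    using inv_le[OF cos_node ne(1)] inv_le[of "- node k"] ne(2) by (auto simp: cos_node)
  have K: "K \<ge> 0" by (simp add: K_def)
  have summE: "summable (\<lambda>k. C * E k)" for C
    unfolding E_def by (intro summable_mult summable_exp_node l)
  have node_p: "of_int (int k) = of_real (node k) - (1/2 :: complex)"
    "of_int (- int k - 1) = - of_real (node k) - (1/2 :: complex)"
    "(of_int (int k) + 1/2 :: real) = node k" "(of_int (- int k - 1) + 1/2 :: real) = - node k" for k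
    by (simp_all add: node_def)
  define f where "f = (\<lambda>n::int. of_real (exp (- l * \<bar>of_int n + 1/2\<bar>)) / (w - of_int n - 1/2)\<^sup>2)"
  define g where "g = (\<lambda>n::int. of_real (sgn (of_int n + 1/2) * exp (- l * \<bar>of_int n + 1/2\<bar>)) / (w - of_int n - 1/2))"
  have f: "f (int k) = of_real (E k) * (1 / (w - of_real (node k)))\<^sup>2"
    "f (- int k - 1) = of_real (E k) * (1 / (w + of_real (node k)))\<^sup>2" for k
    unfolding f_def node_p using node_pos[of k] by (simp_all add: E_def power_divide)
  have g: "g (int k) = of_real (E k) * (1 / (w - of_real (node k)))"
    "g (- int k - 1) = - (of_real (E k) * (1 / (w + of_real (node k))))" for k
    unfolding g_def node_p using node_pos[of k] by (simp_all add: E_def)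
  have bound: "cmod (of_real (E k) * x) \<le> C * E k" if "cmod x \<le> C" for k x C
    unfolding norm_mult using mult_right_mono[OF that E[of k]] E[of k] by (simp add: mult.commute)
  have sf: "summable (\<lambda>k. cmod (f (int k)))" "summable (\<lambda>k. cmod (f (- int k - 1)))"
    unfolding f
    by (rule summable_norm_comparison_test[OF _ summE[of "K\<^sup>2"]],
        intro exI allI impI bound, simp only: norm_power, intro power_mono inv_le' norm_ge_zero)+
  have sg: "summable (\<lambda>k. cmod (g (int k)))" "summable (\<lambda>k. cmod (g (- int k - 1)))"
    unfolding g norm_minus_cancel
    by (rule summable_norm_comparison_test[OF _ summE[of K]], intro exI allI impI bound inv_le')+
  have sf': "summable (\<lambda>k. f (int k) + f (- int k - 1))"
    and sg': "summable (\<lambda>k. g (int k) + g (- int k - 1))"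
    using sf sg by (auto intro!: summable_add intro: summable_norm_cancel)
  have "H * ((\<Sum>\<^sub>\<infinity>n. f n) - of_real l * (\<Sum>\<^sub>\<infinity>n. g n))
      = (\<Sum>k. H * ((f (int k) + f (- int k - 1)) - of_real l * (g (int k) + g (- int k - 1))))"
    unfolding infsum_int_eq_suminf[OF sf] infsum_int_eq_suminf[OF sg]
    by (intro sums_unique sums_mult sums_diff summable_sums sf' sg')
  also have "\<dots> = L_series l w"
    unfolding L_series_def
  proof (rule suminf_cong)
    fix k
    show "H * ((f (int k) + f (- int k - 1)) - of_real l * (g (int k) + g (- int k - 1))) =
        hermite k (exp (- l * node k)) (- l * exp (- l * node k)) w"
      unfolding hermite_eq_fractions[OF ne] H_def[symmetric] f g
      by (simp add: E_def algebra_simps power_divide)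
  qed
  finally show "(cos (of_real pi * w) / of_real pi)\<^sup>2 *
     ((\<Sum>\<^sub>\<infinity>k\<in>(UNIV::int set).
         of_real (exp (- l * \<bar>of_int k + 1/2\<bar>)) / (w - of_int k - 1/2)\<^sup>2)
      - of_real l * (\<Sum>\<^sub>\<infinity>k\<in>(UNIV::int set).
         of_real (sgn (of_int k + 1/2) * exp (- l * \<bar>of_int k + 1/2\<bar>)) / (w - of_int k - 1/2)))
    = L_series l w"
    by (simp add: H_def f_def g_def)
qed

section \<open>The minorant property\<close>

lemma sums_exp_node:
  assumes u: "u > 0"
  shows "(\<lambda>k. exp (- u * node k)) sums (1 / (2 * sinh (u / 2)))"
proof -
  have "(\<lambda>k. exp (- u / 2) * exp (- u) ^ k) sums (exp (- u / 2) * (1 / (1 - exp (- u))))"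
    using u by (intro sums_mult geometric_sums) simp
  moreover have "exp (- u / 2) * exp (- u) ^ k = exp (- u * node k)" for k
    by (simp add: node_def algebra_simps flip: exp_add exp_of_nat_mult)
  moreover have "exp (- u / 2) * (1 / (1 - exp (- u))) = 1 / (2 * sinh (u / 2))"
  proof -
    have "2 * sinh (u / 2) * exp (- u / 2) = 1 - exp (- u)"
      by (simp add: sinh_def algebra_simps flip: exp_add)
    then show ?thesis
      using u by (simp add: field_simps)
  qed
  ultimately show ?thesis by simp
qed

lemma sinh_le_mult_cosh:
  fixes x :: real
  assumes "x \<ge> 0"
  shows "sinh x \<le> x * cosh x"
proof -
  have "0 * cosh 0 - sinh 0 \<le> x * cosh x - sinh x"
  proof (rule DERIV_nonneg_imp_nondecreasing[where f = "\<lambda>t. t * cosh t - sinh t", OF assms])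
    show "\<exists>y. ((\<lambda>t. t * cosh t - sinh t) has_real_derivative y) (at s) \<and> 0 \<le> y" if "0 \<le> s" for s
      using that by (intro exI[of _ "s * sinh s"]) (auto intro!: derivative_eq_intros)
  qed
  then show ?thesis by simp
qed

text \<open>After clearing denominators, a sinh t - t sinh a vanishes at t = a, and its derivative a
  cosh t - sinh a is nonnegative for t >= a by \<open>sinh_le_mult_cosh\<close>.\<close>

lemma sinh_ratio_mono:
  fixes a b :: real
  assumes "0 < a" "a \<le> b"
  shows "b / sinh b \<le> a / sinh a"
proof -
  have "a * sinh a - a * sinh a \<le> a * sinh b - b * sinh a"
  proof (rule DERIV_nonneg_imp_nondecreasing[where f = "\<lambda>t. a * sinh t - t * sinh a", OF assms(2)])
    fix t assume t: "a \<le> t" "t \<le> b"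
    have "sinh a \<le> a * cosh a"
      by (rule sinh_le_mult_cosh) (use assms in simp)
    moreover have "a * cosh a \<le> a * cosh t"
      using assms t by (intro mult_left_mono) (auto simp: cosh_real_nonneg_le_iff)
    ultimately show "\<exists>y. ((\<lambda>t. a * sinh t - t * sinh a) has_real_derivative y) (at t) \<and> 0 \<le> y"
      by (intro exI[of _ "a * cosh t - sinh a"]) (auto intro!: derivative_eq_intros)
  qed
  then show ?thesis
    using assms by (simp add: field_simps)
qed

text \<open>The sums are values of B(u) = (u/2) / sinh(u/2), so this is the monotonicity of B. It is
  stated in \<open>ennreal\<close> because it is applied under an integral of nonnegative
  functions.\<close>

lemma suminf_node_exp_mono:
  assumes "0 < a" "a \<le> b"
  shows "(\<Sum>k. ennreal (b * exp (- b * node k))) \<le> (\<Sum>k. ennreal (a * exp (- a * node k)))"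
proof -
  have *: "(\<Sum>k. ennreal (u * exp (- u * node k))) = ennreal (u / 2 / sinh (u / 2))" if "u > 0" for u
  proof -
    have "(\<lambda>k. u * exp (- u * node k)) sums (u * (1 / (2 * sinh (u / 2))))"
      using that by (intro sums_mult sums_exp_node)
    then show ?thesis
      using that by (subst suminf_ennreal2) (auto simp: sums_iff)
  qed
  show ?thesis
    unfolding *[OF assms(1)] *[OF less_le_trans[OF assms]]
    using assms by (intro ennreal_leI sinh_ratio_mono) auto
qed

text \<open>The factor exp(-w (p - y)) makes the total decay rate p. The start \<open>a\<close> and
  the sign of \<open>l\<close> are free, so that the formula covers the transform of (l + w) exp(-(l
  + w) y) from 0 and, with -l for l, the part w >= l of the transform of |l - w| exp(-|l - w|
  y).\<close>

lemma nn_integral_linear_exp: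
  fixes a l p y :: real
  assumes p: "p > 0" and "l + a \<ge> 0"
  shows "(\<integral>\<^sup>+w. ennreal ((l + w) * exp (- (l + w) * y) * exp (- w * (p - y))) * indicator {a..} w \<partial>lborel)
    = ennreal (exp (- l * y) * exp (- a * p) * ((l + a) / p + 1 / p\<^sup>2))"
proof -
  define F where "F = (\<lambda>w. - exp (- l * y) * (exp (- p * w) * ((l + w) / p + 1 / p\<^sup>2)))"
  have "(\<integral>\<^sup>+w. ennreal ((l + w) * exp (- (l + w) * y) * exp (- w * (p - y))) * indicator {a..} w \<partial>lborel)
      = ennreal (0 - F a)"
  proof (rule nn_integral_FTC_atLeast)
    show "(\<lambda>w. (l + w) * exp (- (l + w) * y) * exp (- w * (p - y))) \<in> borel_measurable borel"
      by measurable
    fix w assume w: "a \<le> w"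
    then show "0 \<le> (l + w) * exp (- (l + w) * y) * exp (- w * (p - y))"
      using assms by simp
    have e: "exp (- (l + w) * y) * exp (- w * (p - y)) = exp (- l * y) * exp (- p * w)"
      by (simp add: algebra_simps flip: exp_add)
    have "(F has_real_derivative - exp (- l * y) *
        (exp (- p * w) * (1 / p) + (exp (- p * w) * - p) * ((l + w) / p + 1 / p\<^sup>2))) (at w)"
      unfolding F_def using p by (auto intro!: derivative_eq_intros simp: field_simps)
    also have "- exp (- l * y) * (exp (- p * w) * (1 / p) + (exp (- p * w) * - p) * ((l + w) / p + 1 / p\<^sup>2))
        = (l + w) * (exp (- l * y) * exp (- p * w))"
      using p by (simp add: field_simps power2_eq_square)
    finally show "(F has_real_derivative (l + w) * exp (- (l + w) * y) * exp (- w * (p - y))) (at w)"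
      unfolding mult.assoc e .
  next
    show "(F \<longlongrightarrow> 0) at_top"
      unfolding F_def using p by real_asymp
  qed
  also have "0 - F a = exp (- l * y) * exp (- a * p) * ((l + a) / p + 1 / p\<^sup>2)"
    by (simp add: F_def mult.commute[of p])
  finally show ?thesis .
qed

text \<open>The integral is split at w = l. On [0, l] the rate d = y - x can have either sign; the
  numerator is nonnegative all the same, being exp(-l y) times the Taylor remainder exp(l d) - 1 - l
  d.\<close>

lemma nn_integral_abs_linear_exp:
  assumes l: "l > 0" and x: "x > 0" and y: "y > 0" and ne: "x \<noteq> y"
  shows "(\<integral>\<^sup>+w. ennreal (\<bar>l - w\<bar> * exp (- \<bar>l - w\<bar> * y) * exp (- w * x)) * indicator {0..} w \<partial>lborel)
    = ennreal ((exp (- l * x) - exp (- l * y) - l * (y - x) * exp (- l * y)) / (y - x)\<^sup>2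
      + exp (- l * x) / (x + y)\<^sup>2)"
proof -
  define d where "d = y - x"
  have d: "d \<noteq> 0" using ne by (simp add: d_def)
  define F where "F = (\<lambda>w. exp (- l * y) * (exp (w * d) * ((l - w) / d + 1 / d\<^sup>2)))"
  define f1 where "f1 = (\<lambda>w. (l - w) * exp (- (l - w) * y) * exp (- w * x))"
  define f2 where "f2 = (\<lambda>w. (- l + w) * exp (- (- l + w) * (- y)) * exp (- w * (x + y - - y)))"
  have f1: "(\<integral>\<^sup>+w. ennreal (f1 w) * indicator {0..l} w \<partial>lborel) = ennreal (F l - F 0)"
  proof (rule nn_integral_FTC_Icc)
    show "f1 \<in> borel_measurable borel"
      unfolding f1_def by measurable
    fix w assume w: "w \<in> {0..l}"
    then show "0 \<le> f1 w" by (simp add: f1_def)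
    have e: "exp (- (l - w) * y) * exp (- w * x) = exp (- l * y) * exp (w * d)"
      by (simp add: d_def algebra_simps flip: exp_add)
    have "(F has_real_derivative exp (- l * y) *
        (exp (w * d) * (- 1 / d) + (exp (w * d) * d) * ((l - w) / d + 1 / d\<^sup>2))) (at w)"
      unfolding F_def using d by (auto intro!: derivative_eq_intros)
    also have "exp (- l * y) * (exp (w * d) * (- 1 / d) + (exp (w * d) * d) * ((l - w) / d + 1 / d\<^sup>2))
        = (l - w) * (exp (- l * y) * exp (w * d))"
      using d by (simp add: field_simps power2_eq_square)
    finally show "(F has_real_derivative f1 w) (at w)"
      unfolding f1_def mult.assoc e .
  qed (use l in simp)
  have F: "F l - F 0 = (exp (- l * x) - exp (- l * y) - l * d * exp (- l * y)) / d\<^sup>2"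
  proof -
    have "exp (- l * y) * exp (l * d) = exp (- l * x)"
      by (simp add: d_def algebra_simps flip: exp_add)
    then have "F l = exp (- l * x) / d\<^sup>2"
      by (simp add: F_def)
    moreover have "F 0 = l * d * exp (- l * y) / d\<^sup>2 + exp (- l * y) / d\<^sup>2"
      using d by (simp add: F_def field_simps power2_eq_square)
    ultimately show ?thesis by (simp add: diff_divide_distrib)
  qed
  have nonneg: "0 \<le> exp (- l * x) - exp (- l * y) - l * d * exp (- l * y)"
  proof -
    have "exp (- l * y) * (1 + l * d) \<le> exp (- l * y) * exp (l * d)"
      by (intro mult_left_mono exp_ge_add_one_self) auto
    also have "exp (- l * y) * exp (l * d) = exp (- l * x)"
      by (simp add: d_def algebra_simps flip: exp_add)
    finally show ?thesis by (simp add: algebra_simps)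
  qed
  have f2: "(\<integral>\<^sup>+w. ennreal ((w - l) * exp (- (w - l) * y) * exp (- w * x)) * indicator {l..} w \<partial>lborel)
     = ennreal (exp (- l * x) / (x + y)\<^sup>2)"
  proof -
    have "exp (l * y) * exp (- l * (x + y)) = exp (- l * x)"
      by (simp add: algebra_simps flip: exp_add)
    then show ?thesis
      using nn_integral_linear_exp[of "x + y" "- l" l y] x y by simp
  qed
  have "(\<integral>\<^sup>+w. ennreal (\<bar>l - w\<bar> * exp (- \<bar>l - w\<bar> * y) * exp (- w * x)) * indicator {0..} w \<partial>lborel)
      = (\<integral>\<^sup>+w. ennreal (f1 w) * indicator {0..l} w
          + ennreal ((w - l) * exp (- (w - l) * y) * exp (- w * x)) * indicator {l..} w \<partial>lborel)"
  proof (rule nn_integral_cong)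
    fix w
    show "ennreal (\<bar>l - w\<bar> * exp (- \<bar>l - w\<bar> * y) * exp (- w * x)) * indicator {0..} w =
        ennreal (f1 w) * indicator {0..l} w
        + ennreal ((w - l) * exp (- (w - l) * y) * exp (- w * x)) * indicator {l..} w"
    proof (cases w l rule: linorder_cases)
      case less
      then show ?thesis by (simp add: f1_def split: split_indicator)
    next
      case greater
      then have "\<bar>l - w\<bar> = w - l" by simp
      with greater l show ?thesis by (simp split: split_indicator)
    qed (use l in \<open>simp add: f1_def\<close>)
  qed
  also have "\<dots> = ennreal (F l - F 0) + ennreal (exp (- l * x) / (x + y)\<^sup>2)"
    unfolding f1[symmetric] f2[symmetric]
    by (rule nn_integral_add) (auto simp: f1_def)
  also have "\<dots> = ennreal (F l - F 0 + exp (- l * x) / (x + y)\<^sup>2)"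
    using nonneg unfolding F by (intro ennreal_plus[symmetric]) auto
  finally show ?thesis
    unfolding F d_def .
qed

text \<open>Up to the factor \<open>(cos (\<pi> x) / \<pi>)\<^sup>2\<close> the difference is \<open>\<Sum> (a k - c k)\<close>, where \<open>a k\<close> and \<open>c k\<close> are
  the Laplace transforms of \<open>\<bar>l - w\<bar> exp (- \<bar>l - w\<bar> y)\<close> and \<open>(l + w) exp (- (l + w) y)\<close>; the sums of
  these functions of \<open>w\<close> over the nodes \<open>y\<close> are \<open>B(\<bar>l - w\<bar>)\<close> and \<open>B(l + w)\<close>.\<close>

lemma L_series_le_exp_aux:
  assumes l: "l > 0" and x: "x > 0" and not_half: "complex_of_real x \<notin> half_integers"
  shows "Re (L_series l (of_real x)) \<le> exp (- l * x)"
proof -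
  have ne: "x \<noteq> node k" for k
    using not_half of_node_in_half_integers(1)[of k] by metis
  define a where "a = (\<lambda>k. (exp (- l * x) - exp (- l * node k) - l * (node k - x) * exp (- l * node k))
      / (node k - x)\<^sup>2 + exp (- l * x) / (x + node k)\<^sup>2)"
  define c where "c = (\<lambda>k. exp (- l * node k) * (l / (x + node k) + 1 / (x + node k)\<^sup>2))"
  define H where "H = (cos (pi * x) / pi)\<^sup>2"
  have ea: "ennreal (a k) = (\<integral>\<^sup>+w. ennreal (\<bar>l - w\<bar> * exp (- \<bar>l - w\<bar> * node k) * exp (- w * x))
      * indicator {0..} w \<partial>lborel)" for k
    unfolding a_def using nn_integral_abs_linear_exp[OF l x node_pos[of k] ne] by simp
  have ec: "ennreal (c k) = (\<integral>\<^sup>+w. ennreal ((l + w) * exp (- (l + w) * node k) * exp (- w * x))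
      * indicator {0..} w \<partial>lborel)" for k
    unfolding c_def using nn_integral_linear_exp[of "x + node k" l 0 "node k"] l x node_pos[of k] by simp
  have suma: "(\<Sum>k. ennreal (a k)) = (\<integral>\<^sup>+w. (\<Sum>k. ennreal (\<bar>l - w\<bar> * exp (- \<bar>l - w\<bar> * node k)))
      * (ennreal (exp (- w * x)) * indicator {0..} w) \<partial>lborel)"
    unfolding ea by (subst nn_integral_suminf[symmetric])
      (auto simp: ennreal_mult mult.assoc ennreal_suminf_multc)
  have sumc: "(\<Sum>k. ennreal (c k)) = (\<integral>\<^sup>+w. (\<Sum>k. ennreal ((l + w) * exp (- (l + w) * node k)))
      * (ennreal (exp (- w * x)) * indicator {0..} w) \<partial>lborel)"
    unfolding ec using l by (subst nn_integral_suminf[symmetric])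
      (auto intro!: nn_integral_cong simp: ennreal_mult mult.assoc simp flip: ennreal_suminf_multc
        split: split_indicator)
  have le: "(\<Sum>k. ennreal (c k)) \<le> (\<Sum>k. ennreal (a k))"
    unfolding suma sumc
  proof (rule nn_integral_mono_AE)
    show "AE w in lborel. (\<Sum>k. ennreal ((l + w) * exp (- (l + w) * node k)))
        * (ennreal (exp (- w * x)) * indicator {0..} w) \<le>
      (\<Sum>k. ennreal (\<bar>l - w\<bar> * exp (- \<bar>l - w\<bar> * node k)))
        * (ennreal (exp (- w * x)) * indicator {0..} w)"
      \<comment> \<open>At w = l every summand |l - w| exp(-|l - w| y) is 0, although B tends to 1
        there, and the comparison fails; a single point is negligible.\<close>
      using AE_lborel_singleton[of l]
    proof eventually_elim
      case (elim w)
      show ?case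
      proof (cases "w \<ge> 0")
        case True
        show ?thesis
          by (rule mult_right_mono, rule suminf_node_exp_mono) (use True elim l in auto)
      qed simp
    qed
  qed
  have c_nonneg: "c k \<ge> 0" for k
    using l x node_pos[of k] by (simp add: c_def)
  have a_nonneg: "a k \<ge> 0" for k
  proof -
    have "exp (- l * node k) * (1 + l * (node k - x)) \<le> exp (- l * node k) * exp (l * (node k - x))"
      by (intro mult_left_mono exp_ge_add_one_self) auto
    also have "\<dots> = exp (- l * x)"
      by (simp add: algebra_simps flip: exp_add)
    finally show ?thesis
      unfolding a_def by (intro add_nonneg_nonneg divide_nonneg_nonneg) (auto simp: algebra_simps)
  qed
  have summ_c: "summable c"
  proof (rule summable_comparison_test')
    show "summable (\<lambda>k. (l / x + 1 / x\<^sup>2) * exp (- l * node k))"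
      by (intro summable_mult summable_exp_node l)
    show "norm (c k) \<le> (l / x + 1 / x\<^sup>2) * exp (- l * node k)" for k
    proof -
      have "l / (x + node k) + 1 / (x + node k)\<^sup>2 \<le> l / x + 1 / x\<^sup>2"
        using l x node_pos[of k] by (intro add_mono divide_left_mono power_mono) auto
      then show ?thesis
        using c_nonneg[of k] by (simp add: c_def mult.commute mult_left_mono)
    qed
  qed
  have H: "H > 0"
  proof -
    have "cos (pi * x) \<noteq> 0"
    proof
      assume "cos (pi * x) = 0"
      then obtain n :: int where "pi * x = of_int n * pi + pi / 2"
        by (auto simp: cos_zero_iff_int2)
      then have "pi * x = pi * (of_int n + 1/2)" by (simp add: algebra_simps)
      then have "complex_of_real x = of_int n + 1/2" by simp
      with not_half show False unfolding half_integers_def by blast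
    qed
    then show ?thesis by (simp add: H_def)
  qed
  have "(\<lambda>k. H * (a k - c k)) sums (exp (- l * x) - Re (L_series l (of_real x)))"
  proof -
    \<comment> \<open>The number exp(-l x) is expanded as exp(-l x) times the series of the constant
      1, which puts both terms of the difference over the same nodes.\<close>
    have "(\<lambda>k. of_real (exp (- l * x)) * hermite k 1 0 (of_real x)
          - hermite k (exp (- l * node k)) (- l * exp (- l * node k)) (of_real x))
        sums (of_real (exp (- l * x)) * 1 - L_series l (of_real x))"
      unfolding L_series_def
      by (intro sums_diff sums_mult sums_hermite_1_0 summable_sums summable_hermite
          summable_weight_exp l)
    moreover have "of_real (exp (- l * x)) * hermite k 1 0 (of_real x)
          - hermite k (exp (- l * node k)) (- l * exp (- l * node k)) (of_real x)
        = of_real (H * (a k - c k))" for k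
    proof -
      define y where "y = node k"
      have y: "x - y \<noteq> 0" "y - x \<noteq> 0" "x + y \<noteq> 0"
        using ne[of k] x node_pos[of k] by (auto simp: y_def)
      have "complex_of_real x \<noteq> of_real (node k)" "complex_of_real x \<noteq> - of_real (node k)"
        using not_half of_node_in_half_integers[of k] by metis+
      then have frac: "hermite k p q (of_real x) = of_real (H * (p * (1 / (x - y)\<^sup>2 + 1 / (x + y)\<^sup>2)
          + q * (1 / (x - y) - 1 / (x + y))))" for p q
        by (simp add: hermite_eq_fractions H_def y_def flip: cos_of_real)
      define e f P Q where "e = exp (- l * x)" and "f = exp (- l * y)" and "P = 1 / (x - y)" and "Q = 1 / (x + y)"
      have P: "1 / (x - y)\<^sup>2 = P\<^sup>2" and Q: "1 / (x + y)\<^sup>2 = Q\<^sup>2"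
        by (simp_all add: P_def Q_def power_divide)
      have "l * (y - x) * f / (y - x)\<^sup>2 = - (l * f * P)"
      proof -
        have "(y - x)\<^sup>2 = (y - x) * (y - x)"
          by (simp add: power2_eq_square)
        then have "l * (y - x) * f / (y - x)\<^sup>2 = l * f / (y - x)"
          using y by simp
        also have "1 / (y - x) = - P"
          unfolding P_def by (metis minus_diff_eq minus_divide_right)
        then have "l * f / (y - x) = - (l * f * P)"
          by (metis divide_inverse inverse_eq_divide mult_minus_right)
        finally show ?thesis .
      qed
      moreover have "(e - f) / (y - x)\<^sup>2 = (e - f) * P\<^sup>2"
        by (simp add: P_def power2_commute[of y x] power_divide)
      moreover have "e / (x + y)\<^sup>2 = e * Q\<^sup>2"
        by (simp add: Q_def power_divide)
      ultimately have a: "a k = (e - f) * P\<^sup>2 + l * f * P + e * Q\<^sup>2"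
        unfolding a_def y_def[symmetric] e_def[symmetric] f_def[symmetric] by (simp add: diff_divide_distrib)
      have c: "c k = f * (l * Q + Q\<^sup>2)"
        by (simp add: c_def f_def Q_def power_divide flip: y_def)
      have "e * (H * (1 * (P\<^sup>2 + Q\<^sup>2) + 0 * (P - Q)))
          - H * (f * (P\<^sup>2 + Q\<^sup>2) + (- l * f) * (P - Q)) = H * (a k - c k)"
        unfolding a c by (simp add: algebra_simps)
      then show ?thesis
        unfolding frac y_def[symmetric] P Q P_def[symmetric] Q_def[symmetric] e_def[symmetric] f_def[symmetric]
        by (simp only: flip: of_real_mult of_real_diff)
    qed
    ultimately have "(\<lambda>k. complex_of_real (H * (a k - c k)))
        sums (of_real (exp (- l * x)) - L_series l (of_real x))"
      by simp
    from sums_Re[OF this] show ?thesis by simp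
  qed
  then have ac: "(\<lambda>k. a k - c k) sums ((exp (- l * x) - Re (L_series l (of_real x))) / H)"
    using sums_mult[of _ _ "1 / H"] H by fastforce
  \<comment> \<open>Summability of \<open>a\<close> is recovered from the summable difference and
    \<open>c\<close>; it is needed to turn the comparison in \<open>ennreal\<close> into one between
    real sums.\<close>
  then have "summable (\<lambda>k. (a k - c k) + c k)"
    using summ_c by (intro summable_add) (auto simp: sums_iff)
  then have summ_a: "summable a" by simp
  have "ennreal (suminf c) \<le> ennreal (suminf a)"
    using le unfolding suminf_ennreal2[OF c_nonneg summ_c] suminf_ennreal2[OF a_nonneg summ_a] .
  then have "suminf c \<le> suminf a"
    using a_nonneg summ_a by (simp add: suminf_nonneg)
  moreover have "suminf a - suminf c = (exp (- l * x) - Re (L_series l (of_real x))) / H"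
    using ac summ_a summ_c by (simp add: sums_iff suminf_diff)
  ultimately have "0 \<le> (exp (- l * x) - Re (L_series l (of_real x))) / H"
    by simp
  then show ?thesis
    using H by (simp add: zero_le_divide_iff)
qed

lemma continuous_L_series: "l > 0 \<Longrightarrow> isCont (L_series l) z"
  using holomorphic_on_imp_continuous_on[OF holomorphic_suminf_hermite[OF summable_weight_exp]]
  by (simp add: continuous_on_eq_continuous_at L_series_def[abs_def])

text \<open>Limits from the right carry the inequality to the nonnegative half-integers and to 0,
  and evenness of the series carries it to negative x.\<close>

lemma L_series_le_exp:
  assumes l: "l > 0"
  shows "Re (L_series l (of_real x)) \<le> exp (- l * \<bar>x\<bar>)"
proof -
  have pos: "Re (L_series l (of_real t)) \<le> exp (- l * t)" if t: "t \<ge> 0" for t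
  proof (rule tendsto_le)
    have "filterlim complex_of_real (at (of_real t)) (at_right t)"
      by (auto simp: filterlim_at eventually_at_filter intro!: tendsto_intros)
    from filterlim_compose[OF tendsto_Re[OF continuous_L_series[OF l, unfolded isCont_def]] this]
    show "((\<lambda>t. Re (L_series l (of_real t))) \<longlongrightarrow> Re (L_series l (of_real t))) (at_right t)" .
    have "\<forall>\<^sub>F s in at_right t. complex_of_real s \<notin> half_integers"
      using \<open>filterlim complex_of_real _ _\<close> eventually_not_half_integer[of "of_real t"]
      unfolding filterlim_iff by blast
    moreover have "\<forall>\<^sub>F s in at_right t. t < s"
      by (rule eventually_at_right_less)
    ultimately show "\<forall>\<^sub>F s in at_right t. Re (L_series l (of_real s)) \<le> exp (- l * s)"
      by eventually_elim (rule L_series_le_exp_aux, use l t in auto)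
    show "((\<lambda>s. exp (- l * s)) \<longlongrightarrow> exp (- l * t)) (at_right t)"
      by (intro tendsto_intros)
  qed auto
  have "L_series l (- of_real t) = L_series l (of_real t)" for t
    unfolding L_series_def by (rule suminf_hermite_minus[OF summable_weight_exp[OF l]])
  then show ?thesis
    using pos[of "\<bar>x\<bar>"] by (cases "x \<ge> 0") (simp_all flip: of_real_minus)
qed

section \<open>Integrals over the real line\<close>

text \<open>Integration by parts gives the antiderivative Si(2 x) - (sin x)^2 / x, and Si tends to
  pi / 2.\<close>

lemma has_bochner_integral_sinc_squared: "has_bochner_integral lborel (\<lambda>x. (sinc x)\<^sup>2) pi"
proof -
  define F where "F = (\<lambda>x. Si (2 * x) - (sin x)\<^sup>2 / x)"
  have deriv: "(F has_real_derivative (sinc x)\<^sup>2) (at x)" if "0 < x" for x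
  proof -
    have "(F has_real_derivative sinc (2 * x) * 2 - ((2 * sin x * cos x) * x - (sin x)\<^sup>2 * 1) / (x * x)) (at x)"
      unfolding F_def using that
      by (auto intro!: derivative_eq_intros DERIV_chain2[OF DERIV_Si])
    also have "sinc (2 * x) * 2 - ((2 * sin x * cos x) * x - (sin x)\<^sup>2 * 1) / (x * x) = (sinc x)\<^sup>2"
      using that by (simp add: sin_double) (simp add: field_simps power2_eq_square)
    finally show ?thesis .
  qed
  have lim0: "(F \<longlongrightarrow> 0) (at_right 0)"
  proof -
    have "((\<lambda>x. Si (2 * x)) \<longlongrightarrow> Si (2 * 0)) (at_right 0)"
      by (intro isCont_tendsto_compose[OF isCont_Si] tendsto_intros)
    moreover have "Si 0 = 0"
      using Si_neg[of 0] by simp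
    moreover have "((\<lambda>x::real. (sin x)\<^sup>2 / x) \<longlongrightarrow> 0) (at_right 0)"
      by real_asymp
    ultimately show ?thesis
      unfolding F_def using tendsto_diff by fastforce
  qed
  have lim1: "(F \<longlongrightarrow> pi / 2) at_top"
  proof -
    have "((\<lambda>x. Si (2 * x)) \<longlongrightarrow> pi / 2) at_top"
      by (rule filterlim_compose[OF Si_at_top]) real_asymp
    moreover have "((\<lambda>x::real. (sin x)\<^sup>2 / x) \<longlongrightarrow> 0) at_top"
    proof (rule Lim_null_comparison)
      show "\<forall>\<^sub>F x::real in at_top. norm ((sin x)\<^sup>2 / x) \<le> 1 / x"
        using eventually_gt_at_top[of 0]
      proof eventually_elim
        case (elim x)
        have "(sin x)\<^sup>2 \<le> 1"
          by (simp add: abs_square_le_1)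
        then show ?case using elim by (simp add: divide_right_mono)
      qed
      show "((\<lambda>x::real. 1 / x) \<longlongrightarrow> 0) at_top" by real_asymp
    qed
    ultimately show ?thesis
      unfolding F_def using tendsto_diff by fastforce
  qed
  have int: "set_integrable lborel (einterval 0 \<infinity>) (\<lambda>x. (sinc x)\<^sup>2)"
    "(LBINT x=0..\<infinity>. (sinc x)\<^sup>2) = pi / 2 - 0"
  proof -
    have *: "isCont (\<lambda>x. (sinc x)\<^sup>2) x" for x
      by (intro continuous_intros isCont_sinc)
    have l0: "((F \<circ> real_of_ereal) \<longlongrightarrow> 0) (at_right (0::ereal))"
      using lim0 unfolding zero_ereal_def ereal_tendsto_simps .
    have l1: "((F \<circ> real_of_ereal) \<longlongrightarrow> pi / 2) (at_left \<infinity>)"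
      using lim1 unfolding ereal_tendsto_simps .
    show "set_integrable lborel (einterval 0 \<infinity>) (\<lambda>x. (sinc x)\<^sup>2)"
      by (rule interval_integral_FTC_nonneg(1)[OF _ deriv * _ l0 l1]) auto
    show "(LBINT x=0..\<infinity>. (sinc x)\<^sup>2) = pi / 2 - 0"
      by (rule interval_integral_FTC_nonneg(2)[OF _ deriv * _ l0 l1]) auto
  qed
  have "einterval 0 \<infinity> = {0<..}" by (auto simp: einterval_def)
  then have "has_bochner_integral lborel (\<lambda>x. indicator {0<..} x *\<^sub>R (sinc x)\<^sup>2) (pi / 2)"
    using int by (simp add: has_bochner_integral_iff set_integrable_def
        interval_lebesgue_integral_0_infty set_lebesgue_integral_def)
  moreover have "AE x in lborel. indicator {0<..} x *\<^sub>R (sinc x)\<^sup>2 = indicator {0..} x *\<^sub>R (sinc x)\<^sup>2"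
    using AE_lborel_singleton[of 0] by eventually_elim (auto split: split_indicator)
  ultimately have "has_bochner_integral lborel (\<lambda>x. indicator {0..} x *\<^sub>R (sinc x)\<^sup>2) (pi / 2)"
    by (subst has_bochner_integral_cong_AE[symmetric]) auto
  from has_bochner_integral_even_function[OF this] show ?thesis
    by simp
qed

section \<open>Orthonormality of the nodal functions and the integral of L\<close>

definition rnodal :: "real \<Rightarrow> real \<Rightarrow> real" where
  "rnodal y x = - sin (pi * y) * sinc (pi * (x - y))"

lemma nodal_eq_rnodal: "nodal y (of_real x) = of_real (rnodal y x)"
  by (simp only: nodal_of_real rnodal_def mult_minus_left)

lemma borel_measurable_rnodal [measurable]: "rnodal y \<in> borel_measurable borel"
  unfolding rnodal_def[abs_def] by measurable

lemma sin_squared_eq_1: "cos (y::real) = 0 \<Longrightarrow> (sin y)\<^sup>2 = 1"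
  using sin_cos_squared_add[of y] by simp

lemma has_bochner_integral_rnodal_squared:
  assumes "cos (pi * y) = 0"
  shows "has_bochner_integral lborel (\<lambda>x. (rnodal y x)\<^sup>2) 1"
proof -
  have "(rnodal y x)\<^sup>2 = (sinc (- (pi * y) + pi * x))\<^sup>2" for x
  proof -
    have "pi * (x - y) = - (pi * y) + pi * x" by (simp add: algebra_simps)
    then show ?thesis
      unfolding rnodal_def power_mult_distrib power2_minus sin_squared_eq_1[OF assms] by (simp only: mult_1)
  qed
  moreover have "pi /\<^sub>R \<bar>pi\<bar> = 1" by simp
  ultimately show ?thesis
    using lborel_has_bochner_integral_real_affine_iff[THEN iffD1, OF pi_neq_zero
        has_bochner_integral_sinc_squared, of "- (pi * y)"]
    by (simp only:)
qed

text \<open>Both claims follow from |a b| <= (a^2 + b^2) / 2, each square having integral 1.\<close>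

lemma rnodal_mult_integrable:
  assumes "cos (pi * y) = 0" "cos (pi * z) = 0"
  shows "integrable lborel (\<lambda>x. rnodal y x * rnodal z x)"
    and "(\<integral>x. \<bar>rnodal y x * rnodal z x\<bar> \<partial>lborel) \<le> 1"
proof -
  note y = has_bochner_integral_rnodal_squared[OF assms(1)]
    and z = has_bochner_integral_rnodal_squared[OF assms(2)]
  have "\<bar>a * b\<bar> \<le> (a\<^sup>2 + b\<^sup>2) / 2" for a b :: real
    using sum_squares_bound[of "\<bar>a\<bar>" "\<bar>b\<bar>"] by (simp add: abs_mult)
  then have le: "\<bar>rnodal y x * rnodal z x\<bar> \<le> ((rnodal y x)\<^sup>2 + (rnodal z x)\<^sup>2) / 2" for x .
  have sum: "has_bochner_integral lborel (\<lambda>x. ((rnodal y x)\<^sup>2 + (rnodal z x)\<^sup>2) / 2) ((1 + 1) / 2)"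
    by (intro has_bochner_integral_divide_zero has_bochner_integral_add y z)
  show int: "integrable lborel (\<lambda>x. rnodal y x * rnodal z x)"
    by (rule Bochner_Integration.integrable_bound[OF integrable.intros[OF sum]]) (use le in auto)
  show "(\<integral>x. \<bar>rnodal y x * rnodal z x\<bar> \<partial>lborel) \<le> 1"
    using integral_mono[OF integrable_abs[OF int] integrable.intros[OF sum] le]
      has_bochner_integral_integral_eq[OF sum] by simp
qed

text \<open>Up to the factor \<open>2 y\<close> the integrand is \<open>\<kappa> (x - y) - \<kappa> (x + y)\<close> with
  \<open>\<kappa> x = sin\<^sup>2 (\<pi> x) / (\<pi>\<^sup>2 x)\<close>. For an antiderivative \<open>K\<close> of \<open>\<kappa>\<close>, the antiderivative
  \<open>K (x - y) - K (x + y)\<close> tends to 0 at \<open>\<plusminus>\<infinity>\<close> because \<open>\<kappa>\<close> does.\<close>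

lemma integral_rnodal_mult_eq_0:
  assumes y: "y > 0" and cos: "cos (pi * y) = 0"
  shows "(\<integral>x. rnodal y x * rnodal (- y) x \<partial>lborel) = 0"
proof -
  define \<kappa> where "\<kappa> = (\<lambda>x. sin (pi * x) / pi * sinc (pi * x))"
  have cont: "isCont \<kappa> x" for x
    unfolding \<kappa>_def by (intro continuous_intros isCont_o2[OF _ isCont_sinc]) auto
  have \<kappa>: "\<kappa> x * x = (sin (pi * x) / pi)\<^sup>2" for x
    by (simp add: \<kappa>_def power2_eq_square)
  have \<kappa>_le: "\<bar>\<kappa> x\<bar> \<le> 1 / \<bar>x\<bar>" if "x \<noteq> 0" for x
  proof -
    have "(sin (pi * x) / pi)\<^sup>2 \<le> 1\<^sup>2"
    proof (subst power2_le_iff_abs_le)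
      have "\<bar>sin (pi * x)\<bar> \<le> pi"
        using abs_sin_le_one[of "pi * x"] pi_gt3 by linarith
      then show "\<bar>sin (pi * x) / pi\<bar> \<le> 1" by simp
    qed auto
    then have "\<bar>\<kappa> x * x\<bar> \<le> 1"
      unfolding \<kappa> by simp
    then show ?thesis
      using that by (simp add: abs_mult field_simps)
  qed
  obtain K where K: "\<And>x. (K has_real_derivative \<kappa> x) (at x)"
    using einterval_antiderivative[of "-\<infinity>" \<infinity> \<kappa>] cont
    by (auto simp: has_real_derivative_iff_has_vector_derivative)
  define \<Phi> where "\<Phi> = (\<lambda>x. (K (x - y) - K (x + y)) / (2 * y))"
  have integrand: "\<kappa> (x - y) - \<kappa> (x + y) = 2 * y * (rnodal y x * rnodal (- y) x)" for x
  proof -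
    have s: "sin (pi * y) * sin (pi * y) = 1"
      using sin_squared_eq_1[OF cos] by (simp add: power2_eq_square)
    have shift: "sin (pi * (x - y)) = - cos (pi * x) * sin (pi * y)"
      "sin (pi * (x + y)) = cos (pi * x) * sin (pi * y)"
      using cos by (simp_all add: sin_diff sin_add ring_distribs)
    define c where "c = cos (pi * x) / pi"
    define p q where "p = rnodal y x" and "q = rnodal (- y) x"
    have mult: "p * (x - y) = c" "q * (x + y) = c"
    proof -
      have "p * (x - y) = - sin (pi * y) * (sin (pi * (x - y)) / pi)"
        by (simp add: p_def rnodal_def)
      then show "p * (x - y) = c"
        unfolding shift using s by (simp add: c_def mult.assoc[symmetric] mult.commute[of "sin (pi * y)" "_ * _"])
      have "q * (x + y) = sin (pi * y) * (sin (pi * (x + y)) / pi)"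
        by (simp add: q_def rnodal_def)
      then show "q * (x + y) = c"
        unfolding shift using s by (simp add: c_def)
    qed
    define S T where "S = sinc (pi * (x - y))" and "T = sinc (pi * (x + y))"
    have "\<kappa> (x - y) = sin (pi * (x - y)) / pi * S" "p = - sin (pi * y) * S"
      by (simp_all add: \<kappa>_def p_def rnodal_def S_def)
    then have 1: "\<kappa> (x - y) = c * p"
      unfolding shift by (simp add: c_def)
    have "\<kappa> (x + y) = sin (pi * (x + y)) / pi * T" "q = sin (pi * y) * T"
      by (simp_all add: \<kappa>_def q_def rnodal_def T_def)
    then have 2: "\<kappa> (x + y) = c * q"
      unfolding shift by (simp add: c_def)
    \<comment> \<open>Replacing c by q (x + y) in one term and by p (x - y) in the other leaves p q
      times (x + y) - (x - y) = 2 y.\<close>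
    have "c * p - c * q = q * (x + y) * p - p * (x - y) * q"
      by (simp only: mult)
    also have "\<dots> = 2 * y * (p * q)" by (simp add: algebra_simps)
    finally show ?thesis using 1 2 by (simp add: p_def q_def)
  qed
  have deriv: "(\<Phi> has_real_derivative rnodal y x * rnodal (- y) x) (at x)" for x
  proof -
    have "((\<lambda>x. K (x + a)) has_real_derivative \<kappa> (x + a)) (at x)" for a
      using K[of "x + a"] by (simp only: DERIV_shift)
    from DERIV_cdivide[OF DERIV_diff[OF this[of "- y"] this[of y]], of "2 * y"]
    have "(\<Phi> has_real_derivative (\<kappa> (x - y) - \<kappa> (x + y)) / (2 * y)) (at x)"
      by (simp add: \<Phi>_def)
    then show ?thesis
      using integrand[of x] y by simp
  qed
  \<comment> \<open>By the mean value theorem the difference quotient of K over [x - y, x + y],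
    which is the negative of the antiderivative at x, is a value of its derivative in that
    interval.\<close>
  have bound: "\<bar>\<Phi> x\<bar> \<le> 1 / (\<bar>x\<bar> - y)" if "\<bar>x\<bar> > y" for x
  proof -
    obtain \<xi> where \<xi>: "x - y < \<xi>" "\<xi> < x + y" "K (x + y) - K (x - y) = (x + y - (x - y)) * \<kappa> \<xi>"
      using MVT2[of "x - y" "x + y" K \<kappa>] K y by auto
    then have "\<Phi> x = - \<kappa> \<xi>"
      using y by (simp add: \<Phi>_def field_simps)
    moreover have "\<bar>x\<bar> - y \<le> \<bar>\<xi>\<bar>" using \<xi> by linarith
    then have "1 / \<bar>\<xi>\<bar> \<le> 1 / (\<bar>x\<bar> - y)"
      using that by (intro divide_left_mono) auto
    ultimately show ?thesis
      using \<kappa>_le[of \<xi>] \<open>\<bar>x\<bar> - y \<le> \<bar>\<xi>\<bar>\<close> that by force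
  qed
  have lim_top: "(\<Phi> \<longlongrightarrow> 0) at_top"
  proof (rule Lim_null_comparison)
    show "\<forall>\<^sub>F x in at_top. norm (\<Phi> x) \<le> 1 / (x - y)"
      using eventually_gt_at_top[of y]
    proof eventually_elim
      case (elim x)
      then show ?case using bound[of x] y by simp
    qed
    show "((\<lambda>x. 1 / (x - y)) \<longlongrightarrow> 0) at_top" by real_asymp
  qed
  have lim_bot: "(\<Phi> \<longlongrightarrow> 0) at_bot"
  proof (rule Lim_null_comparison)
    show "\<forall>\<^sub>F x in at_bot. norm (\<Phi> x) \<le> 1 / (- x - y)"
      using eventually_gt_at_bot[of "- y"]
    proof eventually_elim
      case (elim x)
      then show ?case using bound[of x] y by simp
    qed
    show "((\<lambda>x. 1 / (- x - y)) \<longlongrightarrow> 0) at_bot" by real_asymp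
  qed
  have int: "integrable lborel (\<lambda>x. rnodal y x * rnodal (- y) x)"
    using cos by (intro rnodal_mult_integrable) auto
  have "(LBINT x=-\<infinity>..\<infinity>. rnodal y x * rnodal (- y) x) = 0 - 0"
  proof (rule interval_integral_FTC_integrable)
    show "(\<Phi> has_vector_derivative rnodal y x * rnodal (- y) x) (at x)" for x
      using deriv by (simp add: has_real_derivative_iff_has_vector_derivative)
    show "isCont (\<lambda>x. rnodal y x * rnodal (- y) x) x" for x
      unfolding rnodal_def by (intro continuous_intros isCont_o2[OF _ isCont_sinc])
    show "set_integrable lborel (einterval (-\<infinity>) \<infinity>) (\<lambda>x. rnodal y x * rnodal (- y) x)"
      using int by (simp add: set_integrable_def einterval_eq)
    show "((\<Phi> \<circ> real_of_ereal) \<longlongrightarrow> 0) (at_right (-\<infinity>))"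
      using lim_bot unfolding ereal_tendsto_simps .
    show "((\<Phi> \<circ> real_of_ereal) \<longlongrightarrow> 0) (at_left \<infinity>)"
      using lim_top unfolding ereal_tendsto_simps .
  qed auto
  then show ?thesis
    by (simp add: interval_lebesgue_integral_def einterval_eq set_lebesgue_integral_def)
qed

definition rhermite :: "nat \<Rightarrow> real \<Rightarrow> real \<Rightarrow> real \<Rightarrow> real" where
  "rhermite k a b x = a * ((rnodal (node k) x)\<^sup>2 + (rnodal (- node k) x)\<^sup>2)
    + 2 * node k * b * (rnodal (node k) x * rnodal (- node k) x)"

lemma hermite_eq_rhermite: "hermite k a b (of_real x) = of_real (rhermite k a b x)"
  by (simp add: hermite_def rhermite_def nodal_eq_rnodal)

lemma rhermite_measurable [measurable]:
  assumes [measurable]: "a \<in> borel_measurable M" "b \<in> borel_measurable M" "f \<in> borel_measurable M"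
  shows "(\<lambda>x. rhermite k (a x) (b x) (f x)) \<in> borel_measurable M"
  unfolding rhermite_def by measurable

text \<open>Each square integrates to 1, and the cross term carrying \<open>b\<close> integrates to
  0 by orthogonality.\<close>

lemma has_bochner_integral_rhermite: "has_bochner_integral lborel (rhermite k a b) (2 * a)"
proof -
  have cm: "cos (pi * - node k) = 0" by (simp add: cos_node)
  have "has_bochner_integral lborel (\<lambda>x. rnodal (node k) x * rnodal (- node k) x) 0"
    using rnodal_mult_integrable(1)[OF cos_node cm] integral_rnodal_mult_eq_0[OF node_pos cos_node]
    by (simp add: has_bochner_integral_iff)
  then have "has_bochner_integral lborel (rhermite k a b) (a * (1 + 1) + 2 * node k * b * 0)"
    unfolding rhermite_def[abs_def]
    by (intro has_bochner_integral_add has_bochner_integral_mult_right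
        has_bochner_integral_rnodal_squared cos_node cm)
  then show ?thesis by (simp add: mult.commute)
qed

text \<open>In absolute value the cross term does not cancel. Its factor \<open>node k\<close> does
  no harm when b decays exponentially, as in \<open>has_bochner_integral_rL\<close>.\<close>

lemma integral_abs_rhermite_le:
  "(\<integral>x. \<bar>rhermite k a b x\<bar> \<partial>lborel) \<le> 2 * \<bar>a\<bar> + 2 * node k * \<bar>b\<bar>"
proof -
  have cm: "cos (pi * - node k) = 0" by (simp add: cos_node)
  note p = has_bochner_integral_rnodal_squared[OF cos_node, of k]
    and m = has_bochner_integral_rnodal_squared[OF cm]
    and pm = rnodal_mult_integrable[OF cos_node cm]
  have n: "node k > 0" by (rule node_pos)
  have "(\<integral>x. \<bar>rhermite k a b x\<bar> \<partial>lborel) \<le>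
      (\<integral>x. \<bar>a\<bar> * ((rnodal (node k) x)\<^sup>2 + (rnodal (- node k) x)\<^sup>2)
        + 2 * node k * \<bar>b\<bar> * \<bar>rnodal (node k) x * rnodal (- node k) x\<bar> \<partial>lborel)"
  proof (rule integral_mono)
    show "integrable lborel (\<lambda>x. \<bar>rhermite k a b x\<bar>)"
      using has_bochner_integral_rhermite[of k a b] by (simp add: has_bochner_integral_iff)
    show "integrable lborel (\<lambda>x. \<bar>a\<bar> * ((rnodal (node k) x)\<^sup>2 + (rnodal (- node k) x)\<^sup>2)
        + 2 * node k * \<bar>b\<bar> * \<bar>rnodal (node k) x * rnodal (- node k) x\<bar>)"
      using p m pm(1) by (intro Bochner_Integration.integrable_add integrable_mult_right integrable_abs)
        (auto simp: has_bochner_integral_iff)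
    fix x
    have "\<bar>rhermite k a b x\<bar> \<le> \<bar>a * ((rnodal (node k) x)\<^sup>2 + (rnodal (- node k) x)\<^sup>2)\<bar>
        + \<bar>2 * node k * b * (rnodal (node k) x * rnodal (- node k) x)\<bar>"
      unfolding rhermite_def by (rule abs_triangle_ineq)
    then show "\<bar>rhermite k a b x\<bar> \<le> \<bar>a\<bar> * ((rnodal (node k) x)\<^sup>2 + (rnodal (- node k) x)\<^sup>2)
        + 2 * node k * \<bar>b\<bar> * \<bar>rnodal (node k) x * rnodal (- node k) x\<bar>"
      using n by (simp add: abs_mult)
  qed
  also have "\<dots> = \<bar>a\<bar> * 2 + 2 * node k * \<bar>b\<bar> * (\<integral>x. \<bar>rnodal (node k) x * rnodal (- node k) x\<bar> \<partial>lborel)"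
    using p m pm(1) by (simp add: has_bochner_integral_iff integrable_abs)
  also have "\<dots> \<le> \<bar>a\<bar> * 2 + 2 * node k * \<bar>b\<bar> * 1"
    using pm(2) n by (intro add_left_mono mult_left_mono) auto
  finally show ?thesis by simp
qed

text \<open>The real form of L on the real axis. Given as a series of measurable terms, it is
  jointly measurable in both arguments, as Tonelli and Fubini require.\<close>

definition rL :: "real \<Rightarrow> real \<Rightarrow> real" where
  "rL l x = (\<Sum>k. rhermite k (exp (- l * node k)) (- l * exp (- l * node k)) x)"

lemma L_series_eq_rL:
  assumes "l > 0"
  shows "L_series l (of_real x) = of_real (rL l x)"
proof -
  have "summable (\<lambda>k. complex_of_real (rhermite k (exp (- l * node k)) (- l * exp (- l * node k)) x))"
    using summable_hermite[OF summable_weight_exp[OF assms], of "of_real x"]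
    by (simp add: hermite_eq_rhermite)
  then have "summable (\<lambda>k. rhermite k (exp (- l * node k)) (- l * exp (- l * node k)) x)"
    by (simp add: summable_of_real_iff)
  then show ?thesis
    unfolding L_series_def rL_def hermite_eq_rhermite by (rule suminf_of_real[symmetric])
qed

lemma L_fun_eq_rL: "l > 0 \<Longrightarrow> L_fun l (of_real x) = of_real (rL l x)"
  by (simp add: L_fun_eq_L_series L_series_eq_rL)

lemma rL_le_exp: "l > 0 \<Longrightarrow> rL l x \<le> exp (- l * \<bar>x\<bar>)"
  using L_series_le_exp[of l x] by (simp add: L_series_eq_rL)

lemma rL_measurable [measurable]:
  assumes [measurable]: "f \<in> borel_measurable M" "g \<in> borel_measurable M"
  shows "(\<lambda>x. rL (f x) (g x)) \<in> borel_measurable M"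
  unfolding rL_def by measurable

lemma summable_node_exp:
  assumes l: "l > 0"
  shows "summable (\<lambda>k. node k * exp (- l * node k))"
proof (rule summable_comparison_test')
  show "summable (\<lambda>k. 2 / l * exp (- (l / 2) * node k))"
    using l by (intro summable_mult summable_exp_node) auto
  fix k
  have "l * node k / 2 \<le> exp (l * node k / 2)"
    using exp_ge_add_one_self[of "l * node k / 2"] by linarith
  then have "node k * exp (- l * node k) \<le> 2 / l * exp (l * node k / 2) * exp (- l * node k)"
    using l by (intro mult_right_mono) (auto simp: field_simps)
  also have "\<dots> = 2 / l * exp (- (l / 2) * node k)"
    by (simp flip: exp_add)
  finally show "norm (node k * exp (- l * node k)) \<le> 2 / l * exp (- (l / 2) * node k)"
    using node_pos[of k] by (simp add: abs_mult)
qed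

lemma has_bochner_integral_rL:
  assumes l: "l > 0"
  shows "has_bochner_integral lborel (rL l) (1 / sinh (l / 2))"
proof -
  let ?f = "\<lambda>k. rhermite k (exp (- l * node k)) (- l * exp (- l * node k))"
  have int: "integrable lborel (?f k)" "integral\<^sup>L lborel (?f k) = 2 * exp (- l * node k)" for k
    using has_bochner_integral_rhermite by (auto simp: has_bochner_integral_iff)
  have AE: "AE x in lborel. summable (\<lambda>k. norm (?f k x))"
  proof (rule AE_I2)
    show "summable (\<lambda>k. norm (?f k x))" for x
      using summable_norm_hermite[OF summable_weight_exp[OF l], of "of_real x"]
      unfolding hermite_eq_rhermite by simp
  qed
  have summ: "summable (\<lambda>k. \<integral>x. norm (?f k x) \<partial>lborel)"
  proof (rule summable_comparison_test')
    show "summable (\<lambda>k. 2 * exp (- l * node k) + 2 * l * (node k * exp (- l * node k)))"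
      using l by (intro summable_add summable_mult summable_exp_node summable_node_exp)
    show "norm (\<integral>x. norm (?f k x) \<partial>lborel) \<le> 2 * exp (- l * node k) + 2 * l * (node k * exp (- l * node k))" for k
      using integral_abs_rhermite_le[of k "exp (- l * node k)" "- l * exp (- l * node k)"] l
      by (simp add: abs_mult mult_ac)
  qed
  have "integrable lborel (rL l)"
    unfolding rL_def[abs_def] by (rule integrable_suminf[OF int(1) AE summ])
  moreover have "integral\<^sup>L lborel (rL l) = 1 / sinh (l / 2)"
  proof -
    have "(\<lambda>k. 2 * exp (- l * node k)) sums integral\<^sup>L lborel (rL l)"
      using sums_integral[OF int(1) AE summ] unfolding int(2) rL_def[abs_def] .
    moreover have "(\<lambda>k. 2 * exp (- l * node k)) sums (2 * (1 / (2 * sinh (l / 2))))"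
      by (intro sums_mult sums_exp_node l)
    ultimately show ?thesis
      by (simp add: sums_iff)
  qed
  ultimately show ?thesis
    by (simp add: has_bochner_integral_iff)
qed

section \<open>The integral and the Fourier transform of exp(-s |x|)\<close>

lemma
  fixes s :: real
  assumes s: "s > 0"
  shows has_bochner_integral_exp_abs: "has_bochner_integral lborel (\<lambda>x. exp (- s * \<bar>x\<bar>)) (2 / s)"
    and has_bochner_integral_exp_abs_fourier:
      "has_bochner_integral lborel (\<lambda>x. of_real (exp (- s * \<bar>x\<bar>)) * e2pi (of_real (- t * x)))
        (complex_of_real (2 * s / (s\<^sup>2 + 4 * pi\<^sup>2 * t\<^sup>2)))"
proof -
  have "(\<integral>\<^sup>+x. ennreal (exp (- s * x)) * indicator {0..} x \<partial>lborel) = ennreal (0 - (- exp (- s * 0) / s))"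
  proof (rule nn_integral_FTC_atLeast)
    show "((\<lambda>x. - exp (- s * x) / s) has_real_derivative exp (- s * x)) (at x)" for x
      using s by (auto intro!: derivative_eq_intros)
    show "((\<lambda>x. - exp (- s * x) / s) \<longlongrightarrow> 0) at_top"
      using s by real_asymp
  qed auto
  then have "has_bochner_integral lborel (\<lambda>x. exp (- s * x) * indicator {0..} x) (1 / s)"
    using s by (intro has_bochner_integral_nn_integral)
      (auto simp: ennreal_mult'' ennreal_indicator)
  then have half: "has_bochner_integral lborel (\<lambda>x. indicator {0..} x *\<^sub>R exp (- s * \<bar>x\<bar>)) (1 / s)"
    by (rule has_bochner_integral_cong[THEN iffD1, rotated -1]) (auto split: split_indicator)
  show full: "has_bochner_integral lborel (\<lambda>x. exp (- s * \<bar>x\<bar>)) (2 / s)"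
    using has_bochner_integral_even_function[OF half] by simp
  define f where "f = (\<lambda>x::real. complex_of_real (exp (- s * \<bar>x\<bar>)) * e2pi (of_real (- t * x)))"
  have f_int: "integrable lborel f"
    unfolding f_def
  proof (rule Bochner_Integration.integrable_bound[OF integrable.intros[OF full]])
    show "(\<lambda>x. complex_of_real (exp (- s * \<bar>x\<bar>)) * e2pi (of_real (- t * x))) \<in> borel_measurable lborel"
      unfolding e2pi_def by (auto intro!: borel_measurable_continuous_onI continuous_intros)
  qed (auto simp: norm_mult e2pi_def)
  \<comment> \<open>Folding the line onto the positive half-line makes the integrand the real
    function 2 exp(-s x) cos(c x), whose antiderivative is F.\<close>
  define g where "g = (\<lambda>x. indicator {0<..} x *\<^sub>R (f x + f (- x)))"
  define c where "c = 2 * pi * t"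
  define F where "F = (\<lambda>x. exp (- s * x) * (2 * (c * sin (c * x) - s * cos (c * x)) / (s\<^sup>2 + c\<^sup>2)))"
  have sc: "s\<^sup>2 + c\<^sup>2 > 0" using s by (simp add: add_pos_nonneg)
  have ff: "f x + f (- x) = of_real (exp (- s * \<bar>x\<bar>) * (2 * cos (c * x)))" for x
  proof -
    have "e2pi (of_real (- t * x)) + e2pi (of_real (- t * - x)) = of_real (2 * cos (c * x))"
    proof -
      have "cos (complex_of_real (c * x)) = (exp (\<i> * of_real (c * x)) + exp (- \<i> * of_real (c * x))) / 2"
        by (simp add: cos_exp_eq)
      moreover have e: "2 * of_real pi * \<i> * of_real (- t * x) = - \<i> * of_real (c * x)"
        "2 * of_real pi * \<i> * of_real (- t * - x) = \<i> * complex_of_real (c * x)"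
        by (simp_all add: c_def)
      ultimately show ?thesis
        unfolding e2pi_def e of_real_mult[of 2 "cos _"] cos_of_real[symmetric] by (simp add: algebra_simps)
    qed
    then show ?thesis
      by (simp add: f_def flip: distrib_left)
  qed
  have "has_bochner_integral lborel (\<lambda>x. indicator {0<..} x *\<^sub>R (exp (- s * x) * (2 * cos (c * x)))) (2 * s / (s\<^sup>2 + c\<^sup>2))"
  proof -
    have bnd: "integrable lborel (\<lambda>x. indicator {0<..} x *\<^sub>R (exp (- s * x) * (2 * cos (c * x))))"
    proof (rule Bochner_Integration.integrable_bound[OF integrable_mult_right[OF integrable.intros[OF full], of 2]])
      show "AE x in lborel. norm (indicator {0<..} x *\<^sub>R (exp (- s * x) * (2 * cos (c * x)))) \<le> norm (2 * exp (- s * \<bar>x\<bar>))"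
        by (auto split: split_indicator simp: abs_mult)
    qed auto
    have "(LBINT x=0..\<infinity>. exp (- s * x) * (2 * cos (c * x))) = 0 - F 0"
    proof (rule interval_integral_FTC_integrable)
      show "(F has_vector_derivative exp (- s * x) * (2 * cos (c * x))) (at x)" for x
      proof -
        define D where "D = s\<^sup>2 + c\<^sup>2"
        have "D \<noteq> 0" using sc unfolding D_def by linarith
        have "(F has_real_derivative
            (exp (- s * x) * - s) * (2 * (c * sin (c * x) - s * cos (c * x)) / D)
            + exp (- s * x) * (2 * (c * (cos (c * x) * c) + s * (sin (c * x) * c)) / D)) (at x)"
          unfolding F_def D_def[symmetric] using \<open>D \<noteq> 0\<close>
          by (auto intro!: derivative_eq_intros simp: field_simps)
        also have "(exp (- s * x) * - s) * (2 * (c * sin (c * x) - s * cos (c * x)) / D)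
            + exp (- s * x) * (2 * (c * (cos (c * x) * c) + s * (sin (c * x) * c)) / D)
            = exp (- s * x) * (2 * cos (c * x)) * (s\<^sup>2 + c\<^sup>2) / D"
          by (simp add: algebra_simps power2_eq_square flip: add_divide_distrib diff_divide_distrib)
        finally show ?thesis
          using \<open>D \<noteq> 0\<close> by (simp add: has_real_derivative_iff_has_vector_derivative flip: D_def)
      qed
      show "set_integrable lborel (einterval 0 \<infinity>) (\<lambda>x. exp (- s * x) * (2 * cos (c * x)))"
        using bnd by (simp add: set_integrable_def einterval_eq zero_ereal_def)
      have "isCont F 0" unfolding F_def using sc by (intro continuous_intros) auto
      then show "((F \<circ> real_of_ereal) \<longlongrightarrow> F 0) (at_right 0)"
        unfolding zero_ereal_def ereal_tendsto_simps isCont_def by (rule filterlim_at_split[THEN iffD1, THEN conjunct2])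
      have "(F \<longlongrightarrow> 0) at_top"
      proof (rule Lim_null_comparison)
        show "\<forall>\<^sub>F x in at_top. norm (F x) \<le> exp (- s * x) * (2 * (\<bar>c\<bar> + s) / (s\<^sup>2 + c\<^sup>2))"
        proof (intro always_eventually allI)
          fix x
          have "\<bar>c * sin (c * x) - s * cos (c * x)\<bar> \<le> \<bar>c\<bar> * \<bar>sin (c * x)\<bar> + s * \<bar>cos (c * x)\<bar>"
            using abs_triangle_ineq4[of "c * sin (c * x)" "s * cos (c * x)"] s by (simp add: abs_mult)
          also have "\<dots> \<le> \<bar>c\<bar> * 1 + s * 1"
            using s by (intro add_mono mult_left_mono) auto
          finally show "norm (F x) \<le> exp (- s * x) * (2 * (\<bar>c\<bar> + s) / (s\<^sup>2 + c\<^sup>2))"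
            using sc by (simp add: F_def abs_mult divide_right_mono)
        qed
        show "((\<lambda>x. exp (- s * x) * (2 * (\<bar>c\<bar> + s) / (s\<^sup>2 + c\<^sup>2))) \<longlongrightarrow> 0) at_top"
          by (rule tendsto_mult_left_zero) (use s in real_asymp)
      qed
      then show "((F \<circ> real_of_ereal) \<longlongrightarrow> 0) (at_left \<infinity>)"
        unfolding ereal_tendsto_simps .
    qed (auto intro!: continuous_intros)
    then have "(\<integral>x. indicator {0<..} x *\<^sub>R (exp (- s * x) * (2 * cos (c * x))) \<partial>lborel) = 2 * s / (s\<^sup>2 + c\<^sup>2)"
      by (simp add: interval_lebesgue_integral_0_infty set_lebesgue_integral_def F_def)
    with bnd show ?thesis by (simp add: has_bochner_integral_iff)
  qed
  then have "has_bochner_integral lborel (\<lambda>x. complex_of_real (indicator {0<..} x *\<^sub>R (exp (- s * x) * (2 * cos (c * x)))))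
      (of_real (2 * s / (s\<^sup>2 + c\<^sup>2)))"
    by (rule has_bochner_integral_of_real)
  then have g: "has_bochner_integral lborel g (of_real (2 * s / (s\<^sup>2 + c\<^sup>2)))"
    by (rule has_bochner_integral_cong[THEN iffD1, rotated -1])
      (auto simp: g_def ff split: split_indicator)
  have "integral\<^sup>L lborel f = integral\<^sup>L lborel g"
  proof -
    have i1: "integrable lborel (\<lambda>x. indicator {0<..} x *\<^sub>R f x)"
      and i2: "integrable lborel (\<lambda>x. indicator {..<0} x *\<^sub>R f x)"
      using f_int by (auto intro: integrable_mult_indicator)
    have i3: "integrable lborel (\<lambda>x. indicator {0<..} x *\<^sub>R f (- x))"
      using lborel_integrable_real_affine[OF i2, of "-1" 0] by (simp add: indicator_def)
    have "integral\<^sup>L lborel f = (\<integral>x. indicator {0<..} x *\<^sub>R f x + indicator {..<0} x *\<^sub>R f x \<partial>lborel)"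
    proof (rule integral_cong_AE)
      show "AE x in lborel. f x = indicator {0<..} x *\<^sub>R f x + indicator {..<0} x *\<^sub>R f x"
        using AE_lborel_singleton[of 0] by eventually_elim (auto split: split_indicator)
    qed (use f_int i1 i2 in auto)
    also have "\<dots> = (\<integral>x. indicator {0<..} x *\<^sub>R f x \<partial>lborel) + (\<integral>x. indicator {..<0} x *\<^sub>R f x \<partial>lborel)"
      by (rule Bochner_Integration.integral_add[OF i1 i2])
    also have "(\<integral>x. indicator {..<0} x *\<^sub>R f x \<partial>lborel) = (\<integral>x. indicator {0<..} x *\<^sub>R f (- x) \<partial>lborel)"
      by (subst lborel_integral_real_affine[of "-1" _ 0]) (simp_all add: indicator_def)
    also have "(\<integral>x. indicator {0<..} x *\<^sub>R f x \<partial>lborel) + \<dots> = integral\<^sup>L lborel g"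
      unfolding g_def scaleR_add_right by (rule Bochner_Integration.integral_add[OF i1 i3, symmetric])
    finally show ?thesis .
  qed
  then show "has_bochner_integral lborel (\<lambda>x. of_real (exp (- s * \<bar>x\<bar>)) * e2pi (of_real (- t * x)))
        (complex_of_real (2 * s / (s\<^sup>2 + 4 * pi\<^sup>2 * t\<^sup>2)))"
    using f_int g by (simp add: has_bochner_integral_iff f_def c_def power_mult_distrib)
qed

section \<open>Integration against a measure\<close>

lemma ereal_integral_eq_integral:
  assumes "integrable M u"
  shows "ereal_integral M (\<lambda>x. ereal (u x)) = ereal (integral\<^sup>L M u)"
proof -
  have fin: "(\<integral>\<^sup>+x. ennreal (u x) \<partial>M) \<noteq> \<infinity>" "(\<integral>\<^sup>+x. ennreal (- u x) \<partial>M) \<noteq> \<infinity>"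
    using assms by (simp_all add: real_integrable_def)
  have e: "enn2ereal t = ereal (enn2real t)" if "t \<noteq> \<infinity>" for t
    using that by (metis enn2ereal_ennreal enn2real_nonneg ennreal_enn2real infinity_ennreal_def less_top)
  show ?thesis
    unfolding ereal_integral_def real_lebesgue_integral_def[OF assms] uminus_ereal.simps e2ennreal_ereal
      e[OF fin(1)] e[OF fin(2)] by simp
qed

lemma ereal_integral_nonneg:
  assumes "\<And>x. x \<in> space M \<Longrightarrow> 0 \<le> u x"
  shows "ereal_integral M (\<lambda>x. ereal (u x)) = enn2ereal (\<integral>\<^sup>+x. ennreal (u x) \<partial>M)"
proof -
  have "(\<integral>\<^sup>+x. e2ennreal (- ereal (u x)) \<partial>M) = (\<integral>\<^sup>+x. 0 \<partial>M)"
    using assms by (intro nn_integral_cong) (auto simp: ennreal_neg)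
  then show ?thesis
    by (simp add: ereal_integral_def zero_ennreal.rep_eq)
qed

lemma exp_le_quadratic:
  fixes a l :: real
  assumes "a > 0" "l > 0"
  shows "exp (- l * a) \<le> (1 + 2 / a\<^sup>2) / (l\<^sup>2 + 1)"
proof -
  \<comment> \<open>The products 1 * 1 and (2 / a^2) * (l a)^2 / 2 already add up to l^2 +
    1.\<close>
  have "l\<^sup>2 + 1 \<le> (1 + 2 / a\<^sup>2) * (1 + (l * a)\<^sup>2 / 2)"
    using assms by (simp add: field_simps power_mult_distrib)
  also have "\<dots> \<le> (1 + 2 / a\<^sup>2) * exp (l * a)"
  proof (rule mult_left_mono)
    have "0 \<le> l * a" using assms by simp
    then show "1 + (l * a)\<^sup>2 / 2 \<le> exp (l * a)"
      using exp_lower_Taylor_quadratic[of "l * a"] by linarith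
  qed (use assms in simp)
  finally show ?thesis
    by (simp add: exp_minus divide_simps add_nonneg_pos mult.commute)
qed

text \<open>The mean value bound l |a - b| exp(-l c), weakened to the decay of the measure. The
  factor |a - b| and the uniformity in a, b >= c make it a dominating function for difference
  quotients as well.\<close>

lemma abs_exp_diff_le:
  fixes a b c l :: real
  assumes "c > 0" "c \<le> a" "c \<le> b" "l > 0"
  shows "\<bar>exp (- l * a) - exp (- l * b)\<bar> \<le> \<bar>a - b\<bar> * (1 + 2 / c\<^sup>2) * (l / (l\<^sup>2 + 1))"
  using assms(2,3)
proof (induction a b rule: linorder_wlog)
  case (le a b)
  have "exp (- l * a) * (1 - exp (- l * (b - a))) = exp (- l * a) - exp (- l * b)"
    by (simp add: algebra_simps flip: exp_add)
  moreover have "exp (- l * a) * (1 - exp (- l * (b - a))) \<le> (1 + 2 / c\<^sup>2) / (l\<^sup>2 + 1) * (l * (b - a))"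
  proof (rule mult_mono)
    have "exp (- l * a) \<le> exp (- l * c)"
      using assms le by simp
    also have "\<dots> \<le> (1 + 2 / c\<^sup>2) / (l\<^sup>2 + 1)"
      by (rule exp_le_quadratic) (use assms in auto)
    finally show "exp (- l * a) \<le> (1 + 2 / c\<^sup>2) / (l\<^sup>2 + 1)" .
    show "1 - exp (- l * (b - a)) \<le> l * (b - a)"
      using exp_ge_add_one_self[of "- l * (b - a)"] by simp
    show "0 \<le> 1 - exp (- l * (b - a))"
      using assms le by simp
  qed (use assms in \<open>simp add: add_nonneg_pos\<close>)
  moreover have "exp (- l * b) \<le> exp (- l * a)"
    using assms le by simp
  ultimately show ?case
    using le by (simp add: mult_ac)
next
  case (sym a b)
  then show ?case by (simp add: abs_minus_commute)
qed

text \<open>After clearing denominators, c (l^2 + 1) is dominated term by term by (c + 1/c)(l^2 +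
  c^2). This carries the integrability condition through a rescaling of the variable of
  integration.\<close>

lemma decay_scale_le:
  fixes c l :: real
  assumes "c > 0" "l > 0"
  shows "(l / c) / ((l / c)\<^sup>2 + 1) \<le> (c + 1 / c) * (l / (l\<^sup>2 + 1))"
proof -
  have "(l / c) / ((l / c)\<^sup>2 + 1) = l * c / (l\<^sup>2 + c\<^sup>2)"
    using assms by (simp add: field_simps power2_eq_square)
  also have "\<dots> \<le> (c + 1 / c) * (l / (l\<^sup>2 + 1))"
  proof -
    have "l * c * (l\<^sup>2 + 1) \<le> (c + 1 / c) * l * (l\<^sup>2 + c\<^sup>2)"
      using assms by (simp add: field_simps power2_eq_square)
    then show ?thesis
      using assms by (simp add: divide_simps add_pos_pos mult_ac)
  qed
  finally show ?thesis .
qed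

section \<open>Measures that integrate l / (l^2 + 1)\<close>

locale decay_measure =
  fixes M :: "real measure"
  assumes sets_M: "sets M = sets borel_pos"
    and integrable_decay: "integrable M (\<lambda>l. l / (l\<^sup>2 + 1))"
begin

lemma space_M: "space M = {0<..}"
  using sets_eq_imp_space_eq[OF sets_M] by (simp add: space_restrict_space)

lemma measurable_M: "f \<in> borel_measurable borel \<Longrightarrow> f \<in> borel_measurable M"
  unfolding measurable_cong_sets[OF sets_M refl] by (rule measurable_restrict_space1)

lemma integrable_of_decay:
  fixes f :: "real \<Rightarrow> 'b::{banach, second_countable_topology}"
  assumes "f \<in> borel_measurable borel" "\<And>l. l > 0 \<Longrightarrow> norm (f l) \<le> C * (l / (l\<^sup>2 + 1))"
  shows "integrable M f"
proof (rule Bochner_Integration.integrable_bound)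
  show "integrable M (\<lambda>l. C * (l / (l\<^sup>2 + 1)))"
    by (intro integrable_mult_right integrable_decay)
  show "AE l in M. norm (f l) \<le> norm (C * (l / (l\<^sup>2 + 1)))"
  proof (rule AE_I2)
    fix l assume "l \<in> space M"
    then have "norm (f l) \<le> C * (l / (l\<^sup>2 + 1))"
      by (intro assms(2)) (simp add: space_M)
    then show "norm (f l) \<le> norm (C * (l / (l\<^sup>2 + 1)))"
      by (rule order.trans) (simp only: real_norm_def abs_ge_self)
  qed
qed (rule measurable_M[OF assms(1)])

text \<open>A strictly positive integrable function exists: its superlevel sets cover the space and
  have finite measure by Markov's inequality.\<close>

lemma sigma_finite: "sigma_finite_measure M"
proof
  define A where "A = (\<lambda>n. {l \<in> space M. l / (l\<^sup>2 + 1) \<ge> 1 / real (Suc n)})"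
  have fin: "emeasure M (A n) \<noteq> \<infinity>" for n
  proof -
    have "AE l in M. 0 \<le> l / (l\<^sup>2 + 1)"
      by (rule AE_I2) (simp add: space_M)
    then have "emeasure M (A n) \<le> ennreal (1 / (1 / real (Suc n)) * (\<integral>l. l / (l\<^sup>2 + 1) \<partial>M))"
      unfolding A_def by (intro integral_Markov_inequality integrable_decay) auto
    then show ?thesis
      by (metis ennreal_less_top infinity_ennreal_def leD)
  qed
  have "l \<in> (\<Union>n. A n)" if "l \<in> space M" for l
  proof -
    have "l / (l\<^sup>2 + 1) > 0"
      using that by (simp add: space_M add_nonneg_pos)
    then obtain n where "1 / real (Suc n) < l / (l\<^sup>2 + 1)"
      using reals_Archimedean by (auto simp: inverse_eq_divide)
    with that show ?thesis
      unfolding A_def by (auto intro: less_imp_le)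
  qed
  then have "\<Union> (range A) = space M"
    unfolding A_def by auto
  moreover have "A n \<in> sets M" for n
  proof -
    have [measurable]: "(\<lambda>l::real. l / (l\<^sup>2 + 1)) \<in> borel_measurable M"
      by (intro measurable_M) measurable
    show ?thesis unfolding A_def by measurable
  qed
  ultimately show "\<exists>A. countable A \<and> A \<subseteq> sets M \<and> \<Union> A = space M \<and> (\<forall>a\<in>A. emeasure M a \<noteq> \<infinity>)"
    using fin by (intro exI[of _ "range A"]) auto
qed

lemma integrable_exp_diff:
  assumes "a > 0" "b > 0"
  shows "integrable M (\<lambda>l. exp (- l * a) - exp (- l * b))"
proof (rule integrable_of_decay)
  show "norm (exp (- l * a) - exp (- l * b)) \<le>
      \<bar>a - b\<bar> * (1 + 2 / (min a b)\<^sup>2) * (l / (l\<^sup>2 + 1))" if "l > 0" for l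
    using abs_exp_diff_le[of "min a b" a b l] assms that by simp
qed measurable

lemma f_meas_eq:
  assumes "x \<noteq> 0"
  shows "f_meas M x = ereal (\<integral>l. exp (- l * \<bar>x\<bar>) - exp (- l) \<partial>M)"
  using integrable_exp_diff[of "\<bar>x\<bar>" 1] assms
  unfolding f_meas_def by (intro ereal_integral_eq_integral) simp

text \<open>Dominated convergence of the difference quotients. Restricting to t > y/2 keeps t away
  from 0, where the constant of \<open>abs_exp_diff_le\<close> blows up.\<close>

lemma has_derivative_exp_diff:
  assumes y: "y > 0"
  shows "((\<lambda>t. \<integral>l. exp (- l * t) - exp (- l) \<partial>M) has_real_derivative (\<integral>l. - l * exp (- l * y) \<partial>M)) (at y)"
  unfolding has_field_derivative_iff
proof -
  let ?h = "\<lambda>t. \<integral>l. exp (- l * t) - exp (- l) \<partial>M"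
  have "((\<lambda>t. (?h t - ?h y) / (t - y)) \<longlongrightarrow> (\<integral>l. - l * exp (- l * y) \<partial>M)) (at y within {y/2<..})"
    unfolding tendsto_at_iff_sequentially o_def
  proof (intro allI impI)
    fix s :: "nat \<Rightarrow> real" assume s: "\<forall>i. s i \<in> {y/2<..} - {y}" "s \<longlonglongrightarrow> y"
    have "(\<lambda>i. \<integral>l. (exp (- l * s i) - exp (- l * y)) / (s i - y) \<partial>M) \<longlonglongrightarrow> (\<integral>l. - l * exp (- l * y) \<partial>M)"
    proof (rule integral_dominated_convergence)
      show "integrable M (\<lambda>l. (1 + 2 / (y/2)\<^sup>2) * (l / (l\<^sup>2 + 1)))"
        by (intro integrable_mult_right integrable_decay)
      show "AE l in M. norm ((exp (- l * s i) - exp (- l * y)) / (s i - y))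
          \<le> (1 + 2 / (y/2)\<^sup>2) * (l / (l\<^sup>2 + 1))" for i
      proof (rule AE_I2)
        fix l assume "l \<in> space M"
        then have "\<bar>exp (- l * s i) - exp (- l * y)\<bar> \<le> \<bar>s i - y\<bar> * (1 + 2 / (y/2)\<^sup>2) * (l / (l\<^sup>2 + 1))"
          using s(1) y by (intro abs_exp_diff_le) (auto simp: space_M less_imp_le)
        moreover have "\<bar>s i - y\<bar> > 0" using s(1) by auto
        ultimately show "norm ((exp (- l * s i) - exp (- l * y)) / (s i - y))
            \<le> (1 + 2 / (y/2)\<^sup>2) * (l / (l\<^sup>2 + 1))"
          by (simp add: abs_divide divide_le_eq mult_ac)
      qed
      show "AE l in M. (\<lambda>i. (exp (- l * s i) - exp (- l * y)) / (s i - y)) \<longlonglongrightarrow> - l * exp (- l * y)"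
      proof (rule AE_I2)
        fix l
        have "((\<lambda>t. exp (- l * t)) has_real_derivative - l * exp (- l * y)) (at y)"
          by (auto intro!: derivative_eq_intros)
        then have "((\<lambda>t. (exp (- l * t) - exp (- l * y)) / (t - y)) \<longlongrightarrow> - l * exp (- l * y)) (at y)"
          by (simp add: has_field_derivative_iff)
        then show "(\<lambda>i. (exp (- l * s i) - exp (- l * y)) / (s i - y)) \<longlonglongrightarrow> - l * exp (- l * y)"
          using s unfolding tendsto_at_iff_sequentially o_def by auto
      qed
    qed (auto intro!: measurable_M)
    moreover have "(\<integral>l. (exp (- l * s i) - exp (- l * y)) / (s i - y) \<partial>M) = (?h (s i) - ?h y) / (s i - y)" for i
    proof -
      have "s i > 0" using s(1) y by (metis DiffD1 greaterThan_iff half_gt_zero less_trans)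
      then have "?h (s i) - ?h y = (\<integral>l. (exp (- l * s i) - exp (- l)) - (exp (- l * y) - exp (- l)) \<partial>M)"
        using integrable_exp_diff[of "s i" 1] integrable_exp_diff[of y 1] y
        by (subst Bochner_Integration.integral_diff) auto
      then show ?thesis by simp
    qed
    ultimately show "(\<lambda>i. (?h (s i) - ?h y) / (s i - y)) \<longlonglongrightarrow> (\<integral>l. - l * exp (- l * y) \<partial>M)"
      by (simp only:)
  qed
  moreover have "at y within {y/2<..} = at y"
    using y by (intro at_within_open) auto
  ultimately show "((\<lambda>t. (?h t - ?h y) / (t - y)) \<longlongrightarrow> (\<integral>l. - l * exp (- l * y) \<partial>M)) (at y)"
    by (simp only:)
qed

lemma f_meas'_eq:
  assumes y: "y > 0"
  shows "f_meas' M y = (\<integral>l. - l * exp (- l * y) \<partial>M)"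
    and "f_meas' M (- y) = - (\<integral>l. - l * exp (- l * y) \<partial>M)"
proof -
  let ?h = "\<lambda>t. \<integral>l. exp (- l * t) - exp (- l) \<partial>M"
  have "((\<lambda>t. real_of_ereal (f_meas M t)) has_real_derivative (\<integral>l. - l * exp (- l * y) \<partial>M)) (at y)"
    by (rule has_field_derivative_transform_within_open[OF has_derivative_exp_diff[OF y], of "{0<..}"])
      (use y in \<open>auto simp: f_meas_eq\<close>)
  then show "f_meas' M y = (\<integral>l. - l * exp (- l * y) \<partial>M)"
    unfolding f_meas'_def by (rule DERIV_imp_deriv)
  have "((\<lambda>t. ?h (- t)) has_real_derivative (\<integral>l. - l * exp (- l * y) \<partial>M) * - 1) (at (- y))"
    by (rule DERIV_chain2[where f = ?h]) (use has_derivative_exp_diff[OF y] in \<open>auto intro!: derivative_eq_intros\<close>)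
  then have "((\<lambda>t. real_of_ereal (f_meas M t)) has_real_derivative (\<integral>l. - l * exp (- l * y) \<partial>M) * - 1) (at (- y))"
    by (rule has_field_derivative_transform_within_open[of _ _ _ "{..<0}"])
      (use y in \<open>auto simp: f_meas_eq\<close>)
  then show "f_meas' M (- y) = - (\<integral>l. - l * exp (- l * y) \<partial>M)"
    unfolding f_meas'_def by (simp add: DERIV_imp_deriv)
qed

section \<open>The function G of a measure\<close>

definition val :: "nat \<Rightarrow> real" where
  "val k = (\<integral>l. exp (- l * node k) - exp (- l) \<partial>M)"

definition slope :: "nat \<Rightarrow> real" where
  "slope k = (\<integral>l. - l * exp (- l * node k) \<partial>M)"

abbreviation weight_exp :: "nat \<Rightarrow> real \<Rightarrow> real" where
  "weight_exp k l \<equiv> weight k (exp (- l * node k) - exp (- l)) (- l * exp (- l * node k))"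

lemma weight_exp_measurable: "weight_exp k \<in> borel_measurable borel"
  unfolding weight_def by measurable

lemma integrable_weight_exp: "integrable M (weight_exp k)"
proof (rule integrable_of_decay[OF weight_exp_measurable])
  fix l :: real assume l: "l > 0"
  have "weight_exp k l \<le> (\<Sum>j<Suc k. weight_exp j l)"
    using weight_nonneg by (auto intro!: sum_nonneg)
  also have "\<dots> \<le> weight_const * (l / (l\<^sup>2 + 1))"
    by (rule sum_weight_exp_le[OF l])
  finally show "norm (weight_exp k l) \<le> weight_const * (l / (l\<^sup>2 + 1))"
    using weight_nonneg by simp
qed

lemma summable_integral_weight_exp: "summable (\<lambda>k. \<integral>l. weight_exp k l \<partial>M)"
proof (rule summableI_nonneg_bounded)
  show "0 \<le> (\<integral>l. weight_exp k l \<partial>M)" for k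
    by (intro integral_nonneg_AE AE_I2 weight_nonneg)
  fix N
  have "(\<Sum>k<N. \<integral>l. weight_exp k l \<partial>M) = (\<integral>l. (\<Sum>k<N. weight_exp k l) \<partial>M)"
    by (rule Bochner_Integration.integral_sum[OF integrable_weight_exp, symmetric])
  also have "\<dots> \<le> (\<integral>l. weight_const * (l / (l\<^sup>2 + 1)) \<partial>M)"
    by (intro integral_mono sum_weight_exp_le integrable_mult_right integrable_decay
        Bochner_Integration.integrable_sum integrable_weight_exp) (simp add: space_M)
  finally show "(\<Sum>k<N. \<integral>l. weight_exp k l \<partial>M) \<le> (\<integral>l. weight_const * (l / (l\<^sup>2 + 1)) \<partial>M)" .
qed

lemma integrable_slope: "integrable M (\<lambda>l. - l * exp (- l * node k))"
proof (rule Bochner_Integration.integrable_bound)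
  show "integrable M (\<lambda>l. node k ^ 3 * weight_exp k l)"
    by (intro integrable_mult_right integrable_weight_exp)
  show "AE l in M. norm (- l * exp (- l * node k)) \<le> norm (node k ^ 3 * weight_exp k l)"
  proof (rule AE_I2)
    fix l
    have "\<bar>- l * exp (- l * node k)\<bar> / node k ^ 3 \<le> weight_exp k l"
      by (simp add: weight_def)
    then show "norm (- l * exp (- l * node k)) \<le> norm (node k ^ 3 * weight_exp k l)"
      using node_pos[of k] weight_nonneg by (simp add: abs_mult divide_le_eq mult.commute)
  qed
qed (intro measurable_M, measurable)

lemma integrable_val: "integrable M (\<lambda>l. exp (- l * node k) - exp (- l))"
  using integrable_exp_diff[of "node k" 1] node_pos[of k] by simp

text \<open>For fixed k, \<open>weight\<close> is a seminorm in (a, b), so it passes under the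
  integral sign with an inequality; the cancellation between value and slope is preserved.\<close>

lemma weight_val_slope_le: "weight k (val k) (slope k) \<le> (\<integral>l. weight_exp k l \<partial>M)"
proof -
  let ?a = "\<lambda>l. exp (- l * node k) - exp (- l)" and ?b = "\<lambda>l. - l * exp (- l * node k)"
  note ab = integrable_val[of k] integrable_slope[of k]
  have "\<bar>val k - node k * slope k\<bar> = \<bar>\<integral>l. ?a l - node k * ?b l \<partial>M\<bar>"
    unfolding val_def slope_def using ab
    by (subst Bochner_Integration.integral_diff) (auto intro!: integrable_mult_right)
  also have "\<dots> \<le> (\<integral>l. \<bar>?a l - node k * ?b l\<bar> \<partial>M)"
    by (rule integral_abs_bound)
  finally have 1: "\<bar>val k - node k * slope k\<bar> / (node k)\<^sup>2 \<le> (\<integral>l. \<bar>?a l - node k * ?b l\<bar> \<partial>M) / (node k)\<^sup>2"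
    by (intro divide_right_mono) auto
  have 2: "\<bar>slope k\<bar> / node k ^ 3 \<le> (\<integral>l. \<bar>?b l\<bar> \<partial>M) / node k ^ 3"
    unfolding slope_def using node_pos[of k] by (intro divide_right_mono integral_abs_bound) auto
  have "integrable M (\<lambda>l. \<bar>?a l - node k * ?b l\<bar>)" "integrable M (\<lambda>l. \<bar>?b l\<bar>)"
    by (intro integrable_abs Bochner_Integration.integrable_diff integrable_mult_right ab; fail)+
  then have "(\<integral>l. weight_exp k l \<partial>M) =
      (\<integral>l. \<bar>?a l - node k * ?b l\<bar> \<partial>M) / (node k)\<^sup>2 + (\<integral>l. \<bar>?b l\<bar> \<partial>M) / node k ^ 3"
    unfolding weight_def by (subst Bochner_Integration.integral_add) (auto intro!: integrable_divide_zero)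
  with 1 2 show ?thesis
    unfolding weight_def by linarith
qed

lemma summable_weight_val_slope: "summable (\<lambda>k. weight k (val k) (slope k))"
  by (rule summable_comparison_test'[OF summable_integral_weight_exp])
    (use weight_val_slope_le weight_nonneg in auto)

text \<open>The asymmetric range -N..N+1 of n makes the points n - 1/2 symmetric: n = k + 1 and n =
  -k give the nodes of opposite sign for k = 0, ..., N, hence \<open>Suc N\<close> pairs.\<close>

lemma G_meas_partial_eq: "G_meas_partial M N z = (\<Sum>k<Suc N. hermite k (val k) (slope k) z)"
  unfolding G_meas_partial_def
proof (rule remove_sings_eq_entire)
  show "(\<lambda>z. \<Sum>k<Suc N. hermite k (val k) (slope k) z) holomorphic_on UNIV"
    by (intro holomorphic_intros holomorphic_hermite)
  fix w assume w: "w \<notin> half_integers"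
  define H where "H = (cos (of_real pi * w) / of_real pi)\<^sup>2"
  have ne: "w \<noteq> of_real (node k)" "w \<noteq> - of_real (node k)" for k
    using w of_node_in_half_integers[of k] by auto
  have split: "sum g {- int N..int N + 1} = (\<Sum>k<Suc N. g (int k + 1) + g (- int k))" for g :: "int \<Rightarrow> complex"
  proof -
    have "{- int N..int N + 1} = (\<lambda>k. int k + 1) ` {..<Suc N} \<union> (\<lambda>k. - int k) ` {..<Suc N}"
    proof (intro equalityI subsetI)
      fix n assume n: "n \<in> {- int N..int N + 1}"
      show "n \<in> (\<lambda>k. int k + 1) ` {..<Suc N} \<union> (\<lambda>k. - int k) ` {..<Suc N}"
      proof (cases "n \<ge> 1")
        case True
        with n have "n = int (nat (n - 1)) + 1" "nat (n - 1) < Suc N" by auto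
        then show ?thesis by blast
      next
        case False
        with n have "n = - int (nat (- n))" "nat (- n) < Suc N" by auto
        then show ?thesis by blast
      qed
    qed auto
    then have "sum g {- int N..int N + 1} = sum g ((\<lambda>k. int k + 1) ` {..<Suc N}) + sum g ((\<lambda>k. - int k) ` {..<Suc N})"
      by (simp only:) (rule sum.union_disjoint, auto)
    also have "\<dots> = (\<Sum>k<Suc N. g (int k + 1)) + (\<Sum>k<Suc N. g (- int k))"
      by (subst (1 2) sum.reindex) (auto simp: inj_on_def)
    finally show ?thesis by (simp add: sum.distrib)
  qed
  have node_p: "real_of_int (int k + 1) - 1/2 = node k" "real_of_int (- int k) - 1/2 = - node k"
    "w - of_int (int k + 1) + 1/2 = w - of_real (node k)"
    "w - of_int (- int k) + 1/2 = w + of_real (node k)" for k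
    by (simp_all add: node_def)
  have f: "real_of_ereal (f_meas M (node k)) = val k" "real_of_ereal (f_meas M (- node k)) = val k"
    "f_meas' M (node k) = slope k" "f_meas' M (- node k) = - slope k" for k
    using node_pos[of k] by (simp_all add: f_meas_eq f_meas'_eq val_def slope_def)
  show "(cos (of_real pi * w) / of_real pi)\<^sup>2 *
     ((\<Sum>n\<in>{- int N..int N + 1}.
         of_real (real_of_ereal (f_meas M (of_int n - 1/2))) / (w - of_int n + 1/2)\<^sup>2)
      + (\<Sum>n\<in>{- int N..int N + 1}.
         of_real (f_meas' M (of_int n - 1/2)) / (w - of_int n + 1/2)))
    = (\<Sum>k<Suc N. hermite k (val k) (slope k) w)"
    unfolding split node_p f hermite_eq_fractions[OF ne] H_def[symmetric] sum.distrib[symmetric] sum_distrib_left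
    by (intro sum.cong refl) (simp add: algebra_simps)
qed

lemma G_meas_eq: "G_meas M z = (\<Sum>k. hermite k (val k) (slope k) z)"
  unfolding G_meas_def G_meas_partial_eq
  by (intro limI LIMSEQ_Suc summable_LIMSEQ summable_hermite summable_weight_val_slope)

lemma real_entire_G_meas: "real_entire (G_meas M)"
  unfolding real_entire_def G_meas_eq[abs_def]
  using holomorphic_suminf_hermite[OF summable_weight_val_slope]
    suminf_hermite_in_Reals[OF summable_weight_val_slope] by auto

lemma exp_type_G_meas: "exp_type_at_most (G_meas M) (2 * pi)"
  unfolding G_meas_eq[abs_def] by (rule exp_type_suminf_hermite[OF summable_weight_val_slope])

lemma sums_rL_minus_exp:
  assumes "l > 0"
  shows "(\<lambda>k. rhermite k (exp (- l * node k) - exp (- l)) (- l * exp (- l * node k)) x)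
    sums (rL l x - exp (- l))"
  using sums_Re[OF sums_L_series_minus_exp[OF assms, of "of_real x"]]
  by (simp add: hermite_eq_rhermite L_series_eq_rL[OF assms])

lemma abs_rL_minus_exp_le:
  assumes "l > 0"
  shows "\<bar>rL l x - exp (- l)\<bar> \<le> growth (of_real x) * weight_const * (l / (l\<^sup>2 + 1))"
proof -
  have "complex_of_real (rL l x - exp (- l)) = L_series l (of_real x) - of_real (exp (- l))"
    by (simp add: L_series_eq_rL[OF assms])
  then show ?thesis
    using norm_L_series_minus_exp_le[OF assms, of "of_real x"] by (metis mult.assoc norm_of_real)
qed

text \<open>Sum and integral may be exchanged because the integrals of the absolute values are at
  most \<open>growth\<close> times the summable integrals of the weights.\<close>

lemma G_meas_of_real: "G_meas M (of_real x) = of_real (\<integral>l. rL l x - exp (- l) \<partial>M)"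
proof -
  let ?f = "\<lambda>k l. rhermite k (exp (- l * node k) - exp (- l)) (- l * exp (- l * node k)) x"
  have bound: "\<bar>?f k l\<bar> \<le> growth (of_real x) * weight_exp k l" for k l
    using norm_hermite_le[of k "exp (- l * node k) - exp (- l)" "- l * exp (- l * node k)" "of_real x"]
    by (simp add: hermite_eq_rhermite)
  have int: "integrable M (?f k)" for k
  proof (rule Bochner_Integration.integrable_bound)
    show "integrable M (\<lambda>l. growth (of_real x) * weight_exp k l)"
      by (intro integrable_mult_right integrable_weight_exp)
    show "AE l in M. norm (?f k l) \<le> norm (growth (of_real x) * weight_exp k l)"
      using bound by (intro AE_I2) (metis abs_ge_self order.trans real_norm_def)
  qed (intro measurable_M, measurable)
  have AE: "AE l in M. summable (\<lambda>k. norm (?f k l))"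
  proof (rule AE_I2)
    fix l assume "l \<in> space M"
    then have "l > 0" by (simp add: space_M)
    from summable_norm_hermite[OF summable_weight_exp_diff[OF this], of "of_real x"]
    show "summable (\<lambda>k. norm (?f k l))"
      by (simp add: hermite_eq_rhermite)
  qed
  have summ: "summable (\<lambda>k. \<integral>l. norm (?f k l) \<partial>M)"
  proof (rule summable_comparison_test')
    show "summable (\<lambda>k. growth (of_real x) * (\<integral>l. weight_exp k l \<partial>M))"
      by (intro summable_mult summable_integral_weight_exp)
    fix k
    have "(\<integral>l. norm (?f k l) \<partial>M) \<le> (\<integral>l. growth (of_real x) * weight_exp k l \<partial>M)"
      using int integrable_weight_exp bound by (intro integral_mono integrable_norm integrable_mult_right) auto
    then show "norm (\<integral>l. norm (?f k l) \<partial>M) \<le> growth (of_real x) * (\<integral>l. weight_exp k l \<partial>M)"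
      by (simp add: integral_nonneg_AE)
  qed
  have "(\<lambda>k. integral\<^sup>L M (?f k)) sums (\<integral>l. (\<Sum>k. ?f k l) \<partial>M)"
    by (rule sums_integral[OF int AE summ])
  moreover have "(\<integral>l. (\<Sum>k. ?f k l) \<partial>M) = (\<integral>l. rL l x - exp (- l) \<partial>M)"
    using sums_rL_minus_exp by (intro Bochner_Integration.integral_cong refl) (simp add: space_M sums_iff)
  moreover have "integral\<^sup>L M (?f k) = rhermite k (val k) (slope k) x" for k
  proof -
    have "integral\<^sup>L M (?f k) = val k * ((rnodal (node k) x)\<^sup>2 + (rnodal (- node k) x)\<^sup>2)
        + 2 * node k * slope k * (rnodal (node k) x * rnodal (- node k) x)"
      unfolding rhermite_def val_def slope_def
      by (subst Bochner_Integration.integral_add)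
        (use integrable_val[of k] integrable_slope[of k] in \<open>auto intro!: integrable_mult_right integrable_mult_left\<close>)
    then show ?thesis by (simp add: rhermite_def)
  qed
  ultimately have "(\<lambda>k. rhermite k (val k) (slope k) x) sums (\<integral>l. rL l x - exp (- l) \<partial>M)"
    by simp
  from sums_of_real[OF this] show ?thesis
    unfolding G_meas_eq hermite_eq_rhermite by (rule sums_unique[symmetric])
qed

end

lemma admissible_imp_decay_measure:
  assumes "admissible_measure \<mu>"
  shows "decay_measure \<mu>"
proof
  show sets: "sets \<mu> = sets borel_pos"
    using assms by (simp add: admissible_measure_def)
  have space: "space \<mu> = {0<..}"
    using sets_eq_imp_space_eq[OF sets] by (simp add: space_restrict_space)
  show "integrable \<mu> (\<lambda>l. l / (l\<^sup>2 + 1))"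
  proof (rule integrableI_nonneg)
    show "(\<lambda>l. l / (l\<^sup>2 + 1)) \<in> borel_measurable \<mu>"
      unfolding measurable_cong_sets[OF sets refl] by (intro measurable_restrict_space1) measurable
    show "AE l in \<mu>. 0 \<le> l / (l\<^sup>2 + 1)"
      by (rule AE_I2) (simp add: space)
    show "(\<integral>\<^sup>+ l. ennreal (l / (l\<^sup>2 + 1)) \<partial>\<mu>) < \<infinity>"
      using assms by (simp add: admissible_measure_def)
  qed
qed

section \<open>The difference function\<close>

lemma ereal_integral_cong:
  "(\<And>x. x \<in> space M \<Longrightarrow> u x = v x) \<Longrightarrow> ereal_integral M u = ereal_integral M v"
  unfolding ereal_integral_def by (simp cong: nn_integral_cong)

text \<open>The difference is at most v, useful near 0, and at most 1/v, useful for large v; 2 v /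
  (v^2 + 1) lies above the smaller of the two.\<close>

lemma inverse_minus_csch_bounds:
  fixes v :: real
  assumes v: "v > 0"
  shows "0 \<le> 1 / v - 1 / sinh v" "1 / v - 1 / sinh v \<le> 2 * (v / (v\<^sup>2 + 1))"
proof -
  have sinh: "sinh v > 0" using v by simp
  have 1: "sinh v \<le> v * cosh v"
    by (rule sinh_le_mult_cosh) (use v in simp)
  have "0 * sinh 0 - cosh 0 + 1 \<le> v * sinh v - cosh v + 1"
  proof (rule DERIV_nonneg_imp_nondecreasing[where f = "\<lambda>t. t * sinh t - cosh t + 1"])
    show "\<exists>y. ((\<lambda>t. t * sinh t - cosh t + 1) has_real_derivative y) (at s) \<and> 0 \<le> y" if "0 \<le> s" for s
      using that by (intro exI[of _ "s * cosh s"]) (auto intro!: derivative_eq_intros)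
  qed (use v in simp)
  then have 2: "cosh v - 1 \<le> v * sinh v" by simp
  have "sinh 0 - 0 \<le> sinh v - v"
  proof (rule DERIV_nonneg_imp_nondecreasing[where f = "\<lambda>t. sinh t - t"])
    show "\<exists>y. ((\<lambda>t. sinh t - t) has_real_derivative y) (at s) \<and> 0 \<le> y" for s
      by (intro exI[of _ "cosh s - 1"]) (auto intro!: derivative_eq_intros simp: cosh_real_ge_1)
  qed (use v in simp)
  then have "v \<le> sinh v" by simp
  then show "0 \<le> 1 / v - 1 / sinh v"
    using v sinh by (simp add: divide_left_mono)
  have "sinh v - v \<le> v * (v * sinh v)"
    using 1 mult_left_mono[OF 2, of v] v by (simp add: algebra_simps)
  then have le_v: "1 / v - 1 / sinh v \<le> v"
    using v sinh by (simp add: field_simps power2_eq_square)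
  have le_inv: "1 / v - 1 / sinh v \<le> 1 / v"
    using sinh by simp
  show "1 / v - 1 / sinh v \<le> 2 * (v / (v\<^sup>2 + 1))"
  proof (cases "v \<le> 1")
    case True
    then have "v * (v\<^sup>2 + 1) \<le> v * 2"
      using v power_mono[of v 1 2] by (intro mult_left_mono) auto
    then have "v \<le> 2 * (v / (v\<^sup>2 + 1))"
      by (simp add: divide_simps add_nonneg_pos mult.commute)
    with le_v show ?thesis by linarith
  next
    case False
    then have "v\<^sup>2 + 1 \<le> 2 * v * v"
      using power_mono[of 1 v 2] by (simp add: power2_eq_square)
    then have "1 / v \<le> 2 * (v / (v\<^sup>2 + 1))"
      using v by (simp add: divide_simps add_nonneg_pos power2_eq_square)
    with le_inv show ?thesis by linarith
  qed
qed

locale scaled_decay_measure = decay_measure +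
  fixes \<delta> :: real
  assumes delta: "\<delta> > 0"
begin

definition gap :: "real \<Rightarrow> real \<Rightarrow> real" where
  "gap l x = exp (- l * \<bar>x\<bar>) - rL (l / \<delta>) (\<delta> * x)"

lemma gap_nonneg:
  assumes "l > 0"
  shows "0 \<le> gap l x"
  using rL_le_exp[of "l / \<delta>" "\<delta> * x"] assms delta by (simp add: gap_def abs_mult)

lemma gap_eq_L_fun:
  assumes "l > 0"
  shows "exp (- l * \<bar>x\<bar>) - Re (L_fun (l / \<delta>) (of_real (\<delta> * x))) = gap l x"
  using assms delta by (subst L_fun_eq_rL) (simp_all add: gap_def)

lemma gap_measurable [measurable]:
  assumes [measurable]: "f \<in> borel_measurable N" "g \<in> borel_measurable N"
  shows "(\<lambda>p. gap (f p) (g p)) \<in> borel_measurable N"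
  unfolding gap_def by measurable

lemma integrable_rL_scaled: "integrable M (\<lambda>l. rL (l / \<delta>) x - exp (- (l / \<delta>)))"
proof (rule integrable_of_decay)
  fix l :: real assume l: "l > 0"
  have "\<bar>rL (l / \<delta>) x - exp (- (l / \<delta>))\<bar>
      \<le> growth (of_real x) * weight_const * ((l / \<delta>) / ((l / \<delta>)\<^sup>2 + 1))"
    using l delta by (intro abs_rL_minus_exp_le) simp
  also have "\<dots> \<le> growth (of_real x) * weight_const * ((\<delta> + 1 / \<delta>) * (l / (l\<^sup>2 + 1)))"
    using l delta by (intro mult_left_mono decay_scale_le mult_nonneg_nonneg growth_nonneg weight_const_nonneg)
  finally show "norm (rL (l / \<delta>) x - exp (- (l / \<delta>)))
      \<le> growth (of_real x) * weight_const * (\<delta> + 1 / \<delta>) * (l / (l\<^sup>2 + 1))"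
    by (simp add: mult.assoc)
qed measurable

lemma integrable_exp_diff_delta: "integrable M (\<lambda>l. exp (- l * (1 / \<delta>)) - exp (- l))"
  using integrable_exp_diff[of "1 / \<delta>" 1] delta by simp

text \<open>The two terms of the gap need not be integrable separately; subtracting exp(-l / delta)
  from each of them makes both integrable.\<close>

lemma integrable_gap:
  assumes "x \<noteq> 0"
  shows "integrable M (\<lambda>l. gap l x)"
proof -
  have "integrable M (\<lambda>l. (exp (- l * \<bar>x\<bar>) - exp (- l * (1 / \<delta>))) - (rL (l / \<delta>) (\<delta> * x) - exp (- (l / \<delta>))))"
    using assms delta
    by (intro Bochner_Integration.integrable_diff[OF integrable_exp_diff integrable_rL_scaled]) auto
  then show ?thesis by (simp add: gap_def)
qed

lemma has_bochner_integral_rL_scaled: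
  assumes l: "l > 0"
  shows "has_bochner_integral lborel (\<lambda>x. rL (l / \<delta>) (\<delta> * x)) (1 / \<delta> * (1 / sinh (l / (2 * \<delta>))))"
proof -
  have nz: "\<delta> \<noteq> 0" and pos: "l / \<delta> > 0" using l delta by simp_all
  have "has_bochner_integral lborel (\<lambda>x. rL (l / \<delta>) (0 + \<delta> * x)) (1 / sinh (l / \<delta> / 2) /\<^sub>R \<bar>\<delta>\<bar>)"
    by (rule iffD1[OF lborel_has_bochner_integral_real_affine_iff[OF nz] has_bochner_integral_rL[OF pos]])
  moreover have "1 / sinh (l / \<delta> / 2) /\<^sub>R \<bar>\<delta>\<bar> = 1 / \<delta> * (1 / sinh (l / (2 * \<delta>)))"
  proof -
    have "l / \<delta> / 2 = l / (2 * \<delta>)" by simp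
    then show ?thesis
      using delta by (simp only: abs_of_pos real_scaleR_def inverse_eq_divide)
  qed
  ultimately show ?thesis by (simp only: add_0)
qed

lemma has_bochner_integral_gap:
  assumes l: "l > 0"
  shows "has_bochner_integral lborel (gap l) (2 / l - 1 / \<delta> * (1 / sinh (l / (2 * \<delta>))))"
  unfolding gap_def[abs_def]
  by (intro has_bochner_integral_diff has_bochner_integral_exp_abs has_bochner_integral_rL_scaled l)

lemma integrable_csch: "integrable M (\<lambda>l. 2 / l - 1 / \<delta> * (1 / sinh (l / (2 * \<delta>))))"
proof (rule integrable_of_decay)
  fix l :: real assume l: "l > 0"
  have v: "l / (2 * \<delta>) > 0" using l delta by simp
  have "2 / l - 1 / \<delta> * (1 / sinh (l / (2 * \<delta>))) = 1 / \<delta> * (1 / (l / (2 * \<delta>)) - 1 / sinh (l / (2 * \<delta>)))"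
    using delta by (simp add: right_diff_distrib)
  moreover have "\<bar>1 / (l / (2 * \<delta>)) - 1 / sinh (l / (2 * \<delta>))\<bar> \<le> 2 * ((2 * \<delta> + 1 / (2 * \<delta>)) * (l / (l\<^sup>2 + 1)))"
  proof -
    have "2 * \<delta> > 0" using delta by simp
    from inverse_minus_csch_bounds[OF v] decay_scale_le[OF this l] show ?thesis
      by linarith
  qed
  ultimately have "norm (2 / l - 1 / \<delta> * (1 / sinh (l / (2 * \<delta>))))
      \<le> 1 / \<delta> * (2 * ((2 * \<delta> + 1 / (2 * \<delta>)) * (l / (l\<^sup>2 + 1))))"
    using delta by (simp only: real_norm_def abs_mult) (intro mult_mono, auto)
  then show "norm (2 / l - 1 / \<delta> * (1 / sinh (l / (2 * \<delta>))))
      \<le> 1 / \<delta> * 2 * (2 * \<delta> + 1 / (2 * \<delta>)) * (l / (l\<^sup>2 + 1))"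
    by (simp only: mult.assoc)
qed (unfold sinh_field_def, measurable)

section \<open>Tonelli and Fubini for the gap\<close>

lemma fst_measurable_M [measurable]: "fst \<in> borel_measurable (M \<Otimes>\<^sub>M N)"
  by (rule measurable_compose[OF measurable_fst measurable_M]) simp

lemma snd_measurable_M [measurable]: "snd \<in> borel_measurable (N \<Otimes>\<^sub>M M)"
  by (rule measurable_compose[OF measurable_snd measurable_M]) simp

lemma pair_sigma_finite: "pair_sigma_finite M lborel"
  by (intro pair_sigma_finite.intro sigma_finite lborel.sigma_finite_measure_axioms)

lemma nn_integral_gap_eq:
  "(\<integral>\<^sup>+x. (\<integral>\<^sup>+l. ennreal (gap l x) \<partial>M) \<partial>lborel)
    = ennreal (\<integral>l. 2 / l - 1 / \<delta> * (1 / sinh (l / (2 * \<delta>))) \<partial>M)"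
proof -
  interpret pair_sigma_finite M lborel by (rule pair_sigma_finite)
  have inner: "(\<integral>\<^sup>+x. ennreal (gap l x) \<partial>lborel) = ennreal (2 / l - 1 / \<delta> * (1 / sinh (l / (2 * \<delta>))))"
    and nonneg: "0 \<le> 2 / l - 1 / \<delta> * (1 / sinh (l / (2 * \<delta>)))" if "l \<in> space M" for l
  proof -
    have l: "l > 0" using that by (simp add: space_M)
    note * = has_bochner_integral_gap[OF l]
    show "(\<integral>\<^sup>+x. ennreal (gap l x) \<partial>lborel) = ennreal (2 / l - 1 / \<delta> * (1 / sinh (l / (2 * \<delta>))))"
      using nn_integral_eq_integral[OF integrable.intros[OF *]] gap_nonneg[OF l]
        has_bochner_integral_integral_eq[OF *] by simp
    show "0 \<le> 2 / l - 1 / \<delta> * (1 / sinh (l / (2 * \<delta>)))"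
      using integral_nonneg_AE[where M = lborel and f = "gap l"] gap_nonneg[OF l]
        has_bochner_integral_integral_eq[OF *] by simp
  qed
  have "(\<integral>\<^sup>+x. (\<integral>\<^sup>+l. ennreal (gap l x) \<partial>M) \<partial>lborel) = (\<integral>\<^sup>+l. (\<integral>\<^sup>+x. ennreal (gap l x) \<partial>lborel) \<partial>M)"
    by (rule Fubini') measurable
  also have "\<dots> = (\<integral>\<^sup>+l. ennreal (2 / l - 1 / \<delta> * (1 / sinh (l / (2 * \<delta>)))) \<partial>M)"
    by (intro nn_integral_cong inner)
  also have "\<dots> = ennreal (\<integral>l. 2 / l - 1 / \<delta> * (1 / sinh (l / (2 * \<delta>))) \<partial>M)"
    by (intro nn_integral_eq_integral integrable_csch AE_I2 nonneg)
  finally show ?thesis .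
qed

lemma L_hat_eq:
  assumes l: "l > 0"
  shows "has_bochner_integral lborel (\<lambda>x. of_real (rL (l / \<delta>) (\<delta> * x)) * e2pi (of_real (- t * x)))
    (of_real (1 / \<delta>) * L_hat (l / \<delta>) (t / \<delta>))"
proof -
  let ?f = "\<lambda>x. complex_of_real (rL (l / \<delta>) x) * e2pi (of_real (- (t / \<delta>) * x))"
  have "integrable lborel ?f"
  proof (rule Bochner_Integration.integrable_bound[OF integrable.intros[OF has_bochner_integral_rL]])
    show "l / \<delta> > 0" using l delta by simp
    have "continuous_on UNIV (\<lambda>x::real. e2pi (of_real (- (t / \<delta>) * x)))"
      unfolding e2pi_def by (intro continuous_intros)
    then have [measurable]: "(\<lambda>x::real. e2pi (of_real (- (t / \<delta>) * x))) \<in> borel_measurable borel"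
      by (rule borel_measurable_continuous_onI)
    show "?f \<in> borel_measurable lborel" by measurable
  qed (auto simp: norm_mult e2pi_def)
  moreover have "integral\<^sup>L lborel ?f = L_hat (l / \<delta>) (t / \<delta>)"
    unfolding L_hat_def using l delta by (simp add: L_fun_eq_rL)
  ultimately have "has_bochner_integral lborel ?f (L_hat (l / \<delta>) (t / \<delta>))"
    by (simp add: has_bochner_integral_iff)
  then have "has_bochner_integral lborel (\<lambda>x. ?f (0 + \<delta> * x)) (L_hat (l / \<delta>) (t / \<delta>) /\<^sub>R \<bar>\<delta>\<bar>)"
    using delta by (subst (asm) lborel_has_bochner_integral_real_affine_iff[of \<delta> _ _ 0]) auto
  moreover have "?f (0 + \<delta> * x) = of_real (rL (l / \<delta>) (\<delta> * x)) * e2pi (of_real (- t * x))" for x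
    using delta by simp
  ultimately show ?thesis
    using delta by (simp add: scaleR_conv_of_real inverse_eq_divide)
qed

lemma fourier_gap:
  assumes t: "t \<noteq> 0"
  shows "integrable M (\<lambda>l. 2 * l / (l\<^sup>2 + 4 * pi\<^sup>2 * t\<^sup>2))"
    and "integrable M (\<lambda>l. L_hat (l / \<delta>) (t / \<delta>))"
    and "(\<integral>x. of_real (enn2real (\<integral>\<^sup>+l. ennreal (gap l x) \<partial>M)) * e2pi (of_real (- t * x)) \<partial>lborel) =
         of_real (\<integral>l. 2 * l / (l\<^sup>2 + 4 * pi\<^sup>2 * t\<^sup>2) \<partial>M)
         - of_real (1 / \<delta>) * (\<integral>l. L_hat (l / \<delta>) (t / \<delta>) \<partial>M)"
proof -
  interpret pair_sigma_finite M lborel by (rule pair_sigma_finite)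
  define c where "c = 2 * pi * \<bar>t\<bar>"
  have c: "c > 0" using t by (simp add: c_def)
  show 1: "integrable M (\<lambda>l. 2 * l / (l\<^sup>2 + 4 * pi\<^sup>2 * t\<^sup>2))"
  proof (rule integrable_of_decay)
    fix l :: real assume l: "l > 0"
    have "2 * l / (l\<^sup>2 + 4 * pi\<^sup>2 * t\<^sup>2) = 2 / c * ((l / c) / ((l / c)\<^sup>2 + 1))"
    proof -
      have "4 * pi\<^sup>2 * t\<^sup>2 = c\<^sup>2" by (simp add: c_def power_mult_distrib)
      moreover have "l\<^sup>2 + c\<^sup>2 > 0" using l by (simp add: add_pos_nonneg)
      ultimately show ?thesis
        using c by (simp add: field_simps power2_eq_square)
    qed
    also have "\<dots> \<le> 2 / c * ((c + 1 / c) * (l / (l\<^sup>2 + 1)))"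
      using c l by (intro mult_left_mono decay_scale_le) auto
    finally have le: "2 * l / (l\<^sup>2 + 4 * pi\<^sup>2 * t\<^sup>2) \<le> 2 / c * (c + 1 / c) * (l / (l\<^sup>2 + 1))"
      by (simp only: mult.assoc)
    have nonneg: "0 \<le> 2 * l / (l\<^sup>2 + 4 * pi\<^sup>2 * t\<^sup>2)"
      using l by simp
    show "norm (2 * l / (l\<^sup>2 + 4 * pi\<^sup>2 * t\<^sup>2)) \<le> 2 / c * (c + 1 / c) * (l / (l\<^sup>2 + 1))"
      unfolding real_norm_def abs_of_nonneg[OF nonneg] by (rule le)
  qed measurable
  define F where "F = (\<lambda>l x. complex_of_real (gap l x) * e2pi (of_real (- t * x)))"
  have "continuous_on UNIV (\<lambda>x::real. e2pi (of_real (- t * x)))"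
    unfolding e2pi_def by (intro continuous_intros)
  then have [measurable]: "(\<lambda>x::real. e2pi (of_real (- t * x))) \<in> borel_measurable borel"
    by (rule borel_measurable_continuous_onI)
  have norm_F: "norm (F l x) = \<bar>gap l x\<bar>" for l x
    by (simp add: F_def norm_mult e2pi_def)
  have int_F: "integrable (M \<Otimes>\<^sub>M lborel) (case_prod F)"
  proof (rule integrableI_bounded)
    show F_meas: "case_prod F \<in> borel_measurable (M \<Otimes>\<^sub>M lborel)"
      unfolding F_def by measurable
    have "(\<integral>\<^sup>+p. ennreal (norm (case_prod F p)) \<partial>(M \<Otimes>\<^sub>M lborel))
        = (\<integral>\<^sup>+x. (\<integral>\<^sup>+l. ennreal (norm (F l x)) \<partial>M) \<partial>lborel)"
      using F_meas by (subst nn_integral_snd[symmetric]) auto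
    also have "\<dots> = (\<integral>\<^sup>+x. (\<integral>\<^sup>+l. ennreal (gap l x) \<partial>M) \<partial>lborel)"
      unfolding norm_F by (intro nn_integral_cong) (auto simp: space_M gap_nonneg)
    also have "\<dots> < \<infinity>"
      unfolding nn_integral_gap_eq by simp
    finally show "(\<integral>\<^sup>+p. ennreal (norm (case_prod F p)) \<partial>(M \<Otimes>\<^sub>M lborel)) < \<infinity>" .
  qed
  have F_x: "(\<integral>x. F l x \<partial>lborel) =
      of_real (2 * l / (l\<^sup>2 + 4 * pi\<^sup>2 * t\<^sup>2)) - of_real (1 / \<delta>) * L_hat (l / \<delta>) (t / \<delta>)"
    if "l \<in> space M" for l
  proof -
    have l: "l > 0" using that by (simp add: space_M)
    have "F l = (\<lambda>x. of_real (exp (- l * \<bar>x\<bar>)) * e2pi (of_real (- t * x))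
        - of_real (rL (l / \<delta>) (\<delta> * x)) * e2pi (of_real (- t * x)))"
      by (simp add: F_def gap_def fun_eq_iff algebra_simps)
    then show ?thesis
      using has_bochner_integral_diff[OF has_bochner_integral_exp_abs_fourier[OF l, of t] L_hat_eq[OF l, of t]]
      by (simp only: has_bochner_integral_integral_eq)
  qed
  \<comment> \<open>Fubini gives integrability of the inner Fourier integral as a whole; that of
    \<open>L_hat\<close> follows by removing the explicit first term.\<close>
  have int_Fx: "integrable M (\<lambda>l. of_real (2 * l / (l\<^sup>2 + 4 * pi\<^sup>2 * t\<^sup>2)) - of_real (1 / \<delta>) * L_hat (l / \<delta>) (t / \<delta>))"
    using integrable_fst[OF int_F] F_x by (simp cong: Bochner_Integration.integrable_cong)
  have cplx: "integrable M (\<lambda>l. complex_of_real (2 * l / (l\<^sup>2 + 4 * pi\<^sup>2 * t\<^sup>2)))"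
    by (rule integrable_of_real[OF 1])
  have L: "integrable M (\<lambda>l. of_real (1 / \<delta>) * L_hat (l / \<delta>) (t / \<delta>))"
    using Bochner_Integration.integrable_diff[OF cplx int_Fx] by simp
  from integrable_mult_right[OF this, of "of_real \<delta>"]
  show 2: "integrable M (\<lambda>l. L_hat (l / \<delta>) (t / \<delta>))"
    using delta by simp
  have "(\<integral>x. of_real (enn2real (\<integral>\<^sup>+l. ennreal (gap l x) \<partial>M)) * e2pi (of_real (- t * x)) \<partial>lborel)
      = (\<integral>x. (\<integral>l. F l x \<partial>M) \<partial>lborel)"
  proof (rule integral_cong_AE)
    show "AE x in lborel. of_real (enn2real (\<integral>\<^sup>+l. ennreal (gap l x) \<partial>M)) * e2pi (of_real (- t * x))
        = (\<integral>l. F l x \<partial>M)"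
      \<comment> \<open>At x = 0 the integral of the gap may be infinite, and
        \<open>enn2real\<close> would turn it into 0.\<close>
      using AE_lborel_singleton[of 0]
    proof eventually_elim
      case (elim x)
      have "(\<integral>\<^sup>+l. ennreal (gap l x) \<partial>M) = ennreal (\<integral>l. gap l x \<partial>M)"
        using elim by (intro nn_integral_eq_integral integrable_gap AE_I2 gap_nonneg) (auto simp: space_M)
      moreover have "0 \<le> (\<integral>l. gap l x \<partial>M)"
        by (intro integral_nonneg_AE AE_I2 gap_nonneg) (simp add: space_M)
      ultimately show ?case
        by (simp add: F_def)
    qed
    show "(\<lambda>x. of_real (enn2real (\<integral>\<^sup>+l. ennreal (gap l x) \<partial>M)) * e2pi (of_real (- t * x))) \<in> borel_measurable lborel"
      by measurable
    show "(\<lambda>x. \<integral>l. F l x \<partial>M) \<in> borel_measurable lborel"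
      using borel_measurable_integrable[OF integrable_snd[OF int_F]] .
  qed
  also have "\<dots> = (\<integral>l. (\<integral>x. F l x \<partial>lborel) \<partial>M)"
    by (rule Fubini_integral[OF int_F])
  also have "\<dots> = (\<integral>l. of_real (2 * l / (l\<^sup>2 + 4 * pi\<^sup>2 * t\<^sup>2)) - of_real (1 / \<delta>) * L_hat (l / \<delta>) (t / \<delta>) \<partial>M)"
    by (intro Bochner_Integration.integral_cong refl F_x)
  also have "\<dots> = of_real (\<integral>l. 2 * l / (l\<^sup>2 + 4 * pi\<^sup>2 * t\<^sup>2) \<partial>M)
         - of_real (1 / \<delta>) * (\<integral>l. L_hat (l / \<delta>) (t / \<delta>) \<partial>M)"
    unfolding Bochner_Integration.integral_diff[OF cplx L] integral_complex_of_real integral_mult_right_zero ..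
  finally show "(\<integral>x. of_real (enn2real (\<integral>\<^sup>+l. ennreal (gap l x) \<partial>M)) * e2pi (of_real (- t * x)) \<partial>lborel) =
         of_real (\<integral>l. 2 * l / (l\<^sup>2 + 4 * pi\<^sup>2 * t\<^sup>2) \<partial>M)
         - of_real (1 / \<delta>) * (\<integral>l. L_hat (l / \<delta>) (t / \<delta>) \<partial>M)" .
qed

section \<open>The rescaled measure and the integral formula for the difference\<close>

context
  fixes \<nu> :: "real measure"
  assumes nu: "\<nu> = distr M borel_pos (\<lambda>l. l / \<delta>)"
begin

lemma scale_measurable: "(\<lambda>l. l / \<delta>) \<in> M \<rightarrow>\<^sub>M borel_pos"
proof (rule measurable_restrict_space2)
  show "(\<lambda>l. l / \<delta>) \<in> space M \<rightarrow> {0<..}"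
    using delta by (auto simp: space_M)
qed (intro measurable_M, measurable)

lemma decay_measure_nu: "decay_measure \<nu>"
proof
  show "sets \<nu> = sets borel_pos" by (simp add: nu)
  have "integrable M (\<lambda>l. (l / \<delta>) / ((l / \<delta>)\<^sup>2 + 1))"
    by (rule integrable_of_decay) (use decay_scale_le[OF delta] delta in auto)
  then show "integrable \<nu> (\<lambda>l. l / (l\<^sup>2 + 1))"
    unfolding nu by (subst integrable_distr_eq[OF scale_measurable]) (auto intro!: measurable_restrict_space1)
qed

lemma G_meas_nu: "G_meas \<nu> (of_real x) = of_real (\<integral>l. rL (l / \<delta>) x - exp (- (l / \<delta>)) \<partial>M)"
proof -
  have "(\<lambda>l. rL l x - exp (- l)) \<in> borel_measurable borel_pos"
    by (rule measurable_restrict_space1) measurable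
  then have "(\<integral>l. rL l x - exp (- l) \<partial>\<nu>) = (\<integral>l. rL (l / \<delta>) x - exp (- (l / \<delta>)) \<partial>M)"
    unfolding nu by (rule integral_distr[OF scale_measurable])
  then show ?thesis
    by (simp add: decay_measure.G_meas_of_real[OF decay_measure_nu])
qed

text \<open>The integrand of f at 1/delta is exp(-l/delta) - exp(-l) and that of G is L -
  exp(-l/delta), so the constants cancel against those of f at x. The case split concerns x = 0,
  where f may be infinite; both sides are then infinite.\<close>

lemma minorant_gap_eq: "minorant_gap M \<nu> \<delta> x = enn2ereal (\<integral>\<^sup>+l. ennreal (gap l x) \<partial>M)"
proof -
  define u where "u = (\<lambda>l. exp (- l * \<bar>x\<bar>) - exp (- l))"
  define D R where "D = (\<integral>l. exp (- l * (1 / \<delta>)) - exp (- l) \<partial>M)"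
    and "R = (\<integral>l. rL (l / \<delta>) (\<delta> * x) - exp (- (l / \<delta>)) \<partial>M)"
  define r where "r = (\<lambda>l. (exp (- l * (1 / \<delta>)) - exp (- l)) + (rL (l / \<delta>) (\<delta> * x) - exp (- (l / \<delta>))))"
  have r: "integrable M r" "integral\<^sup>L M r = D + R"
    unfolding r_def D_def R_def
    by (intro Bochner_Integration.integrable_add Bochner_Integration.integral_add
        integrable_exp_diff_delta integrable_rL_scaled)+
  have gap: "gap l x = u l - r l" for l
    by (simp add: gap_def u_def r_def)
  have mgap: "minorant_gap M \<nu> \<delta> x = ereal_integral M (\<lambda>l. ereal (u l)) - ereal D - ereal R"
    using delta f_meas_eq[of "1 / \<delta>"] G_meas_nu[of "\<delta> * x"]
    by (simp add: minorant_gap_def f_meas_def[of M x] u_def D_def R_def)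
  have gap_int: "ereal_integral M (\<lambda>l. ereal (gap l x)) = enn2ereal (\<integral>\<^sup>+l. ennreal (gap l x) \<partial>M)"
    by (rule ereal_integral_nonneg) (simp add: space_M gap_nonneg)
  show ?thesis
  proof (cases "integrable M u")
    case True
    then have "integrable M (\<lambda>l. gap l x)" "(\<integral>l. gap l x \<partial>M) = integral\<^sup>L M u - (D + R)"
      unfolding gap using r by simp_all
    then show ?thesis
      unfolding mgap gap_int[symmetric] using True by (simp add: ereal_integral_eq_integral)
  next
    case False
    have u_meas: "u \<in> borel_measurable M"
      unfolding u_def by (intro measurable_M) measurable
    have "x = 0"
      using False integrable_exp_diff[of "\<bar>x\<bar>" 1] by (cases "x = 0") (auto simp: u_def)
    then have u_nonneg: "0 \<le> u l" if "l \<in> space M" for l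
      using that by (simp add: u_def space_M)
    have "(\<integral>\<^sup>+l. ennreal (u l) \<partial>M) = \<infinity>"
      using False integrableI_nonneg[OF u_meas AE_I2[OF u_nonneg]]
      unfolding infinity_ennreal_def less_top[symmetric] by blast
    then have "ereal_integral M (\<lambda>l. ereal (u l)) = \<infinity>"
      by (simp add: ereal_integral_nonneg u_nonneg)
    then have "minorant_gap M \<nu> \<delta> x = \<infinity>"
      by (simp add: mgap)
    moreover have "(\<integral>\<^sup>+l. ennreal (gap l x) \<partial>M) = \<infinity>"
    proof (rule ccontr)
      \<comment> \<open>Here u is the gap plus the integrable function r, so a finite integral of
        the gap would make u integrable.\<close>
      assume "(\<integral>\<^sup>+l. ennreal (gap l x) \<partial>M) \<noteq> \<infinity>"
      moreover have "(\<lambda>l. gap l x) \<in> borel_measurable M"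
        by (intro measurable_M) measurable
      ultimately have "integrable M (\<lambda>l. gap l x)"
        by (intro integrableI_nonneg AE_I2 gap_nonneg) (auto simp: space_M less_top)
      from Bochner_Integration.integrable_add[OF this r(1)] False show False
        by (simp add: gap)
    qed
    ultimately show ?thesis by simp
  qed
qed

end

end

text \<open>Within the positive half-line, the preimage of E under division by delta is the dilate
  of E by delta.\<close>

lemma distr_scale_eq:
  fixes \<mu> \<nu> :: "real measure"
  assumes mu: "sets \<mu> = sets borel_pos" and delta: "\<delta> > 0" and sets_nu: "sets \<nu> = sets borel_pos"
    and nu: "\<And>E. E \<in> sets borel_pos \<Longrightarrow> emeasure \<nu> E = emeasure \<mu> ((\<lambda>x. \<delta> * x) ` E)"
  shows "\<nu> = distr \<mu> borel_pos (\<lambda>l. l / \<delta>)"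
proof (rule measure_eqI)
  fix E assume "E \<in> sets \<nu>"
  then have E: "E \<in> sets borel_pos" by (simp add: sets_nu)
  then have E_pos: "E \<subseteq> {0<..}"
    by (auto simp: sets_restrict_space)
  have space: "space \<mu> = {0<..}"
    using sets_eq_imp_space_eq[OF mu] by (simp add: space_restrict_space)
  have meas: "(\<lambda>l. l / \<delta>) \<in> \<mu> \<rightarrow>\<^sub>M borel_pos"
  proof (rule measurable_restrict_space2)
    show "(\<lambda>l. l / \<delta>) \<in> borel_measurable \<mu>"
      unfolding measurable_cong_sets[OF mu refl] by (intro measurable_restrict_space1) measurable
  qed (use delta in \<open>auto simp: space\<close>)
  have "(\<lambda>l. l / \<delta>) -` E \<inter> space \<mu> = (\<lambda>x. \<delta> * x) ` E"
  proof (intro equalityI subsetI)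
    fix l assume "l \<in> (\<lambda>l. l / \<delta>) -` E \<inter> space \<mu>"
    then have "l = \<delta> * (l / \<delta>)" "l / \<delta> \<in> E" using delta by auto
    then show "l \<in> (\<lambda>x. \<delta> * x) ` E" by blast
  next
    fix l assume "l \<in> (\<lambda>x. \<delta> * x) ` E"
    then show "l \<in> (\<lambda>l. l / \<delta>) -` E \<inter> space \<mu>"
      using delta E_pos by (auto simp: space)
  qed
  then show "emeasure \<nu> E = emeasure (distr \<mu> borel_pos (\<lambda>l. l / \<delta>)) E"
    by (simp add: emeasure_distr[OF meas E] nu[OF E])
qed (simp add: sets_nu)

theorem theorem1p3:
  fixes \<mu> \<nu> :: "real measure" and \<delta> :: real
  assumes mu: "admissible_measure \<mu>"
    and delta: "\<delta> > 0"
    and sets_nu: "sets \<nu> = sets borel_pos"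
    and nu: "\<And>E. E \<in> sets borel_pos \<Longrightarrow> emeasure \<nu> E = emeasure \<mu> ((\<lambda>x. \<delta> * x) ` E)"
  shows
    "(real_entire (\<lambda>z. G_meas \<nu> (of_real \<delta> * z)) \<and>
      exp_type_at_most (\<lambda>z. G_meas \<nu> (of_real \<delta> * z)) (2 * pi * \<delta>)) \<and>

     (\<forall>x::real. x \<noteq> 0 \<longrightarrow>
       (\<forall>l>0. 0 \<le> exp (- l * \<bar>x\<bar>) - Re (L_fun (l / \<delta>) (of_real (\<delta> * x)))) \<and>
       integrable \<mu> (\<lambda>l. exp (- l * \<bar>x\<bar>) - Re (L_fun (l / \<delta>) (of_real (\<delta> * x))))) \<and>

     (\<forall>x::real. 0 \<le> minorant_gap \<mu> \<nu> \<delta> x \<and>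
       minorant_gap \<mu> \<nu> \<delta> x =
         ereal_integral \<mu> (\<lambda>l. ereal (exp (- l * \<bar>x\<bar>) - Re (L_fun (l / \<delta>) (of_real (\<delta> * x)))))) \<and>

     (ereal_integrable lborel (minorant_gap \<mu> \<nu> \<delta>) \<and>
      integrable \<mu> (\<lambda>l. 2 / l - 1 / \<delta> * (1 / sinh (l / (2 * \<delta>)))) \<and>
      ereal_integral lborel (minorant_gap \<mu> \<nu> \<delta>) =
        ereal (\<integral>l. 2 / l - 1 / \<delta> * (1 / sinh (l / (2 * \<delta>))) \<partial>\<mu>)) \<and>

     (\<forall>t::real. t \<noteq> 0 \<longrightarrow>
       integrable \<mu> (\<lambda>l. 2 * l / (l\<^sup>2 + 4 * pi\<^sup>2 * t\<^sup>2)) \<and>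
       integrable \<mu> (\<lambda>l. L_hat (l / \<delta>) (t / \<delta>)) \<and>
       (\<integral>x. of_real (real_of_ereal (minorant_gap \<mu> \<nu> \<delta> x)) * e2pi (of_real (- t * x)) \<partial>lborel) =
         of_real (\<integral>l. 2 * l / (l\<^sup>2 + 4 * pi\<^sup>2 * t\<^sup>2) \<partial>\<mu>)
         - of_real (1 / \<delta>) * (\<integral>l. L_hat (l / \<delta>) (t / \<delta>) \<partial>\<mu>))"
proof -
  interpret decay_measure \<mu>
    by (rule admissible_imp_decay_measure[OF mu])
  interpret scaled_decay_measure \<mu> \<delta>
    by unfold_locales (rule delta)
  have nu_distr: "\<nu> = distr \<mu> borel_pos (\<lambda>l. l / \<delta>)"
    by (rule distr_scale_eq[OF sets_M delta sets_nu nu])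
  interpret \<nu>: decay_measure \<nu>
    by (rule decay_measure_nu[OF nu_distr])
  note mgap = minorant_gap_eq[OF nu_distr]
  have mgap_fun: "minorant_gap \<mu> \<nu> \<delta> = (\<lambda>x. enn2ereal (\<integral>\<^sup>+l. ennreal (gap l x) \<partial>\<mu>))"
    by (rule ext) (rule mgap)
  have gap_L: "exp (- l * \<bar>x\<bar>) - Re (L_fun (l / \<delta>) (of_real (\<delta> * x))) = gap l x" if "l \<in> space \<mu>" for l x
    using that by (intro gap_eq_L_fun) (simp add: space_M)
  interpret sigma_finite_measure \<mu> by (rule sigma_finite)
  have part1: "real_entire (\<lambda>z. G_meas \<nu> (of_real \<delta> * z))"
  proof -
    have "G_meas \<nu> holomorphic_on UNIV"
      using \<nu>.real_entire_G_meas by (simp add: real_entire_def)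
    moreover have "(\<lambda>z. of_real \<delta> * z) holomorphic_on UNIV"
      by (intro holomorphic_intros)
    ultimately have "(\<lambda>z. G_meas \<nu> (of_real \<delta> * z)) holomorphic_on UNIV"
      using holomorphic_on_compose_gen[of "\<lambda>z. of_real \<delta> * z" UNIV "G_meas \<nu>" UNIV]
      by (simp add: o_def)
    then show ?thesis
      using \<nu>.real_entire_G_meas unfolding real_entire_def by (simp flip: of_real_mult)
  qed
  have part1': "exp_type_at_most (\<lambda>z. G_meas \<nu> (of_real \<delta> * z)) (2 * pi * \<delta>)"
    by (rule exp_type_at_most_scale[OF \<nu>.exp_type_G_meas delta])
  have part2: "integrable \<mu> (\<lambda>l. exp (- l * \<bar>x\<bar>) - Re (L_fun (l / \<delta>) (of_real (\<delta> * x))))" if "x \<noteq> 0" for x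
    using integrable_gap[OF that] by (subst Bochner_Integration.integrable_cong[OF refl gap_L])
  have part2': "0 \<le> exp (- l * \<bar>x\<bar>) - Re (L_fun (l / \<delta>) (of_real (\<delta> * x)))" if "l > 0" for l x
    using gap_nonneg[OF that] by (simp only: gap_eq_L_fun[OF that])
  have part3: "minorant_gap \<mu> \<nu> \<delta> x =
         ereal_integral \<mu> (\<lambda>l. ereal (exp (- l * \<bar>x\<bar>) - Re (L_fun (l / \<delta>) (of_real (\<delta> * x)))))" for x
  proof -
    have "ereal_integral \<mu> (\<lambda>l. ereal (exp (- l * \<bar>x\<bar>) - Re (L_fun (l / \<delta>) (of_real (\<delta> * x)))))
        = ereal_integral \<mu> (\<lambda>l. ereal (gap l x))"
      by (intro ereal_integral_cong) (simp only: gap_L)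
    also have "\<dots> = enn2ereal (\<integral>\<^sup>+l. ennreal (gap l x) \<partial>\<mu>)"
      by (rule ereal_integral_nonneg) (simp add: space_M gap_nonneg)
    finally show ?thesis by (simp only: mgap)
  qed
  have "(\<lambda>x. \<integral>\<^sup>+l. ennreal (gap l x) \<partial>\<mu>) \<in> borel_measurable lborel"
    by measurable
  then have part4: "ereal_integrable lborel (minorant_gap \<mu> \<nu> \<delta>)"
    unfolding ereal_integrable_def mgap_fun using nn_integral_gap_eq by simp
  have part4': "ereal_integral lborel (minorant_gap \<mu> \<nu> \<delta>) =
      ereal (\<integral>l. 2 / l - 1 / \<delta> * (1 / sinh (l / (2 * \<delta>))) \<partial>\<mu>)"
  proof -
    have "(\<integral>\<^sup>+x. e2ennreal (- enn2ereal (\<integral>\<^sup>+l. ennreal (gap l x) \<partial>\<mu>)) \<partial>lborel) = 0"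
      by (simp add: e2ennreal_neg)
    \<comment> \<open>Needed because \<open>ennreal\<close> cuts negative reals off at 0.\<close>
    moreover have "0 \<le> (\<integral>l. 2 / l - 1 / \<delta> * (1 / sinh (l / (2 * \<delta>))) \<partial>\<mu>)"
    proof (intro integral_nonneg_AE AE_I2)
      fix l assume "l \<in> space \<mu>"
      then have "l > 0" by (simp add: space_M)
      then show "0 \<le> 2 / l - 1 / \<delta> * (1 / sinh (l / (2 * \<delta>)))"
        using integral_nonneg_AE[where M = lborel and f = "gap l"] gap_nonneg[of l]
          has_bochner_integral_integral_eq[OF has_bochner_integral_gap[of l]] by simp
    qed
    ultimately show ?thesis
      unfolding ereal_integral_def mgap_fun e2ennreal_enn2ereal nn_integral_gap_eq
      by (simp add: zero_ennreal.rep_eq)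
  qed
  \<comment> \<open>\<open>real_of_ereal\<close> sends the possible value infinity at x = 0 to 0;
    one point does not change the integral.\<close>
  have part5: "(\<integral>x. of_real (real_of_ereal (minorant_gap \<mu> \<nu> \<delta> x)) * e2pi (of_real (- t * x)) \<partial>lborel) =
         of_real (\<integral>l. 2 * l / (l\<^sup>2 + 4 * pi\<^sup>2 * t\<^sup>2) \<partial>\<mu>)
         - of_real (1 / \<delta>) * (\<integral>l. L_hat (l / \<delta>) (t / \<delta>) \<partial>\<mu>)" if "t \<noteq> 0" for t
    unfolding mgap real_of_ereal_enn2ereal by (rule fourier_gap(3)[OF that])
  show ?thesis
    by (intro conjI allI impI part1 part1' part2 part2' part3 part4 part4' part5
        integrable_csch fourier_gap(1,2)) (assumption | simp only: mgap enn2ereal_nonneg)+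
qed

end
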